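(* Let $C$ be a smooth closed Jordan curve in $\mathbb{C}$ encircling $0$, with interior $\Omega$ of area $A(\Omega)$. The $\tau$-function $\tau=\tau(C)=\langle\mathbf 1\rangle_C/\langle\mathbf 1\rangle_0$ of the contour $C$ is well-defined and is given explicitly by $$\log\tau=-\frac{1}{\pi^2}\int_\Omega\int_\Omega\log|z-w|\,d^2z\,d^2w+\frac{2}{\pi^2}A(\Omega)\int_\Omega\log|z|\,d^2z=-\frac{1}{\pi^2}\int_\Omega\int_\Omega\log\Big|\frac1z-\frac1w\Big|\,d^2z\,d^2w .$$
   Context: $d^2z=|dz\wedge d\bar z|/2$ is Lebesgue measure on $\mathbb{C}$. For $\varphi\in C^\infty(\mathbb{P}^1,\mathbb{R})$, $$S_0(\varphi)=\frac18\int_{\mathbb{P}^1}d\varphi\wedge\ast d\varphi=\frac i4\int_{\mathbb{P}^1}\partial\varphi\wedge\bar\partial\varphi,\qquad S_{top}(\varphi)=A(\Omega)\varphi(0)-\int_\Omega\varphi\,d^2z,$$ and $S_C=S_0+S_{top}$. Formally $\langle\mathbf 1\rangle_0=\int_{C^\infty(\mathbb{P}^1,\mathbb{R})/\mathbb{R}}[\mathcal{D}\varphi]\,e^{-\frac1\pi S_0(\varphi)}$ and $\langle\mathbf 1\rangle_C=\int_{C^\infty(\mathbb{P}^1,\mathbb{R})/\mathbb{R}}[\mathcal{D}\varphi]\,e^{-\frac1\pi S_C(\varphi)}$. Rigorous definition. Choose a conformal metric $ds^2=\rho(z)|dz|^2$ on $\mathbb{P}^1$ with Laplacian $\Delta_0=-\rho^{-1}\partial^2/\partial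 z\partial\bar z$ acting on functions; then $\langle\mathbf 1\rangle_0=(\mathrm{Area}(\mathbb{P}^1)/\det_\zeta\Delta_0)^{1/2}$, where $\det_\zeta$ is the zeta-function determinant. Approximate, in the distributional sense, the characteristic function $\chi_\Omega$ of $\Omega$ and the Dirac delta-function $\delta_0$ at $0$ (with respect to $d^2z$) by smooth functions $\chi^{(\epsilon)}_\Omega$ and $\delta_0^{(\epsilon)}$ with compact supports satisfying $\int_{\mathbb{C}}(A(\Omega)\delta_0^{(\epsilon)}-\chi_\Omega^{(\epsilon)})\,d^2z=0$. Put $S_C^{(\epsilon)}(\varphi)=S_0(\varphi)+\int_{\mathbb{C}}(A(\Omega)\delta_0^{(\epsilon)}-\chi_\Omega^{(\epsilon)})\varphi\,d^2z$ and $$\langle\mathbf 1\rangle_C:=\lim_{\epsilon\to0}\exp\Big\{\frac{A(\Omega)^2}{\pi^2}\int_{\mathbb{C}}\int_{\mathbb{C}}\log|z-w|\,\delta_0^{(\epsilon)}(z)\delta_0^{(\epsilon)}(w)\,d^2z\,d^2w\Big\}\int_{C^\infty(\mathbb{P}^1,\mathbb{R})/\mathbb{R}}[\mathcal{D}\varphi]\,e^{-\frac1\pi S_C^{(\epsilon)}(\varphi)} .$$ The last integral is the standard Gaussian integral with a linear term, computed by the shift of variables $\varphi=\Phi^{(\epsilon)}+\tilde\varphi$ that removes the terms linear in $\tilde\varphi$; i.e. it equals $\langle\mathbf 1\rangle_0\,e^{-\frac1\pi S_C^{(\epsilon)}(\Phi^{(\epsilon)})}$, where $\Phi^{(\epsilon)}$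 is the critical point of $S_C^{(\epsilon)}$ normalized by $\Phi^{(\epsilon)}(\infty)=0$.
   Formalization: The approximations of the characteristic function and delta function are also required, for small epsilon, to have a common compact support, a uniform bound and an L1 bound respectively; with distributional convergence alone the limit depends on the choice. *)

theory Defs
  imports "HOL-Complex_Analysis.Complex_Analysis" "HOL-Library.Function_Algebras"
begin

section \<open>Smooth functions and smooth Jordan curves\<close>

primrec C_k :: "nat \<Rightarrow> ('a::euclidean_space \<Rightarrow> 'b::real_normed_vector) \<Rightarrow> bool" where
  "C_k 0 f \<longleftrightarrow> continuous_on UNIV f"
| "C_k (Suc k) f \<longleftrightarrow>
     (\<forall>x. f differentiable (at x)) \<and>
     (\<forall>b\<in>Basis. C_k k (\<lambda>x. frechet_derivative f (at x) b))"

definition smooth :: "('a::euclidean_space \<Rightarrow> 'b::real_normed_vector) \<Rightarrow> bool" where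
  "smooth f \<longleftrightarrow> (\<forall>k. C_k k f)"

definition compactly_supported :: "('a::topological_space \<Rightarrow> real) \<Rightarrow> bool" where
  "compactly_supported f \<longleftrightarrow> compact (closure {x. f x \<noteq> 0})"

definition smooth_jordan_curve :: "complex set \<Rightarrow> bool" where
  "smooth_jordan_curve C \<longleftrightarrow>
     (\<exists>\<gamma> :: real \<Rightarrow> complex. smooth \<gamma> \<and> (\<forall>t. \<gamma> (t + 1) = \<gamma> t) \<and> inj_on \<gamma> {0..<1} \<and>
        (\<forall>t. vector_derivative \<gamma> (at t) \<noteq> 0) \<and> C = range \<gamma>)"


section \<open>The Riemann sphere\<close>

text \<open>The projective line is the type \<open>complex option\<close>, with \<open>None\<close> as the point at infinity;
  its two standard charts are \<open>Some\<close> and \<open>chart_inf\<close>.\<close>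

definition chart_inf :: "complex \<Rightarrow> complex option" where
  "chart_inf w = (if w = 0 then None else Some (1 / w))"

definition smooth_P1 :: "(complex option \<Rightarrow> real) \<Rightarrow> bool" where
  "smooth_P1 \<phi> \<longleftrightarrow> smooth (\<phi> \<circ> Some) \<and> smooth (\<phi> \<circ> chart_inf)"

text \<open>The density \<open>\<rho>\<close> of a smooth metric \<open>ds\<^sup>2 = \<rho>(z) |dz|\<^sup>2\<close> on the sphere, in the affine chart.
  For \<open>w = 1/z\<close> one has \<open>|dz|\<^sup>2 = |w|\<^sup>-\<^sup>4 |dw|\<^sup>2\<close>, so \<open>\<rho>'\<close> is the density in the chart at infinity.\<close>

definition conformal_metric :: "(complex \<Rightarrow> real) \<Rightarrow> bool" where
  "conformal_metric \<rho> \<longleftrightarrow>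
     smooth \<rho> \<and> (\<forall>z. \<rho> z > 0) \<and>
     (\<exists>\<rho>'. smooth \<rho>' \<and> (\<forall>w. \<rho>' w > 0) \<and> (\<forall>w. w \<noteq> 0 \<longrightarrow> \<rho>' w = \<rho> (1 / w) / cmod w ^ 4))"

definition area_P1 :: "(complex \<Rightarrow> real) \<Rightarrow> real" where
  "area_P1 \<rho> = (\<integral>z. \<rho> z \<partial>lborel)"


section \<open>The zeta-function determinant of the Laplacian\<close>

text \<open>\<open>\<partial>\<^sup>2/\<partial>z\<partial>z\<close>-bar is a quarter of the Euclidean Laplacian, and \<open>Basis = {1, \<i>}\<close> on the
  complex numbers.\<close>

definition laplacian :: "(complex \<Rightarrow> real) \<Rightarrow> (complex \<Rightarrow> real) \<Rightarrow> complex \<Rightarrow> real" where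
  "laplacian \<rho> f z =
     - (1 / \<rho> z) * ((1 / 4) *
        (\<Sum>b\<in>Basis. frechet_derivative (\<lambda>x. frechet_derivative f (at x) b) (at z) b))"

text \<open>The eigenvalue equation at the point at infinity follows by continuity.\<close>

definition eigenspace :: "(complex \<Rightarrow> real) \<Rightarrow> real \<Rightarrow> (complex option \<Rightarrow> real) set" where
  "eigenspace \<rho> l = {\<phi>. smooth_P1 \<phi> \<and> (\<forall>z. laplacian \<rho> (\<phi> \<circ> Some) z = l * \<phi> (Some z))}"

definition eigenvalue_multiplicity :: "(complex \<Rightarrow> real) \<Rightarrow> real \<Rightarrow> nat" where
  "eigenvalue_multiplicity \<rho> l =
     vector_space.dim (\<lambda>(c::real) (\<phi> :: complex option \<Rightarrow> real) p. c * \<phi> p) (eigenspace \<rho> l)"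

definition spectral_zeta :: "(complex \<Rightarrow> real) \<Rightarrow> complex \<Rightarrow> complex" where
  "spectral_zeta \<rho> s =
     (\<Sum>\<^sub>\<infinity>l\<in>{l. l > 0 \<and> eigenspace \<rho> l \<noteq> {0}}.
        of_nat (eigenvalue_multiplicity \<rho> l) * complex_of_real l powr (- s))"

text \<open>On a closed surface the zeta series converges for \<open>Re s > 1\<close> and continues
  holomorphically to the plane without \<open>1\<close>. The continuation is unique there, and real on the real
  axis, so taking the real part of its derivative at \<open>0\<close> only adjusts the type.\<close>

definition zeta_continuation :: "(complex \<Rightarrow> real) \<Rightarrow> complex \<Rightarrow> complex" where
  "zeta_continuation \<rho> =
     (SOME Z. Z holomorphic_on (UNIV - {1}) \<and> (\<forall>s. Re s > 1 \<longrightarrow> Z s = spectral_zeta \<rho> s))"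

definition det_zeta :: "(complex \<Rightarrow> real) \<Rightarrow> real" where
  "det_zeta \<rho> = exp (- Re (deriv (zeta_continuation \<rho>) 0))"

definition partition_0 :: "(complex \<Rightarrow> real) \<Rightarrow> real" where
  "partition_0 \<rho> = sqrt (area_P1 \<rho> / det_zeta \<rho>)"


section \<open>The regularized theory\<close>

text \<open>\<open>d\<phi> \<and> *d\<phi>\<close> is conformally invariant and equals the squared Euclidean gradient times Lebesgue
  measure in the affine chart, whose complement is a null set.\<close>

definition S_0 :: "(complex option \<Rightarrow> real) \<Rightarrow> real" where
  "S_0 \<phi> = (1 / 8) *
     (\<integral>z. (\<Sum>b\<in>Basis. (frechet_derivative (\<phi> \<circ> Some) (at z) b)\<^sup>2) \<partial>lborel)"

abbreviation area :: "complex set \<Rightarrow> real" where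
  "area \<Omega> \<equiv> measure lborel \<Omega>"

text \<open>Here \<open>chi\<close> and \<open>\<delta>\<close> are the regularizations at one fixed \<open>\<epsilon>\<close>.\<close>

definition S_reg ::
  "complex set \<Rightarrow> (complex \<Rightarrow> real) \<Rightarrow> (complex \<Rightarrow> real) \<Rightarrow> (complex option \<Rightarrow> real) \<Rightarrow> real" where
  "S_reg \<Omega> chi \<delta> \<phi> = S_0 \<phi> + (\<integral>z. (area \<Omega> * \<delta> z - chi z) * \<phi> (Some z) \<partial>lborel)"

definition critical_point ::
  "((complex option \<Rightarrow> real) \<Rightarrow> real) \<Rightarrow> (complex option \<Rightarrow> real) \<Rightarrow> bool" where
  "critical_point S \<Phi> \<longleftrightarrow>
     smooth_P1 \<Phi> \<and>
     (\<forall>\<psi>. smooth_P1 \<psi> \<longrightarrow> ((\<lambda>t::real. S (\<lambda>p. \<Phi> p + t * \<psi> p)) has_real_derivative 0) (at 0))"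

definition normalized_critical_point ::
  "((complex option \<Rightarrow> real) \<Rightarrow> real) \<Rightarrow> complex option \<Rightarrow> real" where
  "normalized_critical_point S = (THE \<Phi>. critical_point S \<Phi> \<and> \<Phi> None = 0)"

text \<open>The Gaussian functional integral of \<open>exp (- S/\<pi>)\<close> over smooth functions modulo constants, for
  \<open>S\<close> equal to \<open>S_0\<close> plus a linear term that vanishes on constants.\<close>

definition gaussian_integral ::
  "(complex \<Rightarrow> real) \<Rightarrow> ((complex option \<Rightarrow> real) \<Rightarrow> real) \<Rightarrow> real" where
  "gaussian_integral \<rho> S = partition_0 \<rho> * exp (- (1 / pi) * S (normalized_critical_point S))"

definition partition_reg ::
  "(complex \<Rightarrow> real) \<Rightarrow> complex set \<Rightarrow> (complex \<Rightarrow> real) \<Rightarrow> (complex \<Rightarrow> real) \<Rightarrow> real" where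
  "partition_reg \<rho> \<Omega> chi \<delta> =
     exp ((area \<Omega>)\<^sup>2 / pi\<^sup>2 *
       (\<integral>z. (\<integral>w. ln (cmod (z - w)) * \<delta> z * \<delta> w \<partial>lborel) \<partial>lborel)) *
     gaussian_integral \<rho> (S_reg \<Omega> chi \<delta>)"


section \<open>Admissible regularizations and the tau-function\<close>

text \<open>Distributional convergence, with neutrality. The last clause (a common compact support, a
  uniform bound on \<open>chi\<close> and an \<open>L\<^sup>1\<close> bound on \<open>\<delta>\<close>, for small \<open>\<epsilon>\<close>) holds for mollifications. It
  cannot be dropped: the energy is quadratic, so it is not continuous for distributional convergence
  alone. Adding \<open>\<psi>(z) cos (Re z / \<epsilon>) / \<epsilon>\<close> to \<open>chi\<close> with \<open>\<psi>\<close> a fixed bump function (and restoring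
  neutrality by a vanishingly small correction) changes the limit of the energy but not the
  distributional limit.\<close>

definition admissible_regularization ::
  "complex set \<Rightarrow> (real \<Rightarrow> complex \<Rightarrow> real) \<Rightarrow> (real \<Rightarrow> complex \<Rightarrow> real) \<Rightarrow> bool" where
  "admissible_regularization \<Omega> chi \<delta> \<longleftrightarrow>
     (\<forall>\<epsilon>>0. smooth (chi \<epsilon>) \<and> compactly_supported (chi \<epsilon>) \<and>
            smooth (\<delta> \<epsilon>) \<and> compactly_supported (\<delta> \<epsilon>) \<and>
            (\<integral>z. area \<Omega> * \<delta> \<epsilon> z - chi \<epsilon> z \<partial>lborel) = 0) \<and>
     (\<forall>\<psi> :: complex \<Rightarrow> real. smooth \<psi> \<and> compactly_supported \<psi> \<longrightarrow>
        ((\<lambda>\<epsilon>. \<integral>z. chi \<epsilon> z * \<psi> z \<partial>lborel) \<longlongrightarrow> (\<integral>z\<in>\<Omega>. \<psi> z \<partial>lborel)) (at_right 0) \<and>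
        ((\<lambda>\<epsilon>. \<integral>z. \<delta> \<epsilon> z * \<psi> z \<partial>lborel) \<longlongrightarrow> \<psi> 0) (at_right 0)) \<and>
     (\<exists>R M. \<forall>\<^sub>F \<epsilon> in at_right 0.
        (\<forall>z. cmod z > R \<longrightarrow> chi \<epsilon> z = 0 \<and> \<delta> \<epsilon> z = 0) \<and>
        (\<forall>z. \<bar>chi \<epsilon> z\<bar> \<le> M) \<and> (\<integral>z. \<bar>\<delta> \<epsilon> z\<bar> \<partial>lborel) \<le> M)"

text \<open>\<open>t\<close> is the value of the tau-function of \<open>C\<close> if, for every choice of metric and of
  regularization, the critical points and the limit \<open>Z\<close> defining the partition function of \<open>C\<close>
  exist, and \<open>t\<close> is the resulting ratio. Since such choices exist, unique existence of \<open>t\<close> says that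
  the tau-function is well-defined.\<close>

definition is_tau :: "complex set \<Rightarrow> real \<Rightarrow> bool" where
  "is_tau C t \<longleftrightarrow>
     (\<forall>\<rho> chi \<delta>. conformal_metric \<rho> \<and> admissible_regularization (inside C) chi \<delta> \<longrightarrow>
        (\<forall>\<epsilon>>0. \<exists>!\<Phi>. critical_point (S_reg (inside C) (chi \<epsilon>) (\<delta> \<epsilon>)) \<Phi> \<and> \<Phi> None = 0) \<and>
        (\<exists>Z. ((\<lambda>\<epsilon>. partition_reg \<rho> (inside C) (chi \<epsilon>) (\<delta> \<epsilon>)) \<longlongrightarrow> Z) (at_right 0) \<and>
             t = Z / partition_0 \<rho>))"

definition tau :: "complex set \<Rightarrow> real" where
  "tau C = (THE t. is_tau C t)"

end

theory Submission
  imports Defs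
begin

text \<open>
  Write \<open>A\<close> for the area of \<open>\<Omega>\<close> and \<open>f = A \<delta> - \<chi>\<close> for the regularized source. The action \<open>S_0 + \<integral>f \<phi>\<close> is
  a quadratic form plus a linear one, so \<open>\<Phi>\<close> is critical iff
  \<open>(1/4) \<integral>\<nabla>\<Phi>\<cdot>\<nabla>\<psi> + \<integral>f \<psi> = 0\<close> for every smooth \<open>\<psi>\<close> on the sphere, the weak form of \<open>\<Delta>\<Phi> = 4 f\<close>.
  Two solutions differ by a function with vanishing gradient, hence agree if both vanish at infinity.
  A solution is the logarithmic potential \<open>\<Phi>(z) = (2/\<pi>) \<integral>ln|z - w| f(w)\<close>: since \<open>\<integral>f = 0\<close>, the
  growth \<open>ln|z|\<close> cancels, and near infinity \<open>\<Phi>\<close> is the real part of a holomorphic function of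
  \<open>1/z\<close>. Taking \<open>\<psi> = \<Phi>\<close> shows that the critical value is \<open>(1/2) \<integral>f \<Phi> = (1/\<pi>) E(f, f)\<close>, where
  \<open>E(a, b) = \<integral>\<integral>ln|z - w| a(z) b(w)\<close>. Expanding,
  \<open>E(f, f) = A\<^sup>2 E(\<delta>, \<delta>) - 2 A E(\<delta>, \<chi>) + E(\<chi>, \<chi>)\<close>, and the divergent term \<open>E(\<delta>, \<delta>)\<close> is cancelled
  by the prefactor in the definition of the partition function. What remains is
  \<open>\<langle>1\<rangle>_0 exp (- (E(\<chi>, \<chi>) - 2 A E(\<delta>, \<chi>)) / \<pi>\<^sup>2)\<close>, and the first factor cancels in the quotient
  because it is positive.

  Two analytic facts carry the argument. The first is the weak equation (\<open>log_potential_weak_equation\<close>).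
  Integration by parts turns the gradient of the potential into the integral of \<open>f\<close> against the kernel
  \<open>(z - w)/|z - w|\<^sup>2\<close>; after Fubini one needs
  \<open>\<integral>\<nabla>\<psi>(z)\<cdot>(z - w)/|z - w|\<^sup>2 = 2\<pi> (\<psi>(\<infinity>) - \<psi>(w))\<close>, which \<open>radial_derivative_integral\<close> gets from the
  fundamental theorem of calculus along the rays from \<open>w\<close>.
  The second is the continuity of \<open>E\<close> along regularizations (\<open>log_energy_tendsto\<close>): on a bounded set
  the logarithm differs from a smooth kernel by at most \<open>\<eta>/|z - w|\<close>, whose integral is \<open>O(\<eta>)\<close> because
  \<open>\<chi>\<close> is uniformly bounded; for a smooth kernel the potentials of \<open>\<chi>\<close> are equi-Lipschitz, so weak
  convergence makes them converge uniformly on compact sets, and they can be paired with the \<open>L\<^sup>1\<close>-bounded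
  \<open>\<delta>\<close> or \<open>\<chi>\<close>. Hence \<open>E(\<chi>, \<chi>)\<close> and \<open>E(\<delta>, \<chi>)\<close> tend to \<open>\<integral>\<integral>ln|z - w|\<close> over \<open>\<Omega> \<times> \<Omega>\<close> and to \<open>\<integral>ln|w|\<close>
  over \<open>\<Omega>\<close>.

  Since a metric and a regularization exist (\<open>conformal_metric_exists\<close>,
  \<open>admissible_regularization_exists\<close>), the value of \<open>\<tau>\<close> is unique. The second formula is
  \<open>ln|1/z - 1/w| = ln|z - w| - ln|z| - ln|w|\<close> integrated over \<open>\<Omega> \<times> \<Omega>\<close>. The curve
  enters through its compactness, which makes \<open>\<Omega>\<close> open and bounded.
\<close>

section \<open>Smooth functions on open sets\<close>

abbreviation dd :: "('a::euclidean_space \<Rightarrow> 'b::real_normed_vector) \<Rightarrow> 'a \<Rightarrow> 'a \<Rightarrow> 'b" where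
  "dd f x \<equiv> frechet_derivative f (at x)"

text \<open>Inversion, the logarithm and a potential near infinity are smooth only on open subsets, hence a
  localization of the global notion; it is only used for open sets, where the full derivative is meaningful.\<close>

primrec C_k_on :: "nat \<Rightarrow> 'a::euclidean_space set \<Rightarrow> ('a \<Rightarrow> 'b::real_normed_vector) \<Rightarrow> bool" where
  "C_k_on 0 U f \<longleftrightarrow> continuous_on U f"
| "C_k_on (Suc k) U f \<longleftrightarrow>
     (\<forall>x\<in>U. f differentiable (at x)) \<and>
     (\<forall>b\<in>Basis. C_k_on k U (\<lambda>x. dd f x b))"

definition smooth_on :: "'a::euclidean_space set \<Rightarrow> ('a \<Rightarrow> 'b::real_normed_vector) \<Rightarrow> bool" where
  "smooth_on U f \<longleftrightarrow> (\<forall>k. C_k_on k U f)"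

lemma C_k_eq_C_k_on: "C_k k f \<longleftrightarrow> C_k_on k UNIV f"
  by (induction k arbitrary: f) auto

lemma smooth_eq_smooth_on: "smooth f \<longleftrightarrow> smooth_on UNIV f"
  by (simp add: smooth_def smooth_on_def C_k_eq_C_k_on)

lemma C_k_on_cong:
  assumes "open U" "\<And>x. x \<in> U \<Longrightarrow> f x = g x" "C_k_on k U f"
  shows "C_k_on k U g"
  using assms(2,3)
proof (induction k arbitrary: f g)
  case 0
  then show ?case by (simp cong: continuous_on_cong)
next
  case (Suc k)
  have D: "(g has_derivative dd f x) (at x)" if "x \<in> U" for x
  proof (rule has_derivative_transform_within_open[OF _ \<open>open U\<close> that])
    show "(f has_derivative dd f x) (at x)"
      using Suc.prems(2) that frechet_derivative_works by auto
  qed (use Suc.prems in auto)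
  have eq: "dd g x = dd f x" if "x \<in> U" for x
    using D[OF that] by (rule frechet_derivative_at[symmetric])
  show ?case
    using Suc.prems D eq Suc.IH[of "\<lambda>x. dd f x _" "\<lambda>x. dd g x _"]
    by (auto simp: differentiable_def)
qed

lemma C_k_on_Un:
  "open U \<Longrightarrow> open V \<Longrightarrow> C_k_on k U f \<Longrightarrow> C_k_on k V f \<Longrightarrow> C_k_on k (U \<union> V) f"
  by (induction k arbitrary: f) (auto intro: continuous_on_open_Un)

lemma C_k_on_SucI:
  assumes "open U" "\<And>x. x \<in> U \<Longrightarrow> (f has_derivative D x) (at x)"
    and "\<And>b. b \<in> Basis \<Longrightarrow> C_k_on k U (\<lambda>x. D x b)"
  shows "C_k_on (Suc k) U f"
proof -
  have "D x = dd f x" if "x \<in> U" for x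
    using assms(2)[OF that] by (rule frechet_derivative_at)
  then show ?thesis
    using assms C_k_on_cong[OF assms(1), of "\<lambda>x. D x _" "\<lambda>x. dd f x _" k]
    by (auto simp: differentiable_def)
qed

lemma C_k_on_Suc_imp: "open U \<Longrightarrow> C_k_on (Suc k) U f \<Longrightarrow> C_k_on k U f"
proof (induction k arbitrary: f)
  case 0
  then show ?case
    by (auto intro!: continuous_at_imp_continuous_on differentiable_imp_continuous_within)
next
  case (Suc k)
  then show ?case by (metis C_k_on.simps(2))
qed

lemma C_k_on_Suc_D:
  assumes "C_k_on (Suc k) U f" "x \<in> U"
  shows "(f has_derivative dd f x) (at x)"
  using assms frechet_derivative_works by auto

lemma C_k_on_const: "C_k_on k U (\<lambda>x. c)"
  by (induction k arbitrary: c) auto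

lemma C_k_on_add:
  assumes "open U"
  shows "C_k_on k U f \<Longrightarrow> C_k_on k U g \<Longrightarrow> C_k_on k U (\<lambda>x. f x + g x)"
proof (induction k arbitrary: f g)
  case 0
  then show ?case by (auto intro: continuous_on_add)
next
  case (Suc k)
  show ?case
    by (rule C_k_on_SucI[OF assms has_derivative_add[OF C_k_on_Suc_D[OF Suc.prems(1)] C_k_on_Suc_D[OF Suc.prems(2)]]])
       (use Suc in auto)
qed

lemma C_k_on_sum:
  assumes "open U" "\<And>i. i \<in> I \<Longrightarrow> C_k_on k U (f i)"
  shows "C_k_on k U (\<lambda>x. \<Sum>i\<in>I. f i x)"
  using assms(2) by (induction I rule: infinite_finite_induct)
    (auto intro: C_k_on_const C_k_on_add[OF assms(1)])

lemma C_k_on_linear: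
  assumes "bounded_linear L" "open U"
  shows "C_k_on k U f \<Longrightarrow> C_k_on k U (\<lambda>x. L (f x))"
proof (induction k arbitrary: f)
  case 0
  then show ?case using assms by (auto intro: bounded_linear.continuous_on)
next
  case (Suc k)
  show ?case
    by (rule C_k_on_SucI[OF assms(2) bounded_linear.has_derivative[OF assms(1) C_k_on_Suc_D[OF Suc.prems]]])
       (use Suc in auto)
qed

lemma C_k_on_bilinear:
  assumes B: "bounded_bilinear B" and U: "open U"
  shows "C_k_on k U f \<Longrightarrow> C_k_on k U g \<Longrightarrow> C_k_on k U (\<lambda>x. B (f x) (g x))"
proof (induction k arbitrary: f g)
  case 0
  then show ?case using B by (auto intro: bounded_bilinear.continuous_on)
next
  case (Suc k)
  note low = Suc.prems[THEN C_k_on_Suc_imp[OF U]]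
  show ?case
    by (rule C_k_on_SucI[OF U bounded_bilinear.FDERIV[OF B C_k_on_Suc_D[OF Suc.prems(1)] C_k_on_Suc_D[OF Suc.prems(2)]]])
       (use Suc low in \<open>auto intro!: C_k_on_add[OF U]\<close>)
qed

text \<open>By the chain rule each partial derivative of \<open>f \<circ> g\<close> is a sum of products of a coordinate of a
  partial derivative of \<open>g\<close> with a partial derivative of \<open>f\<close> composed with \<open>g\<close>, and the latter falls
  under the induction hypothesis.\<close>

lemma C_k_on_compose:
  fixes f :: "'b::euclidean_space \<Rightarrow> 'c::real_normed_vector" and g :: "'a::euclidean_space \<Rightarrow> 'b"
  assumes U: "open U" and V: "open V" and gV: "g ` U \<subseteq> V"
  shows "C_k_on k V f \<Longrightarrow> C_k_on k U g \<Longrightarrow> C_k_on k U (\<lambda>x. f (g x))"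
proof (induction k arbitrary: f)
  case 0
  then show ?case using gV by (auto intro: continuous_on_compose2)
next
  case (Suc k)
  have g: "C_k_on k U g" using Suc.prems(2) C_k_on_Suc_imp[OF U] by blast
  have D: "((\<lambda>x. f (g x)) has_derivative
      (\<lambda>h. \<Sum>i\<in>Basis. (dd g x h \<bullet> i) *\<^sub>R dd f (g x) i)) (at x)"
    if x: "x \<in> U" for x
  proof -
    have gx: "g x \<in> V" using x gV by auto
    note f' = C_k_on_Suc_D[OF Suc.prems(1) gx]
    have chain: "((\<lambda>x. f (g x)) has_derivative
        (\<lambda>h. dd f (g x) (dd g x h))) (at x)"
      using has_derivative_compose[OF C_k_on_Suc_D[OF Suc.prems(2) x] f'] .
    have lin: "linear (dd f (g x))"
      using f' has_derivative_linear by blast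
    have expand: "dd f (g x) v
        = (\<Sum>i\<in>Basis. (v \<bullet> i) *\<^sub>R dd f (g x) i)" for v
      by (subst (1) euclidean_representation[of v, symmetric])
         (simp only: linear_sum[OF lin] linear_cmul[OF lin])
    show ?thesis
      by (rule has_derivative_eq_rhs[OF chain]) (rule ext, rule expand)
  qed
  show ?case
  proof (rule C_k_on_SucI[OF U D])
    fix b :: 'a assume b: "b \<in> Basis"
    show "C_k_on k U (\<lambda>x. \<Sum>i\<in>Basis. (dd g x b \<bullet> i) *\<^sub>R dd f (g x) i)"
    proof (intro C_k_on_sum[OF U] C_k_on_bilinear[OF bounded_bilinear_scaleR U])
      fix i :: 'b assume i: "i \<in> Basis"
      show "C_k_on k U (\<lambda>x. dd g x b \<bullet> i)"
        using Suc.prems(2) b by (intro C_k_on_linear[OF bounded_linear_inner_left U]) auto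
      show "C_k_on k U (\<lambda>x. dd f (g x) i)"
        using Suc.IH[OF _ g, of "\<lambda>y. dd f y i"] Suc.prems(1) i by auto
    qed
  qed
qed

lemma C_k_on_id: "open U \<Longrightarrow> C_k_on k U (\<lambda>x. x)"
proof (cases k)
  case (Suc n)
  assume U: "open U"
  show ?thesis unfolding Suc
    by (rule C_k_on_SucI[OF U has_derivative_ident]) (rule C_k_on_const)
qed (auto intro: continuous_on_id)

lemma C_k_on_holomorphic:
  assumes "open U"
  shows "f holomorphic_on U \<Longrightarrow> C_k_on k U f"
proof (induction k arbitrary: f)
  case 0
  then show ?case by (simp add: holomorphic_on_imp_continuous_on)
next
  case (Suc k)
  show ?case
  proof (rule C_k_on_SucI[OF assms])
    fix x assume "x \<in> U"
    then show "(f has_derivative (\<lambda>h. h * deriv f x)) (at x)"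
      using holomorphic_derivI[OF Suc.prems assms] unfolding has_field_derivative_def
      by (simp add: mult.commute[of _ "deriv f x"] o_def)
  next
    fix b :: complex
    show "C_k_on k U (\<lambda>x. b * deriv f x)"
      by (intro Suc.IH holomorphic_on_mult holomorphic_on_const holomorphic_deriv Suc.prems assms)
  qed
qed

lemma smooth_on_const: "smooth_on U (\<lambda>x. c)"
  by (simp add: smooth_on_def C_k_on_const)

lemma smooth_on_id: "open U \<Longrightarrow> smooth_on U (\<lambda>x. x)"
  by (simp add: smooth_on_def C_k_on_id)

lemma smooth_on_add: "open U \<Longrightarrow> smooth_on U f \<Longrightarrow> smooth_on U g \<Longrightarrow> smooth_on U (\<lambda>x. f x + g x)"
  by (simp add: smooth_on_def C_k_on_add)

lemma smooth_on_linear: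
  "bounded_linear L \<Longrightarrow> open U \<Longrightarrow> smooth_on U f \<Longrightarrow> smooth_on U (\<lambda>x. L (f x))"
  by (simp add: smooth_on_def C_k_on_linear)

lemma smooth_on_bilinear:
  "bounded_bilinear B \<Longrightarrow> open U \<Longrightarrow> smooth_on U f \<Longrightarrow> smooth_on U g \<Longrightarrow> smooth_on U (\<lambda>x. B (f x) (g x))"
  by (simp add: smooth_on_def C_k_on_bilinear)

lemmas smooth_on_mult = smooth_on_bilinear[OF bounded_bilinear_mult]
lemmas smooth_on_inner = smooth_on_bilinear[OF bounded_bilinear_inner]

lemma smooth_on_cmult:
  fixes f :: "'a::euclidean_space \<Rightarrow> real"
  shows "open U \<Longrightarrow> smooth_on U f \<Longrightarrow> smooth_on U (\<lambda>x. c * f x)"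
  by (intro smooth_on_mult smooth_on_const)

lemma smooth_on_diff:
  fixes f g :: "'a::euclidean_space \<Rightarrow> real"
  assumes "open U" "smooth_on U f" "smooth_on U g"
  shows "smooth_on U (\<lambda>x. f x - g x)"
  using smooth_on_add[OF assms(1,2) smooth_on_cmult[OF assms(1,3), of "-1"]] by simp

lemma smooth_on_compose:
  fixes f :: "'b::euclidean_space \<Rightarrow> 'c::real_normed_vector" and g :: "'a::euclidean_space \<Rightarrow> 'b"
  shows "smooth_on V f \<Longrightarrow> smooth_on U g \<Longrightarrow> open U \<Longrightarrow> open V \<Longrightarrow> g ` U \<subseteq> V \<Longrightarrow> smooth_on U (\<lambda>x. f (g x))"
  by (simp add: smooth_on_def C_k_on_compose)

lemma smooth_on_holomorphic: "open U \<Longrightarrow> f holomorphic_on U \<Longrightarrow> smooth_on U f"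
  by (simp add: smooth_on_def C_k_on_holomorphic)

lemma smooth_on_cong:
  "open U \<Longrightarrow> (\<And>x. x \<in> U \<Longrightarrow> f x = g x) \<Longrightarrow> smooth_on U f \<Longrightarrow> smooth_on U g"
  unfolding smooth_on_def using C_k_on_cong by blast

lemma smooth_on_Un: "open U \<Longrightarrow> open V \<Longrightarrow> smooth_on U f \<Longrightarrow> smooth_on V f \<Longrightarrow> smooth_on (U \<union> V) f"
  unfolding smooth_on_def using C_k_on_Un by blast

lemma smooth_on_imp_continuous_on: "smooth_on U f \<Longrightarrow> continuous_on U f"
  unfolding smooth_on_def by (metis C_k_on.simps(1))

lemma smooth_on_has_derivative:
  "smooth_on U f \<Longrightarrow> x \<in> U \<Longrightarrow> (f has_derivative dd f x) (at x)"
  unfolding smooth_on_def using C_k_on_Suc_D by blast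

lemma smooth_on_frechet_derivative:
  "smooth_on U f \<Longrightarrow> b \<in> Basis \<Longrightarrow> smooth_on U (\<lambda>x. dd f x b)"
  unfolding smooth_on_def by (metis C_k_on.simps(2))

lemma smooth_imp_has_derivative:
  "smooth f \<Longrightarrow> (f has_derivative dd f x) (at x)"
  by (simp add: smooth_eq_smooth_on smooth_on_has_derivative)

lemma smooth_imp_continuous: "smooth f \<Longrightarrow> continuous_on A f"
  by (metis smooth_eq_smooth_on smooth_on_imp_continuous_on continuous_on_subset subset_UNIV)

lemma smooth_frechet_derivative:
  "smooth f \<Longrightarrow> b \<in> Basis \<Longrightarrow> smooth (\<lambda>x. dd f x b)"
  by (simp add: smooth_eq_smooth_on smooth_on_frechet_derivative)

section \<open>Differentiation under the integral sign and convolution\<close>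

lemma dominated_convergence_within:
  fixes f :: "'b::metric_space \<Rightarrow> 'a \<Rightarrow> 'c::{banach, second_countable_topology}"
  assumes "g \<in> borel_measurable M" "integrable M w"
    and "\<forall>\<^sub>F x in at a within S. f x \<in> borel_measurable M \<and> (AE y in M. norm (f x y) \<le> w y)"
    and "AE y in M. ((\<lambda>x. f x y) \<longlongrightarrow> g y) (at a within S)"
  shows "((\<lambda>x. integral\<^sup>L M (f x)) \<longlongrightarrow> integral\<^sup>L M g) (at a within S)"
proof -
  obtain T where T: "open T" "a \<in> T"
    and P: "\<And>x. x \<in> T \<Longrightarrow> x \<noteq> a \<Longrightarrow> x \<in> S \<Longrightarrow> f x \<in> borel_measurable M \<and> (AE y in M. norm (f x y) \<le> w y)"
    using assms(3) unfolding eventually_at_topological by blast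
  have eq: "at a within S = at a within (S \<inter> T)"
    by (rule at_within_nhd[OF T(2,1)]) auto
  show ?thesis
    unfolding eq tendsto_at_iff_sequentially o_def
  proof (intro allI impI)
    fix X assume X: "\<forall>i. X i \<in> S \<inter> T - {a}" "X \<longlonglongrightarrow> a"
    have mem: "X i \<in> T" "X i \<noteq> a" "X i \<in> S" for i using X by auto
    show "(\<lambda>i. integral\<^sup>L M (f (X i))) \<longlonglongrightarrow> integral\<^sup>L M g"
    proof (rule integral_dominated_convergence[OF assms(1) _ assms(2)])
      show "f (X i) \<in> borel_measurable M" for i using P[OF mem] by blast
      show "AE x in M. norm (f (X i) x) \<le> w x" for i using P[OF mem] by blast
      show "AE x in M. (\<lambda>i. f (X i) x) \<longlonglongrightarrow> g x"
        using assms(4)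
      proof eventually_elim
        case (elim y)
        then show ?case unfolding tendsto_at_iff_sequentially o_def using X by auto
      qed
    qed
  qed
qed

text \<open>The difference quotients converge pointwise, and by the mean value inequality they are dominated by
  \<open>2 B\<close>.\<close>

lemma has_derivative_lebesgue_integral:
  fixes F :: "'a::euclidean_space \<Rightarrow> 'b \<Rightarrow> 'c::{banach, second_countable_topology}"
  assumes U: "open U" "convex U" "x \<in> U"
    and int: "\<And>y. y \<in> U \<Longrightarrow> integrable M (F y)"
    and meas: "\<And>h. (\<lambda>s. F' x s h) \<in> borel_measurable M"
    and der: "\<And>y s. y \<in> U \<Longrightarrow> ((\<lambda>y. F y s) has_derivative F' y s) (at y)"
    and bd: "\<And>y s h. y \<in> U \<Longrightarrow> norm (F' y s h) \<le> B s * norm h"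
    and B: "integrable M B"
  shows "((\<lambda>y. \<integral>s. F y s \<partial>M) has_derivative (\<lambda>h. \<integral>s. F' x s h \<partial>M)) (at x)"
proof -
  have lin: "linear (F' x s)" for s
    using der[OF U(3)] has_derivative_linear by blast
  have int': "integrable M (\<lambda>s. F' x s h)" for h
    by (rule Bochner_Integration.integrable_bound[OF integrable_mult_left[OF B, of "norm h"] meas])
       (use bd[OF U(3)] in \<open>auto intro!: AE_I2 simp: abs_mult intro: order_trans[OF _ mult_right_mono[OF abs_ge_self]]\<close>)
  show ?thesis
    unfolding has_derivative_at
  proof
    show "bounded_linear (\<lambda>h. \<integral>s. F' x s h \<partial>M)"
    proof (rule bounded_linear_intro[where K = "integral\<^sup>L M B"])
      fix h k r
      show "(\<integral>s. F' x s (h + k) \<partial>M) = (\<integral>s. F' x s h \<partial>M) + (\<integral>s. F' x s k \<partial>M)"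
        by (simp add: linear_add[OF lin] int' Bochner_Integration.integral_add)
      show "(\<integral>s. F' x s (r *\<^sub>R h) \<partial>M) = r *\<^sub>R (\<integral>s. F' x s h \<partial>M)"
        by (simp add: linear_cmul[OF lin])
      have "norm (\<integral>s. F' x s h \<partial>M) \<le> (\<integral>s. norm (F' x s h) \<partial>M)"
        by (rule integral_norm_bound)
      also have "\<dots> \<le> (\<integral>s. B s * norm h \<partial>M)"
        by (rule integral_mono[OF integrable_norm[OF int'] integrable_mult_left[OF B]]) (rule bd[OF U(3)])
      finally have "norm (\<integral>s. F' x s h \<partial>M) \<le> (\<integral>s. B s * norm h \<partial>M)" .
      then show "norm (\<integral>s. F' x s h \<partial>M) \<le> norm h * integral\<^sup>L M B"
        by (simp add: mult.commute)
    qed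
    let ?q = "\<lambda>h s. norm (F (x + h) s - F x s - F' x s h) / norm h"
    have near: "\<forall>\<^sub>F h in at 0. x + h \<in> U"
    proof -
      have "((\<lambda>h. x + h) \<longlongrightarrow> x + 0) (at 0)" by (intro tendsto_intros)
      then show ?thesis using U(1,3) by (simp add: topological_tendstoD)
    qed
    have est: "norm (F (x + h) s - F x s) \<le> B s * norm h" if "x + h \<in> U" for h s
    proof -
      have "norm (F (x + h) s - F x s) \<le> B s * norm (x + h - x)"
        by (rule differentiable_bound[OF U(2), where f' = "\<lambda>y. F' y s"])
           (use der bd U(3) that in \<open>auto intro: has_derivative_at_withinI simp: onorm_le\<close>)
      then show ?thesis by simp
    qed
    have "((\<lambda>h. \<integral>s. ?q h s \<partial>M) \<longlongrightarrow> (\<integral>s. 0 \<partial>M)) (at 0)"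
    proof (rule dominated_convergence_within[where w = "\<lambda>s. 2 * B s"])
      show "\<forall>\<^sub>F h in at 0. ?q h \<in> borel_measurable M \<and> (AE s in M. norm (?q h s) \<le> 2 * B s)"
        using near
      proof eventually_elim
        case (elim h)
        have m: "?q h \<in> borel_measurable M"
          using int[OF elim] int[OF U(3)] int'[of h] by measurable
        have "?q h s \<le> 2 * B s" for s
        proof (cases "h = 0")
          case True
          \<comment> \<open>The default quotient at \<open>h = 0\<close> is 0, and \<open>B s\<close> is nonnegative by the bound at a unit vector.\<close>
          have "0 \<le> B s * norm (SOME b::'a. b \<in> Basis)"
            using bd[OF U(3)] norm_ge_zero order_trans by blast
          moreover have "norm (SOME b::'a. b \<in> Basis) = 1"
            by (simp add: some_in_eq)
          ultimately show ?thesis using True by simp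
        next
          case False
          have "norm (F (x + h) s - F x s - F' x s h) \<le> B s * norm h + B s * norm h"
            by (rule order_trans[OF norm_triangle_ineq4 add_mono[OF est[OF elim] bd[OF U(3)]]])
          then show ?thesis using False by (simp add: divide_simps)
        qed
        then show ?case using m by auto
      qed
      show "AE s in M. ((\<lambda>h. ?q h s) \<longlongrightarrow> 0) (at 0)"
        using der[OF U(3)] unfolding has_derivative_at by auto
    qed (use B in auto)
    then have lim: "((\<lambda>h. \<integral>s. ?q h s \<partial>M) \<longlongrightarrow> 0) (at 0)" by simp
    have "\<forall>\<^sub>F h in at 0. norm (norm ((\<integral>s. F (x + h) s \<partial>M) - (\<integral>s. F x s \<partial>M) - (\<integral>s. F' x s h \<partial>M)) / norm h)
        \<le> (\<integral>s. ?q h s \<partial>M)"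
      using near
    proof eventually_elim
      case (elim h)
      have "(\<integral>s. F (x + h) s \<partial>M) - (\<integral>s. F x s \<partial>M) - (\<integral>s. F' x s h \<partial>M)
          = (\<integral>s. F (x + h) s - F x s - F' x s h \<partial>M)"
        using int[OF elim] int[OF U(3)] int'[of h] by simp
      also have "norm \<dots> \<le> (\<integral>s. norm (F (x + h) s - F x s - F' x s h) \<partial>M)"
        by (rule integral_norm_bound)
      finally show ?case by (simp add: divide_right_mono)
    qed
    then show "((\<lambda>h. norm ((\<integral>s. F (x + h) s \<partial>M) - (\<integral>s. F x s \<partial>M) - (\<integral>s. F' x s h \<partial>M)) / norm h) \<longlongrightarrow> 0) (at 0)"
      by (rule Lim_null_comparison) (rule lim)
  qed
qed

text \<open>The radius is kept explicit because the estimates for regularizations need one ball for all members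
  of a family.\<close>

definition supported_in :: "real \<Rightarrow> ('a::real_normed_vector \<Rightarrow> real) \<Rightarrow> bool" where
  "supported_in R f \<longleftrightarrow> (\<forall>z. norm z > R \<longrightarrow> f z = 0)"

lemma compactly_supported_iff:
  fixes f :: "'a::euclidean_space \<Rightarrow> real"
  shows "compactly_supported f \<longleftrightarrow> (\<exists>R. supported_in R f)"
proof
  assume "compactly_supported f"
  then have "bounded {x. f x \<noteq> 0}"
    unfolding compactly_supported_def by (meson bounded_subset closure_subset compact_imp_bounded)
  then obtain R where "\<forall>x\<in>{x. f x \<noteq> 0}. norm x \<le> R" unfolding bounded_iff by blast
  then show "\<exists>R. supported_in R f" unfolding supported_in_def by (intro exI[of _ R]) force
next
  assume "\<exists>R. supported_in R f"
  then obtain R where "{x. f x \<noteq> 0} \<subseteq> cball 0 R"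
    unfolding supported_in_def by (metis (mono_tags, lifting) linorder_not_le mem_Collect_eq mem_cball_0 subsetI)
  then have "bounded {x. f x \<noteq> 0}" using bounded_cball bounded_subset by blast
  then show "compactly_supported f" unfolding compactly_supported_def by simp
qed

lemma continuous_supported_in_bounded:
  fixes f :: "'a::euclidean_space \<Rightarrow> real"
  assumes "continuous_on UNIV f" "supported_in R f"
  obtains B where "0 \<le> B" "\<And>z. \<bar>f z\<bar> \<le> B"
proof -
  have "bounded (f ` cball 0 R)"
    using assms(1) by (intro compact_imp_bounded compact_continuous_image) (auto intro: continuous_on_subset)
  then obtain B where B: "\<And>z. z \<in> cball 0 R \<Longrightarrow> \<bar>f z\<bar> \<le> B" unfolding bounded_iff by fastforce
  show thesis
  proof (rule that[of "max 0 B"])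
    show "\<bar>f z\<bar> \<le> max 0 B" for z
      using B[of z] assms(2) unfolding supported_in_def by (cases "norm z \<le> R") auto
  qed simp
qed

definition locally_integrable :: "('a::euclidean_space \<Rightarrow> real) \<Rightarrow> bool" where
  "locally_integrable g \<longleftrightarrow> g \<in> borel_measurable borel \<and> (\<forall>R. set_integrable lborel (cball 0 R) g)"

lemma locally_integrable_mult:
  fixes g h :: "'a::euclidean_space \<Rightarrow> real"
  assumes g: "locally_integrable g" and h: "h \<in> borel_measurable borel"
    and B: "\<And>w. \<bar>h w\<bar> \<le> B" and R: "supported_in R h"
  shows "integrable lborel (\<lambda>w. g w * h w)"
proof (rule Bochner_Integration.integrable_bound)
  show "integrable lborel (\<lambda>w. B * (indicat_real (cball 0 R) w *\<^sub>R g w))"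
    using g unfolding locally_integrable_def set_integrable_def by simp
  show "(\<lambda>w. g w * h w) \<in> borel_measurable lborel"
    using g h unfolding locally_integrable_def by auto
  have "\<bar>g w * h w\<bar> \<le> \<bar>B * (indicat_real (cball 0 R) w *\<^sub>R g w)\<bar>" for w
  proof (cases "norm w \<le> R")
    case True
    have "0 \<le> B" using B[of 0] by linarith
    then show ?thesis using True B[of w] by (simp add: abs_mult mult.commute[of B] mult_left_mono)
  next
    case False
    then show ?thesis using R by (simp add: supported_in_def)
  qed
  then show "AE w in lborel. norm (g w * h w) \<le> norm (B * (indicat_real (cball 0 R) w *\<^sub>R g w))" by simp
qed

lemma supported_in_frechet_derivative:
  fixes f :: "'a::euclidean_space \<Rightarrow> real"
  assumes "supported_in R f" "norm z > R"
  shows "dd f z h = 0"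
proof -
  have "(f has_derivative (\<lambda>h. 0)) (at z)"
  proof (rule has_derivative_transform_within_open)
    show "((\<lambda>z. 0::real) has_derivative (\<lambda>h. 0)) (at z)" by simp
    show "open (- cball 0 R :: 'a set)" by (simp add: open_Compl)
    show "z \<in> - cball 0 R" using assms(2) by simp
    show "0 = f x" if "x \<in> - cball 0 R" for x
      using that assms(1) by (simp add: supported_in_def)
  qed
  then have "(\<lambda>h. 0) = dd f z" by (rule frechet_derivative_at)
  then show ?thesis by metis
qed

lemma frechet_derivative_expand:
  fixes f :: "'a::euclidean_space \<Rightarrow> 'b::real_normed_vector"
  assumes "smooth f"
  shows "dd f z h = (\<Sum>i\<in>Basis. (h \<bullet> i) *\<^sub>R dd f z i)"
proof -
  have lin: "linear (dd f z)"
    using has_derivative_linear[OF smooth_imp_has_derivative[OF assms]] .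
  show ?thesis
    by (subst (1) euclidean_representation[of h, symmetric])
       (simp only: linear_sum[OF lin] linear_cmul[OF lin])
qed

lemma frechet_derivative_bounded_on_compact:
  fixes f :: "'a::euclidean_space \<Rightarrow> real"
  assumes f: "smooth f" and S: "compact S"
  obtains B where "0 \<le> B" "\<And>z h. z \<in> S \<Longrightarrow> \<bar>dd f z h\<bar> \<le> B * norm h"
proof -
  have "\<exists>B\<ge>0. \<forall>z\<in>S. \<bar>dd f z i\<bar> \<le> B" if "i \<in> Basis" for i
  proof -
    have "bounded ((\<lambda>z. dd f z i) ` S)"
      using smooth_imp_continuous[OF smooth_frechet_derivative[OF f that]] S
      by (intro compact_imp_bounded compact_continuous_image)
    then obtain B where "\<forall>z\<in>S. \<bar>dd f z i\<bar> \<le> B" unfolding bounded_iff by auto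
    then show ?thesis by (intro exI[of _ "max 0 B"]) auto
  qed
  then obtain B where B: "\<And>i. i \<in> Basis \<Longrightarrow> 0 \<le> B i"
      "\<And>i z. i \<in> Basis \<Longrightarrow> z \<in> S \<Longrightarrow> \<bar>dd f z i\<bar> \<le> B i" by metis
  show thesis
  proof (rule that[of "\<Sum>i\<in>Basis. B i"])
    show "0 \<le> sum B Basis" using B(1) by (simp add: sum_nonneg)
    fix z h assume z: "z \<in> S"
    have "\<bar>dd f z h\<bar> \<le> (\<Sum>i\<in>Basis. \<bar>(h \<bullet> i) *\<^sub>R dd f z i\<bar>)"
      by (subst frechet_derivative_expand[OF f]) (rule sum_abs)
    also have "\<dots> \<le> (\<Sum>i\<in>Basis. norm h * B i)"
      using B z by (intro sum_mono) (auto simp: abs_mult intro!: mult_mono Basis_le_norm)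
    finally show "\<bar>dd f z h\<bar> \<le> sum B Basis * norm h"
      by (simp add: sum_distrib_left mult.commute)
  qed
qed

lemma frechet_derivative_bounded:
  fixes f :: "'a::euclidean_space \<Rightarrow> real"
  assumes f: "smooth f" and R: "supported_in R f"
  obtains B where "0 \<le> B" "\<And>z h. \<bar>dd f z h\<bar> \<le> B * norm h"
proof -
  obtain B where B: "0 \<le> B"
      "\<And>z h. z \<in> cball 0 R \<Longrightarrow> \<bar>dd f z h\<bar> \<le> B * norm h"
    using frechet_derivative_bounded_on_compact[OF f compact_cball] by metis
  have "\<bar>dd f z h\<bar> \<le> B * norm h" for z h
    using B supported_in_frechet_derivative[OF R, of z h] by (cases "norm z \<le> R") auto
  with B(1) show thesis by (rule that)
qed

lemma has_derivative_convolution: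
  fixes f g :: "'a::euclidean_space \<Rightarrow> real"
  assumes g: "locally_integrable g" and f: "smooth f" and R: "supported_in R f"
  shows "((\<lambda>z. LBINT w. g w * f (z - w)) has_derivative
      (\<lambda>h. LBINT w. g w * dd f (z - w) h)) (at z)"
proof -
  obtain B where B: "0 \<le> B" "\<And>z h. \<bar>dd f z h\<bar> \<le> B * norm h"
    using frechet_derivative_bounded[OF f R] by metis
  have fm: "f \<in> borel_measurable borel"
    using smooth_imp_continuous[OF f] by (rule borel_measurable_continuous_onI)
  have gm: "g \<in> borel_measurable borel" using g by (simp add: locally_integrable_def)
  have f'm: "(\<lambda>w. dd f w h) \<in> borel_measurable borel" for h
  proof -
    have eq: "(\<lambda>w. dd f w h)
        = (\<lambda>w. \<Sum>i\<in>Basis. (h \<bullet> i) *\<^sub>R dd f w i)"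
      by (intro ext frechet_derivative_expand[OF f])
    have "continuous_on UNIV (\<lambda>w. dd f w h)"
      by (subst eq)
         (intro continuous_on_sum continuous_on_scaleR continuous_on_const smooth_imp_continuous smooth_frechet_derivative[OF f])
    then show ?thesis by (rule borel_measurable_continuous_onI)
  qed
  obtain C where C: "\<And>z. \<bar>f z\<bar> \<le> C"
    using continuous_supported_in_bounded[OF smooth_imp_continuous[OF f] R] by metis
  let ?F' = "\<lambda>(y::'a) (w::'a) (h::'a). g w * dd f (y - w) h"
  show ?thesis
  proof (rule has_derivative_lebesgue_integral[where U = "ball z 1" and F' = ?F'
        and B = "\<lambda>w. B * (indicat_real (cball 0 (R + norm z + 1)) w *\<^sub>R \<bar>g w\<bar>)" and M = lborel])
    fix y assume y: "y \<in> ball z 1"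
    show "integrable lborel (\<lambda>w. g w * f (y - w))"
    proof (rule locally_integrable_mult[OF g _ C])
      show "(\<lambda>w. f (y - w)) \<in> borel_measurable borel" using fm by measurable
      show "supported_in (norm y + R) (\<lambda>w. f (y - w))"
        unfolding supported_in_def
      proof (intro allI impI)
        fix w :: 'a assume "norm y + R < norm w"
        then have "R < norm (y - w)" using norm_triangle_ineq2[of w y] by (simp add: norm_minus_commute)
        then show "f (y - w) = 0" using R by (simp add: supported_in_def)
      qed
    qed
    show "((\<lambda>y. g w * f (y - w)) has_derivative (\<lambda>h. g w * dd f (y - w) h)) (at y)" for w :: 'a
    proof -
      have "((\<lambda>y. f (y - w)) has_derivative (\<lambda>h. dd f (y - w) h)) (at y)"
        by (rule has_derivative_compose[where g = f and f = "\<lambda>y. y - w" and f' = "\<lambda>h. h", simplified])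
           (auto intro!: derivative_eq_intros smooth_imp_has_derivative[OF f])
      then show ?thesis by (intro has_derivative_mult_right)
    qed
    show "norm (g w * dd f (y - w) h)
        \<le> B * (indicat_real (cball 0 (R + norm z + 1)) w *\<^sub>R \<bar>g w\<bar>) * norm h" for w h :: 'a
    proof (cases "norm w \<le> R + norm z + 1")
      case True
      have "\<bar>g w\<bar> * \<bar>dd f (y - w) h\<bar> \<le> \<bar>g w\<bar> * (B * norm h)"
        using B by (intro mult_left_mono) auto
      then show ?thesis using True by (simp add: abs_mult algebra_simps)
    next
      case False
      have "norm y \<le> norm z + 1"
        using y norm_triangle_ineq2[of y z] by (simp add: dist_norm norm_minus_commute)
      then have "R < norm (y - w)" using False norm_triangle_ineq2[of w y] by (simp add: norm_minus_commute)
      then show ?thesis using False supported_in_frechet_derivative[OF R] by simp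
    qed
  next
    show "integrable lborel (\<lambda>w. B * (indicat_real (cball 0 (R + norm z + 1)) w *\<^sub>R \<bar>g w\<bar>))"
    proof -
      have "integrable lborel (\<lambda>w. \<bar>indicat_real (cball 0 (R + norm z + 1)) w *\<^sub>R g w\<bar>)"
        using g unfolding locally_integrable_def set_integrable_def by (intro integrable_abs) blast
      then show ?thesis by (intro integrable_mult_right) (simp add: abs_mult)
    qed
    show "(\<lambda>w. g w * dd f (z - w) h) \<in> borel_measurable lborel" for h
    proof -
      have "(\<lambda>w. z - w) \<in> borel_measurable lborel" by simp
      from measurable_compose[OF this f'm] show ?thesis using gm by (intro borel_measurable_times) auto
    qed
  qed auto
qed

text \<open>All derivatives fall on the smooth factor.\<close>

lemma smooth_convolution:
  fixes f g :: "'a::euclidean_space \<Rightarrow> real"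
  assumes g: "locally_integrable g" and f: "smooth f" and R: "supported_in R f"
  shows "smooth (\<lambda>z. LBINT w. g w * f (z - w))"
proof -
  have "C_k_on k UNIV (\<lambda>z. LBINT w. g w * f (z - w))" for k
    using f R
  proof (induction k arbitrary: f)
    case 0
    have "continuous (at z) (\<lambda>z. LBINT w. g w * f (z - w))" for z
      using has_derivative_continuous[OF has_derivative_convolution[OF g 0]] .
    then show ?case by (simp add: continuous_at_imp_continuous_on)
  next
    case (Suc k)
    show ?case
    proof (rule C_k_on_SucI[OF open_UNIV has_derivative_convolution[OF g Suc.prems]])
      fix b :: 'a assume b: "b \<in> Basis"
      show "C_k_on k UNIV (\<lambda>z. LBINT w. g w * dd f (z - w) b)"
        using supported_in_frechet_derivative[OF Suc.prems(2)]
        by (intro Suc.IH smooth_frechet_derivative[OF Suc.prems(1) b]) (simp add: supported_in_def)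
    qed
  qed
  then show ?thesis by (simp add: smooth_eq_smooth_on smooth_on_def)
qed

section \<open>Affine substitutions and integrable singularities in the plane\<close>

lemma lborel_integral_affine:
  fixes f :: "'a::euclidean_space \<Rightarrow> 'b::{banach, second_countable_topology}"
  assumes c: "c \<noteq> 0" and f: "f \<in> borel_measurable borel"
  shows "(LBINT x. f x) = \<bar>c\<bar> ^ DIM('a) *\<^sub>R (LBINT x. f (t + c *\<^sub>R x))"
  by (subst lborel_affine[OF c, of t])
     (use f in \<open>simp add: integral_density integral_distr del: power_abs\<close>)

lemma lborel_integrable_affine:
  fixes f :: "'a::euclidean_space \<Rightarrow> 'b::{banach, second_countable_topology}"
  assumes c: "c \<noteq> 0" and f: "integrable lborel f"
  shows "integrable lborel (\<lambda>x. f (t + c *\<^sub>R x))"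
proof -
  have m: "f \<in> borel_measurable borel" using f by auto
  have "integrable (density (distr lborel borel (\<lambda>x. t + c *\<^sub>R x)) (\<lambda>_. ennreal (\<bar>c\<bar> ^ DIM('a)))) f"
    using f lborel_affine[OF c, of t] by simp
  then have "integrable lborel (\<lambda>x. \<bar>c\<bar> ^ DIM('a) *\<^sub>R f (t + c *\<^sub>R x))"
    using m by (subst (asm) integrable_density) (simp_all add: integrable_distr_eq del: power_abs)
  from integrable_scaleR_right[OF this, of "inverse (\<bar>c\<bar> ^ DIM('a))"] show ?thesis using c by simp
qed

lemma lborel_integral_reflect:
  fixes f :: "'a::euclidean_space \<Rightarrow> 'b::{banach, second_countable_topology}"
  assumes "f \<in> borel_measurable borel"
  shows "(LBINT w. f (z - w)) = (LBINT w. f w)"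
  using lborel_integral_affine[of "-1" f z] assms by simp

lemma lborel_integral_translate:
  fixes f :: "'a::euclidean_space \<Rightarrow> 'b::{banach, second_countable_topology}"
  assumes "f \<in> borel_measurable borel"
  shows "(LBINT w. f (z + w)) = (LBINT w. f w)"
  using lborel_integral_affine[of 1 f z] assms by simp

lemma continuous_on_frechet_derivative:
  fixes f :: "'a::euclidean_space \<Rightarrow> 'b::real_normed_vector"
  assumes "smooth f" "continuous_on A g" "continuous_on A h"
  shows "continuous_on A (\<lambda>x. dd f (g x) (h x))"
proof -
  have eq: "(\<lambda>x. dd f (g x) (h x))
      = (\<lambda>x. \<Sum>i\<in>Basis. (h x \<bullet> i) *\<^sub>R dd f (g x) i)"
    by (intro ext frechet_derivative_expand[OF assms(1)])
  have "continuous_on A (\<lambda>x. dd f (g x) i)" if "i \<in> Basis" for i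
    by (rule continuous_on_compose2[OF smooth_imp_continuous[OF smooth_frechet_derivative[OF assms(1) that]] assms(2)])
       auto
  then show ?thesis
    by (subst eq) (intro continuous_on_sum continuous_on_scaleR continuous_on_inner continuous_on_const assms(3))
qed

text \<open>By translation invariance \<open>z \<mapsto> \<integral>F(z - w)\<close> is constant, and its derivative is the integral in
  question.\<close>

lemma integral_frechet_derivative_eq_0:
  fixes F :: "'a::euclidean_space \<Rightarrow> real"
  assumes F: "smooth F" and R: "supported_in R F"
  shows "(LBINT z. dd F z h) = 0"
proof -
  have li: "locally_integrable (\<lambda>z::'a. 1)"
    unfolding locally_integrable_def set_integrable_def
    by (auto simp: emeasure_cball intro!: integrable_real_indicator emeasure_bounded_finite)
  have m: "F \<in> borel_measurable borel"
    using smooth_imp_continuous[OF F] by (rule borel_measurable_continuous_onI)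
  have m': "(\<lambda>z. dd F z h) \<in> borel_measurable borel"
    by (intro borel_measurable_continuous_onI continuous_on_frechet_derivative[OF F] continuous_intros)
  have "((\<lambda>z. LBINT w. 1 * F (z - w)) has_derivative
      (\<lambda>h. LBINT w. 1 * dd F (0 - w) h)) (at 0)"
    by (rule has_derivative_convolution[OF li F R])
  moreover have "(\<lambda>z. LBINT w. 1 * F (z - w)) = (\<lambda>z. LBINT w. F w)"
    using lborel_integral_reflect[OF m] by simp
  ultimately have "(\<lambda>h. LBINT w. 1 * dd F (0 - w) h) = (\<lambda>h. 0)"
    by (simp add: has_derivative_unique[OF _ has_derivative_const])
  then have "(LBINT w. dd F (0 - w) h) = 0" by (simp add: fun_eq_iff)
  then show ?thesis using lborel_integral_reflect[OF m', of 0] by simp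
qed

text \<open>A single majorant for the singular integrals below: it is of order \<open>1/|u|\<close> at the origin and
  \<open>1/|u|\<^sup>3\<close> at infinity, hence integrable over the plane.\<close>

definition decay :: "complex \<Rightarrow> real" where
  "decay u = 1 / (cmod u * (1 + cmod u)\<^sup>2)"

lemma decay_nonneg [simp]: "0 \<le> decay u"
  by (simp add: decay_def)

lemma decay_measurable [measurable]: "decay \<in> borel_measurable borel"
  unfolding decay_def by measurable

lemma emeasure_cball_complex: "0 \<le> r \<Longrightarrow> emeasure lborel (cball (0::complex) r) = ennreal (pi * r\<^sup>2)"
  by (simp add: emeasure_cball unit_ball_vol_2)

lemma nn_integral_decay_tail:
  assumes "r > 0"
  shows "(\<integral>\<^sup>+t. ennreal ((1 + 3 * t) / (t\<^sup>2 * (1 + t) ^ 3)) * indicator {r..} t \<partial>lborel)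
    = ennreal (1 / (r * (1 + r)\<^sup>2))"
proof -
  have "(\<integral>\<^sup>+t. ennreal ((1 + 3 * t) / (t\<^sup>2 * (1 + t) ^ 3)) * indicator {r..} t \<partial>lborel)
      = ennreal (0 - (- (1 / (r * (1 + r)\<^sup>2))))"
  proof (rule nn_integral_FTC_atLeast)
    show "((\<lambda>t::real. - (1 / (t * (1 + t)\<^sup>2))) has_real_derivative (1 + 3 * t) / (t\<^sup>2 * (1 + t) ^ 3)) (at t)"
      if "r \<le> t" for t
    proof -
      have t: "t > 0" using assms that by simp
      show ?thesis
        using t by (auto intro!: derivative_eq_intros simp: divide_simps)
                   (simp add: power2_eq_square power3_eq_cube algebra_simps)
    qed
    show "((\<lambda>t::real. - (1 / (t * (1 + t)\<^sup>2))) \<longlongrightarrow> 0) at_top"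
      by real_asymp
  qed (use assms in auto)
  then show ?thesis by simp
qed

text \<open>Layer-cake formula: \<open>decay u\<close> is the integral over \<open>t \<ge> |u|\<close> of minus the derivative of
  \<open>1/(t (1 + t)\<^sup>2)\<close>, so by Tonelli its integral is that of this density times the disc area \<open>\<pi> t\<^sup>2\<close>.\<close>

lemma integrable_decay: "integrable lborel decay"
proof (rule integrableI_nonneg)
  let ?k = "\<lambda>t::real. (1 + 3 * t) / (t\<^sup>2 * (1 + t) ^ 3)"
  have "(\<integral>\<^sup>+u. ennreal (decay u) \<partial>lborel)
      \<le> (\<integral>\<^sup>+(u::complex). (\<integral>\<^sup>+t. ennreal (?k t) * indicator {0<..} t * indicator (cball 0 t) u \<partial>lborel) \<partial>lborel)"
  proof (rule nn_integral_mono)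
    fix u :: complex
    show "ennreal (decay u) \<le> (\<integral>\<^sup>+t. ennreal (?k t) * indicator {0<..} t * indicator (cball 0 t) u \<partial>lborel)"
    proof (cases "u = 0")
      case False
      then have "ennreal (decay u) = (\<integral>\<^sup>+t. ennreal (?k t) * indicator {cmod u..} t \<partial>lborel)"
        by (simp add: decay_def nn_integral_decay_tail)
      also have "\<dots> = (\<integral>\<^sup>+t. ennreal (?k t) * indicator {0<..} t * indicator (cball 0 t) u \<partial>lborel)"
      proof (intro nn_integral_cong)
        fix t :: real
        have "0 < cmod u" using False by simp
        then have "0 < t" if "cmod u \<le> t" using that by linarith
        then show "ennreal (?k t) * indicator {cmod u..} t = ennreal (?k t) * indicator {0<..} t * indicator (cball 0 t) u"
          by (cases "cmod u \<le> t") simp_all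
      qed
      finally show ?thesis by simp
    qed (simp add: decay_def)
  qed
  also have "\<dots> = (\<integral>\<^sup>+t. (\<integral>\<^sup>+(u::complex). ennreal (?k t) * indicator {0<..} t * indicator (cball 0 t) u \<partial>lborel) \<partial>lborel)"
  proof (rule lborel_pair.Fubini'[symmetric])
    have "{x::complex \<times> real. cmod (fst x) \<le> snd x} \<in> sets borel"
      by (intro borel_closed closed_Collect_le continuous_intros)
    then have [measurable]: "{x::complex \<times> real. cmod (fst x) \<le> snd x} \<in> sets (lborel \<Otimes>\<^sub>M lborel)"
      unfolding lborel_prod by simp
    have "(\<lambda>x::complex \<times> real. ennreal (?k (snd x)) * indicator {0<..} (snd x) * indicator {x. cmod (fst x) \<le> snd x} x)
       \<in> borel_measurable (lborel \<Otimes>\<^sub>M lborel)"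
      by measurable
    then show "(\<lambda>(u::complex, t). ennreal (?k t) * indicator {0<..} t * indicator (cball 0 t) u)
       \<in> borel_measurable (lborel \<Otimes>\<^sub>M lborel)"
      by (rule measurable_cong[THEN iffD1, rotated]) (auto simp: indicator_def)
  qed
  also have "\<dots> \<le> (\<integral>\<^sup>+t. ennreal (3 * pi / (1 + t)\<^sup>2) * indicator {0..} t \<partial>lborel)"
  proof (rule nn_integral_mono)
    fix t :: real
    show "(\<integral>\<^sup>+u. ennreal (?k t) * indicator {0<..} t * indicator (cball (0::complex) t) u \<partial>lborel)
        \<le> ennreal (3 * pi / (1 + t)\<^sup>2) * indicator {0..} t"
    proof (cases "t > 0")
      case True
      then have "(\<integral>\<^sup>+u. ennreal (?k t) * indicator {0<..} t * indicator (cball (0::complex) t) u \<partial>lborel)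
          = (\<integral>\<^sup>+u. ennreal (?k t) * indicator (cball (0::complex) t) u \<partial>lborel)"
        by simp
      also have "\<dots> = ennreal (?k t) * emeasure lborel (cball (0::complex) t)"
        by (rule nn_integral_cmult_indicator) simp
      also have "\<dots> = ennreal (?k t) * ennreal (pi * t\<^sup>2)"
        using True by (simp only: emeasure_cball_complex less_imp_le)
      also have "\<dots> = ennreal (?k t * (pi * t\<^sup>2))"
        by (rule ennreal_mult''[symmetric]) simp
      also have "?k t * (pi * t\<^sup>2) \<le> 3 * pi / (1 + t)\<^sup>2"
        using True by (simp add: divide_simps) (simp add: power2_eq_square power3_eq_cube algebra_simps)
      finally show ?thesis using True by (simp add: ennreal_leI)
    qed simp
  qed
  also have "\<dots> = ennreal (0 - (- (3 * pi / (1 + 0))))"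
  proof (rule nn_integral_FTC_atLeast)
    show "((\<lambda>t. - (3 * pi / (1 + t))) has_real_derivative 3 * pi / (1 + t)\<^sup>2) (at t)" if "0 \<le> t" for t
      using that by (auto intro!: derivative_eq_intros simp: power2_eq_square)
    show "((\<lambda>t. - (3 * pi / (1 + t))) \<longlongrightarrow> 0) at_top"
      by real_asymp
  qed auto
  finally show "(\<integral>\<^sup>+u. ennreal (decay u) \<partial>lborel) < \<infinity>"
    by (rule le_less_trans) simp
qed auto

lemma locally_integrable_dominated:
  fixes g :: "complex \<Rightarrow> real"
  assumes m: "g \<in> borel_measurable borel"
    and b: "\<And>R u. cmod u \<le> R \<Longrightarrow> u \<noteq> 0 \<Longrightarrow> \<bar>g u\<bar> \<le> C R * decay u"
  shows "locally_integrable g"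
  unfolding locally_integrable_def set_integrable_def
proof (intro conjI allI m)
  fix R
  show "integrable lborel (\<lambda>x. indicat_real (cball 0 R) x *\<^sub>R g x)"
  proof (rule Bochner_Integration.integrable_bound)
    show "integrable lborel (\<lambda>u. C R * decay u)" using integrable_decay by simp
    show "AE u in lborel. norm (indicat_real (cball 0 R) u *\<^sub>R g u) \<le> norm (C R * decay u)"
      using AE_lborel_singleton[of 0]
    proof eventually_elim
      case (elim u)
      show ?case
      proof (cases "cmod u \<le> R")
        case True
        then show ?thesis using b[OF True elim] by simp
      qed simp
    qed
    show "(\<lambda>x. indicat_real (cball 0 R) x *\<^sub>R g x) \<in> borel_measurable lborel"
      using m by (intro borel_measurable_scaleR borel_measurable_indicator) auto
  qed
qed

lemma locally_integrable_inverse_norm: "locally_integrable (\<lambda>u::complex. 1 / cmod u)"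
proof (rule locally_integrable_dominated)
  show "\<bar>1 / cmod u\<bar> \<le> (1 + R)\<^sup>2 * decay u" if "cmod u \<le> R" "u \<noteq> 0" for R u
  proof -
    have "(1 + cmod u)\<^sup>2 \<le> (1 + R)\<^sup>2" using that by (intro power_mono) auto
    moreover have "(1 + cmod u)\<^sup>2 > 0" using norm_ge_zero[of u] by (intro zero_less_power) linarith
    ultimately show ?thesis using that(2) unfolding decay_def by (simp add: field_simps)
  qed
qed measurable

lemma abs_ln_le:
  fixes r :: real
  assumes "r > 0"
  shows "\<bar>ln r\<bar> \<le> r + 1 / r"
proof -
  have "ln r \<le> r - 1" "- ln r \<le> 1 / r - 1" "0 < 1 / r"
    using assms ln_le_minus_one[of r] ln_le_minus_one[of "1 / r"] by (simp_all add: ln_div)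
  then show ?thesis using assms by linarith
qed

lemma ln_cmod_measurable [measurable]: "(\<lambda>u. ln (cmod u)) \<in> borel_measurable borel"
  by measurable

lemma locally_integrable_ln: "locally_integrable (\<lambda>u::complex. ln (cmod u))"
proof (rule locally_integrable_dominated)
  show "\<bar>ln (cmod u)\<bar> \<le> (1 + R)\<^sup>2 * (1 + R\<^sup>2) * decay u" if "cmod u \<le> R" "u \<noteq> 0" for R u
  proof -
    have u: "cmod u > 0" using that by simp
    have "\<bar>ln (cmod u)\<bar> \<le> cmod u + 1 / cmod u" using abs_ln_le[OF u] .
    also have "\<dots> = (1 + (cmod u)\<^sup>2) / cmod u" using u by (simp add: field_simps power2_eq_square)
    also have "\<dots> = (1 + cmod u)\<^sup>2 * (1 + (cmod u)\<^sup>2) * decay u"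
    proof -
      have "(1 + r\<^sup>2) / r = (1 + r)\<^sup>2 * (1 + r\<^sup>2) * (1 / (r * (1 + r)\<^sup>2))" if "r > 0" for r :: real
        using that by simp
      then show ?thesis using u unfolding decay_def by blast
    qed
    also have "\<dots> \<le> (1 + R)\<^sup>2 * (1 + R\<^sup>2) * decay u"
      using that by (intro mult_right_mono mult_mono power_mono add_left_mono) auto
    finally show ?thesis .
  qed
qed measurable

section \<open>The integral of a radial derivative\<close>

lemma has_integral_inverse_cube:
  assumes "r > 0"
  shows "has_bochner_integral lborel (\<lambda>t::real. 1 / t ^ 3 * indicator {r..} t) (1 / (2 * r\<^sup>2))"
proof (rule has_bochner_integral_nn_integral)
  have "(\<integral>\<^sup>+t. ennreal (1 / t ^ 3 * indicator {r..} t) \<partial>lborel) = (\<integral>\<^sup>+t. ennreal (1 / t ^ 3) * indicator {r..} t \<partial>lborel)"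
    by (intro nn_integral_cong) (auto simp: indicator_def)
  also have "\<dots> = ennreal (0 - (- (1 / (2 * r\<^sup>2))))"
  proof (rule nn_integral_FTC_atLeast)
    show "((\<lambda>t. - (1 / (2 * t\<^sup>2))) has_real_derivative 1 / t ^ 3) (at t)" if "r \<le> t" for t
    proof -
      have "t > 0" using that assms by simp
      then show ?thesis
        by (auto intro!: derivative_eq_intros simp: power2_eq_square power3_eq_cube)
    qed
    show "((\<lambda>t::real. - (1 / (2 * t\<^sup>2))) \<longlongrightarrow> 0) at_top" by real_asymp
  qed (use assms in auto)
  finally show "(\<integral>\<^sup>+t. ennreal (1 / t ^ 3 * indicator {r..} t) \<partial>lborel) = ennreal (1 / (2 * r\<^sup>2))" by simp
  show "AE t in lborel. 0 \<le> 1 / t ^ 3 * indicat_real {r..} t"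
    using assms by (auto intro!: AE_I2 simp: indicator_def)
qed auto

lemma integrable_ray:
  assumes "r > 0"
  shows "integrable lborel (\<lambda>t::real. K * r / (1 + t * r)\<^sup>2 * indicator {0..} t)"
    "(LBINT t. K * r / (1 + t * r)\<^sup>2 * indicator {0..} t) = K"
proof -
  have "has_bochner_integral lborel (\<lambda>t::real. r / (1 + t * r)\<^sup>2 * indicator {0..} t) 1"
  proof (rule has_bochner_integral_nn_integral)
    have "(\<integral>\<^sup>+t. ennreal (r / (1 + t * r)\<^sup>2 * indicator {0..} t) \<partial>lborel)
        = (\<integral>\<^sup>+t. ennreal (r / (1 + t * r)\<^sup>2) * indicator {0..} t \<partial>lborel)"
      by (intro nn_integral_cong) (auto simp: indicator_def)
    also have "\<dots> = ennreal (0 - (- (1 / (1 + 0 * r))))"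
    proof (rule nn_integral_FTC_atLeast)
      show "((\<lambda>t. - (1 / (1 + t * r))) has_real_derivative r / (1 + t * r)\<^sup>2) (at t)" if "0 \<le> t" for t
      proof -
        have "1 + t * r \<noteq> 0" using that assms by (smt (verit) mult_nonneg_nonneg)
        then show ?thesis
          by (auto intro!: derivative_eq_intros simp: power2_eq_square)
      qed
      show "((\<lambda>t::real. - (1 / (1 + t * r))) \<longlongrightarrow> 0) at_top" using assms by real_asymp
    qed (use assms in auto)
    finally show "(\<integral>\<^sup>+t. ennreal (r / (1 + t * r)\<^sup>2 * indicator {0..} t) \<partial>lborel) = ennreal 1" by simp
    show "AE t in lborel. 0 \<le> r / (1 + t * r)\<^sup>2 * indicat_real {0..} t"
      using assms by (auto intro!: AE_I2 simp: indicator_def)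
  qed auto
  from has_bochner_integral_mult_right[OF this, of K]
  have "has_bochner_integral lborel (\<lambda>t::real. K * r / (1 + t * r)\<^sup>2 * indicator {0..} t) K" by (simp add: mult.assoc)
  then show "integrable lborel (\<lambda>t::real. K * r / (1 + t * r)\<^sup>2 * indicator {0..} t)"
    "(LBINT t. K * r / (1 + t * r)\<^sup>2 * indicator {0..} t) = K"
    by (auto simp: has_bochner_integral_iff)
qed

lemma norm_le_cone_sets:
  "{x::complex \<times> real. cmod (fst x) \<le> snd x} \<in> sets (lborel \<Otimes>\<^sub>M lborel)"
proof -
  have "{x::complex \<times> real. cmod (fst x) \<le> snd x} \<in> sets borel"
    by (intro borel_closed closed_Collect_le continuous_intros)
  then show ?thesis unfolding lborel_prod by simp
qed

text \<open>The form of the Fubini criterion used throughout: a bound on the integrals of the sections.\<close>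

lemma integrable_pairI:
  fixes f :: "'a::euclidean_space \<Rightarrow> 'b::euclidean_space \<Rightarrow> real"
  assumes f: "case_prod f \<in> borel_measurable (lborel \<Otimes>\<^sub>M lborel)"
    and int: "AE x in lborel. integrable lborel (f x)"
    and b: "AE x in lborel. (LBINT y. \<bar>f x y\<bar>) \<le> B x" and B: "integrable lborel B"
  shows "integrable (lborel \<Otimes>\<^sub>M lborel) (case_prod f)"
proof (rule lborel_pair.Fubini_integrable[OF f])
  have m: "(\<lambda>x. LBINT y. \<bar>f x y\<bar>) \<in> borel_measurable lborel"
    using borel_measurable_abs[OF f]
    by (intro lborel.borel_measurable_lebesgue_integral) (simp add: case_prod_beta')
  show "integrable lborel (\<lambda>x. LBINT y. norm (case_prod f (x, y)))"
  proof (rule Bochner_Integration.integrable_bound[OF B])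
    show "AE x in lborel. norm (LBINT y. norm (case_prod f (x, y))) \<le> norm (B x)"
      using b by eventually_elim (auto intro: order_trans)
  qed (use m in simp)
  show "AE x in lborel. integrable lborel (\<lambda>y. case_prod f (x, y))"
    using int by simp
qed

text \<open>Here \<open>D\<psi>(u) u = r \<partial>\<psi>/\<partial>r\<close>, so in polar coordinates the integrand is \<open>\<partial>\<psi>/\<partial>r dr d\<theta>\<close>. The
  proof replaces polar coordinates by a dilation: writing \<open>1/|u|\<^sup>2\<close> as the integral of \<open>2 t\<^sup>-\<^sup>3\<close> over
  \<open>t \<ge> |u|\<close> and substituting \<open>u = t z\<close> gives \<open>2 \<integral>\<integral>D\<psi>(t z) z dt dz\<close> over \<open>t > 0\<close> and the unit disc;
  the inner integral is \<open>\<psi>(\<infinity>) - \<psi>(0)\<close>, and the disc has area \<open>\<pi>\<close>.\<close>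

lemma radial_derivative_integral:
  fixes \<psi> :: "complex \<Rightarrow> real"
  assumes \<psi>: "smooth \<psi>"
    and K: "\<And>z h. \<bar>dd \<psi> z h\<bar> \<le> K * cmod h / (1 + cmod z)\<^sup>2"
    and L: "(\<psi> \<longlongrightarrow> L) at_infinity"
  shows "(LBINT u. dd \<psi> u u / (cmod u)\<^sup>2) = 2 * pi * (L - \<psi> 0)"
proof -
  define G where "G = (\<lambda>u. dd \<psi> u u)"
  have lin: "linear (dd \<psi> u)" for u
    using has_derivative_linear[OF smooth_imp_has_derivative[OF \<psi>]] .
  have G_meas [measurable]: "G \<in> borel_measurable borel"
    unfolding G_def by (intro borel_measurable_continuous_onI continuous_on_frechet_derivative[OF \<psi>] continuous_intros)
  have G0: "G 0 = 0" unfolding G_def using linear_0[OF lin] .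
  have G_decay: "\<bar>G u\<bar> / (cmod u)\<^sup>2 \<le> K * decay u" for u
  proof (cases "u = 0")
    case False
    have "\<bar>G u\<bar> / (cmod u)\<^sup>2 \<le> (K * cmod u / (1 + cmod u)\<^sup>2) / (cmod u)\<^sup>2"
      unfolding G_def by (intro divide_right_mono K) auto
    also have "\<dots> = K * decay u" using False by (simp add: decay_def power2_eq_square)
    finally show ?thesis .
  qed (simp add: G0 decay_def)
  have K0: "0 \<le> K" using K[of 0 1] by simp
  \<comment> \<open>The layer-cake integrand: its integral over \<open>t\<close> is \<open>G u/|u|\<^sup>2\<close>.\<close>
  define H where "H = (\<lambda>u t. 2 * G u / t ^ 3 * indicator {0<..} t * indicator (cball 0 t) (u::complex) :: real)"
  have H_meas: "case_prod H \<in> borel_measurable (lborel \<Otimes>\<^sub>M lborel)"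
  proof -
    note [measurable] = norm_le_cone_sets
    have "(\<lambda>x::complex \<times> real. 2 * G (fst x) / snd x ^ 3 * indicator {0<..} (snd x) * indicator {x. cmod (fst x) \<le> snd x} x)
       \<in> borel_measurable (lborel \<Otimes>\<^sub>M lborel)"
      by measurable
    then show ?thesis
      by (rule measurable_cong[THEN iffD1, rotated]) (auto simp: indicator_def H_def)
  qed
  have H_int: "has_bochner_integral lborel (\<lambda>t. c / t ^ 3 * indicator {0<..} t * indicator (cball 0 t) u) (c / (2 * (cmod u)\<^sup>2))"
    if "u \<noteq> 0 \<or> c = 0" for u :: complex and c :: real
  proof (cases "u = 0")
    case False
    then have u: "cmod u > 0" by simp
    have "(\<lambda>t. c / t ^ 3 * indicator {0<..} t * indicator (cball 0 t) u) = (\<lambda>t. c * (1 / t ^ 3 * indicator {cmod u..} t))"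
    proof
      fix t :: real
      have "0 < t" if "cmod u \<le> t" using that u by linarith
      then show "c / t ^ 3 * indicator {0<..} t * indicator (cball 0 t) u = c * (1 / t ^ 3 * indicator {cmod u..} t)"
        by (cases "cmod u \<le> t") simp_all
    qed
    then show ?thesis
      using has_bochner_integral_mult_right[OF has_integral_inverse_cube[OF u], of c] by simp
  qed (use that in \<open>auto simp: has_bochner_integral_zero\<close>)
  have H1: "has_bochner_integral lborel (H u) (G u / (cmod u)\<^sup>2)" for u
    using H_int[of u "2 * G u"] G0 by (cases "u = 0") (auto simp: H_def)
  have H2: "has_bochner_integral lborel (\<lambda>t. \<bar>H u t\<bar>) (\<bar>G u\<bar> / (cmod u)\<^sup>2)" for u
  proof -
    have "(\<lambda>t. \<bar>H u t\<bar>) = (\<lambda>t. (2 * \<bar>G u\<bar>) / t ^ 3 * indicator {0<..} t * indicator (cball 0 t) u)"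
      by (rule ext) (auto simp: H_def indicator_def abs_mult)
    then show ?thesis
      using H_int[of u "2 * \<bar>G u\<bar>"] G0 by (cases "u = 0") auto
  qed
  have H_pair: "integrable (lborel \<Otimes>\<^sub>M lborel) (case_prod H)"
  proof (rule integrable_pairI[OF H_meas, where B = "\<lambda>u. K * decay u"])
    show "AE u in lborel. integrable lborel (H u)" using H1 by (auto simp: has_bochner_integral_iff)
    show "AE u in lborel. (LBINT t. \<bar>H u t\<bar>) \<le> K * decay u"
      using H2 G_decay by (auto simp: has_bochner_integral_iff)
  qed (simp add: integrable_decay)
  \<comment> \<open>The integrand after the substitution \<open>u = t z\<close>.\<close>
  define J where "J = (\<lambda>(z::complex) t. 2 * dd \<psi> (t *\<^sub>R z) z * indicator {0<..} t * indicator (cball 0 1) z :: real)"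
  have J_meas: "case_prod J \<in> borel_measurable (lborel \<Otimes>\<^sub>M lborel)"
  proof -
    have "continuous_on UNIV (\<lambda>x::complex \<times> real. dd \<psi> (snd x *\<^sub>R fst x) (fst x))"
      by (intro continuous_on_frechet_derivative[OF \<psi>] continuous_intros)
    then have "(\<lambda>x::complex \<times> real. dd \<psi> (snd x *\<^sub>R fst x) (fst x)) \<in> borel_measurable borel"
      by (rule borel_measurable_continuous_onI)
    then have [measurable]: "(\<lambda>x::complex \<times> real. dd \<psi> (snd x *\<^sub>R fst x) (fst x)) \<in> borel_measurable (lborel \<Otimes>\<^sub>M lborel)"
      unfolding lborel_prod by simp
    have [measurable]: "cball (0::complex) 1 \<in> sets borel" by simp
    have "(\<lambda>x::complex \<times> real. 2 * dd \<psi> (snd x *\<^sub>R fst x) (fst x) * indicator {0<..} (snd x) * indicator (cball 0 1) (fst x))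
        \<in> borel_measurable (lborel \<Otimes>\<^sub>M lborel)"
      by measurable
    then show ?thesis by (simp add: J_def case_prod_beta')
  qed
  have J_le: "\<bar>J z t\<bar> \<le> 2 * K * cmod z / (1 + t * cmod z)\<^sup>2 * indicator {0..} t" for z t
  proof (cases "t > 0 \<and> cmod z \<le> 1")
    case True
    then show ?thesis using K[of "t *\<^sub>R z" z] by (simp add: J_def abs_mult)
  next
    case False
    then have "J z t = 0" by (auto simp: J_def indicator_def)
    then show ?thesis using K0 by (simp add: indicator_def)
  qed
  have J_sec: "J z \<in> borel_measurable lborel" for z
    using measurable_compose_Pair1[OF _ J_meas, of z] by simp
  have J_int: "integrable lborel (J z)" "(LBINT t. \<bar>J z t\<bar>) \<le> 2 * K * indicator (cball 0 1) z" for z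
  proof -
    have "integrable lborel (J z) \<and> (LBINT t. \<bar>J z t\<bar>) \<le> 2 * K * indicator (cball 0 1) z"
    proof (cases "z \<noteq> 0 \<and> cmod z \<le> 1")
      case True
      then have z: "cmod z > 0" by simp
      note dom = integrable_ray[OF z, of "2 * K"]
      have int: "integrable lborel (J z)"
        by (rule Bochner_Integration.integrable_bound[OF dom(1) J_sec])
           (rule AE_I2, unfold real_norm_def, rule order_trans[OF J_le abs_ge_self])
      have "(LBINT t. \<bar>J z t\<bar>) \<le> (LBINT t. 2 * K * cmod z / (1 + t * cmod z)\<^sup>2 * indicator {0..} t)"
        by (intro integral_mono integrable_abs int dom(1) J_le)
      then show ?thesis using int dom(2) True by simp
    next
      case False
      then have "J z = (\<lambda>t. 0)"
        by (auto simp: J_def fun_eq_iff linear_0[OF lin])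
      then show ?thesis using K0 by simp
    qed
    then show "integrable lborel (J z)" "(LBINT t. \<bar>J z t\<bar>) \<le> 2 * K * indicator (cball 0 1) z" by auto
  qed
  have J_pair: "integrable (lborel \<Otimes>\<^sub>M lborel) (case_prod J)"
  proof (rule integrable_pairI[OF J_meas, where B = "\<lambda>z. 2 * K * indicator (cball 0 1) z"])
    show "integrable lborel (\<lambda>z::complex. 2 * K * indicat_real (cball 0 1) z)"
      by (auto intro!: integrable_real_indicator simp: emeasure_cball_complex)
  qed (use J_int in auto)
  have slice: "(LBINT u. H u t) = (LBINT z. J z t)" for t
  proof (cases "t > 0")
    case True
    have m: "(\<lambda>u. H u t) \<in> borel_measurable borel"
      unfolding H_def using G_meas
      by (intro borel_measurable_times borel_measurable_divide borel_measurable_const borel_measurable_indicator) auto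
    have "(LBINT u. H u t) = (LBINT z. \<bar>t\<bar>\<^sup>2 * H (t *\<^sub>R z) t)"
      using lborel_integral_affine[OF _ m, of t 0] True by simp
    also have "\<dots> = (LBINT z. J z t)"
    proof (rule Bochner_Integration.integral_cong[OF refl])
      fix z :: complex
      have "G (t *\<^sub>R z) = t * dd \<psi> (t *\<^sub>R z) z"
        unfolding G_def using linear_cmul[OF lin] by simp
      moreover have "t *\<^sub>R z \<in> cball 0 t \<longleftrightarrow> z \<in> cball 0 1" using True by simp
      ultimately show "\<bar>t\<bar>\<^sup>2 * H (t *\<^sub>R z) t = J z t"
        using True by (simp add: H_def J_def indicator_def power2_eq_square power3_eq_cube)
    qed
    finally show ?thesis .
  qed (simp add: H_def J_def)
  have ray: "(LBINT t. J z t) = 2 * (L - \<psi> 0) * indicator (cball 0 1) z" if z: "z \<noteq> 0" for z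
  proof (cases "cmod z \<le> 1")
    case True
    have eq: "J z = (\<lambda>t. indicator {0<..} t *\<^sub>R (2 * dd \<psi> (t *\<^sub>R z) z))"
      using True by (auto simp: J_def fun_eq_iff)
    have "(LBINT t=0..\<infinity>. 2 * dd \<psi> (t *\<^sub>R z) z) = 2 * L - 2 * \<psi> 0"
    proof (rule interval_integral_FTC_integrable[where F = "\<lambda>t. 2 * \<psi> (t *\<^sub>R z)"])
      fix t :: real
      have "((\<lambda>t. \<psi> (t *\<^sub>R z)) has_derivative (\<lambda>h. dd \<psi> (t *\<^sub>R z) (h *\<^sub>R z))) (at t)"
        by (rule has_derivative_compose[OF _ smooth_imp_has_derivative[OF \<psi>]])
           (auto intro!: derivative_eq_intros)
      then have "((\<lambda>t. \<psi> (t *\<^sub>R z)) has_vector_derivative dd \<psi> (t *\<^sub>R z) z) (at t)"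
        unfolding has_vector_derivative_def using linear_cmul[OF lin] by simp
      then show "((\<lambda>t. 2 * \<psi> (t *\<^sub>R z)) has_vector_derivative 2 * dd \<psi> (t *\<^sub>R z) z) (at t)"
        by (rule has_vector_derivative_mult_right)
      have "continuous_on UNIV (\<lambda>t. 2 * dd \<psi> (t *\<^sub>R z) z)"
        by (intro continuous_intros continuous_on_frechet_derivative[OF \<psi>])
      then show "isCont (\<lambda>t. 2 * dd \<psi> (t *\<^sub>R z) z) t"
        by (simp add: continuous_on_eq_continuous_at)
    next
      show "set_integrable lborel (einterval 0 \<infinity>) (\<lambda>t. 2 * dd \<psi> (t *\<^sub>R z) z)"
        using J_int(1)[of z] unfolding eq set_integrable_def by (simp add: zero_ereal_def)
      have "((\<lambda>t. 2 * \<psi> (t *\<^sub>R z)) \<longlongrightarrow> 2 * \<psi> (0 *\<^sub>R z)) (at_right 0)"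
        by (intro tendsto_intros continuous_on_tendsto_compose[OF smooth_imp_continuous[OF \<psi>, of UNIV]]) auto
      then show "(((\<lambda>t. 2 * \<psi> (t *\<^sub>R z)) \<circ> real_of_ereal) \<longlongrightarrow> 2 * \<psi> 0) (at_right 0)"
        by (simp add: zero_ereal_def ereal_tendsto_simps)
      have "filterlim (\<lambda>t. t *\<^sub>R z) at_infinity at_top"
      proof -
        have "cmod z > 0" using z by simp
        then have "filterlim (\<lambda>t::real. \<bar>t\<bar> * cmod z) at_top at_top" by real_asymp
        then show ?thesis by (simp add: filterlim_at_infinity_conv_norm_at_top)
      qed
      then have "((\<lambda>t. 2 * \<psi> (t *\<^sub>R z)) \<longlongrightarrow> 2 * L) at_top"
        by (intro tendsto_intros filterlim_compose[OF L])
      then show "(((\<lambda>t. 2 * \<psi> (t *\<^sub>R z)) \<circ> real_of_ereal) \<longlongrightarrow> 2 * L) (at_left \<infinity>)"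
        by (simp add: ereal_tendsto_simps)
    qed simp
    then show ?thesis
      using True unfolding eq
      by (simp add: zero_ereal_def interval_integral_to_infinity_eq set_lebesgue_integral_def algebra_simps)
  qed (simp add: J_def)
  have "(LBINT u. G u / (cmod u)\<^sup>2) = (LBINT u. (LBINT t. H u t))"
    using H1 by (simp add: has_bochner_integral_iff)
  also have "\<dots> = (LBINT t. (LBINT u. H u t))"
    by (rule lborel_pair.Fubini_integral[OF H_pair, symmetric])
  also have "\<dots> = (LBINT t. (LBINT z. J z t))"
    by (simp only: slice)
  also have "\<dots> = (LBINT z. (LBINT t. J z t))"
    by (rule lborel_pair.Fubini_integral[OF J_pair])
  also have "\<dots> = (LBINT z. 2 * (L - \<psi> 0) * indicator (cball (0::complex) 1) z)"
  proof (rule integral_cong_AE)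
    show "(\<lambda>z. LBINT t. J z t) \<in> borel_measurable lborel"
      using J_meas by (intro lborel.borel_measurable_lebesgue_integral)
    show "AE z in lborel. (LBINT t. J z t) = 2 * (L - \<psi> 0) * indicator (cball (0::complex) 1) z"
      using AE_lborel_singleton[of 0] by eventually_elim (use ray in auto)
  qed (auto intro!: borel_measurable_times borel_measurable_indicator)
  also have "\<dots> = 2 * pi * (L - \<psi> 0)"
    by (simp add: measure_def emeasure_cball_complex)
  finally show ?thesis by (simp add: G_def)
qed

section \<open>The Dirichlet form on the sphere and critical points\<close>

lemma smooth_P1D: "smooth_P1 \<phi> \<Longrightarrow> smooth (\<phi> \<circ> Some)"
  by (simp add: smooth_P1_def)

text \<open>Outside the unit disc \<open>\<phi>(z)\<close> is a smooth function of \<open>1/z\<close>, and the derivative of \<open>1/z\<close>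
  has modulus \<open>1/|z|\<^sup>2\<close>.\<close>

lemma smooth_P1_derivative_decay:
  assumes "smooth_P1 \<phi>"
  obtains K where "\<And>z h. \<bar>dd (\<phi> \<circ> Some) z h\<bar> \<le> K * cmod h / (1 + cmod z)\<^sup>2"
proof -
  let ?f = "\<phi> \<circ> Some" and ?g = "\<phi> \<circ> chart_inf"
  have f: "smooth ?f" and g: "smooth ?g" using assms by (auto simp: smooth_P1_def)
  obtain B where B: "0 \<le> B" "\<And>z h. z \<in> cball 0 1 \<Longrightarrow> \<bar>dd ?f z h\<bar> \<le> B * norm h"
    using frechet_derivative_bounded_on_compact[OF f compact_cball] by metis
  obtain C where C: "0 \<le> C" "\<And>z h. z \<in> cball 0 1 \<Longrightarrow> \<bar>dd ?g z h\<bar> \<le> C * norm h"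
    using frechet_derivative_bounded_on_compact[OF g compact_cball] by metis
  have "\<bar>dd ?f z h\<bar> \<le> (4 * (B + C)) * cmod h / (1 + cmod z)\<^sup>2" for z h
  proof (cases "cmod z \<le> 1")
    case True
    have "(1 + cmod z)\<^sup>2 \<le> 2\<^sup>2" using True by (intro power_mono) auto
    moreover have pos: "0 < (1 + cmod z)\<^sup>2" using norm_ge_zero[of z] by (intro zero_less_power) linarith
    ultimately have q: "1 \<le> 4 / (1 + cmod z)\<^sup>2" by simp
    have "\<bar>dd ?f z h\<bar> \<le> (B + C) * cmod h * 1"
      using B(2)[of z h] C(1) True by (simp add: algebra_simps add_increasing2)
    also have "\<dots> \<le> (B + C) * cmod h * (4 / (1 + cmod z)\<^sup>2)"
      using B(1) C(1) q by (intro mult_left_mono) auto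
    finally show ?thesis by (simp add: mult_ac)
  next
    case False
    then have z0: "z \<noteq> 0" and z1: "cmod z \<ge> 1" by auto
    have D: "(?f has_derivative (\<lambda>h. dd ?g (1 / z) (- h / z\<^sup>2))) (at z)"
    proof (rule has_derivative_transform_within_open)
      show "open (- {0::complex})" by auto
      show "z \<in> - {0}" using z0 by simp
      show "?g (1 / x) = ?f x" if "x \<in> - {0}" for x
        using that by (simp add: chart_inf_def)
      have "((\<lambda>x. 1 / x) has_derivative (\<lambda>h. - h / z\<^sup>2)) (at z)"
        using z0 by (auto intro!: derivative_eq_intros simp: power2_eq_square)
      from has_derivative_compose[OF this smooth_imp_has_derivative[OF g]]
      show "((\<lambda>x. ?g (1 / x)) has_derivative (\<lambda>h. dd ?g (1 / z) (- h / z\<^sup>2))) (at z)" .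
    qed
    have "(1 + cmod z)\<^sup>2 \<le> (2 * cmod z)\<^sup>2" using z1 by (intro power_mono) auto
    moreover have pos: "0 < (1 + cmod z)\<^sup>2" using norm_ge_zero[of z] by (intro zero_less_power) linarith
    ultimately have q: "1 / (cmod z)\<^sup>2 \<le> 4 / (1 + cmod z)\<^sup>2"
      using z0 by (simp add: power_mult_distrib field_simps)
    have "dd ?f z h = dd ?g (1 / z) (- h / z\<^sup>2)"
      using frechet_derivative_at[OF D] by metis
    also have "\<bar>\<dots>\<bar> \<le> C * norm (- h / z\<^sup>2)"
      using z1 by (intro C(2)) (simp add: norm_divide divide_simps)
    also have "\<dots> \<le> (B + C) * cmod h * (1 / (cmod z)\<^sup>2)"
      using B(1) by (simp add: norm_divide norm_power divide_right_mono mult_right_mono)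
    also have "\<dots> \<le> (B + C) * cmod h * (4 / (1 + cmod z)\<^sup>2)"
      using B(1) C(1) q by (intro mult_left_mono) auto
    finally show ?thesis by (simp add: mult_ac)
  qed
  then show thesis by (rule that)
qed

lemma smooth_P1_tendsto_at_infinity:
  assumes "smooth_P1 \<phi>"
  shows "((\<phi> \<circ> Some) \<longlongrightarrow> \<phi> None) at_infinity"
proof -
  have "continuous_on UNIV (\<phi> \<circ> chart_inf)"
    using assms by (intro smooth_imp_continuous) (simp add: smooth_P1_def)
  then have "isCont (\<phi> \<circ> chart_inf) 0" by (simp only: continuous_on_eq_continuous_at[OF open_UNIV] UNIV_I)
  then have "((\<lambda>z. (\<phi> \<circ> chart_inf) (inverse z)) \<longlongrightarrow> (\<phi> \<circ> chart_inf) 0) at_infinity"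
    by (rule isCont_tendsto_compose) (rule tendsto_inverse_0)
  moreover have "\<forall>\<^sub>F z in at_infinity. (\<phi> \<circ> chart_inf) (inverse z) = (\<phi> \<circ> Some) z"
    unfolding eventually_at_infinity
    by (intro exI[of _ 1]) (auto simp: chart_inf_def inverse_eq_divide)
  ultimately have "((\<phi> \<circ> Some) \<longlongrightarrow> (\<phi> \<circ> chart_inf) 0) at_infinity"
    by (rule Lim_transform_eventually)
  then show ?thesis by (simp add: chart_inf_def)
qed

lemma smooth_P1_add_scaled:
  assumes "smooth_P1 \<phi>" "smooth_P1 \<psi>"
  shows "smooth_P1 (\<lambda>p. \<phi> p + t * \<psi> p)"
  using assms unfolding smooth_P1_def smooth_eq_smooth_on o_def
  by (auto intro!: smooth_on_add smooth_on_cmult)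

definition grad_dot :: "(complex \<Rightarrow> real) \<Rightarrow> (complex \<Rightarrow> real) \<Rightarrow> complex \<Rightarrow> real" where
  "grad_dot f g z = (\<Sum>b\<in>Basis. dd f z b * dd g z b)"

lemma continuous_grad_dot: "smooth f \<Longrightarrow> smooth g \<Longrightarrow> continuous_on UNIV (grad_dot f g)"
  unfolding grad_dot_def
  by (intro continuous_on_sum continuous_on_mult smooth_imp_continuous smooth_frechet_derivative)

lemma integrable_grad_dot:
  assumes "smooth_P1 \<phi>" "smooth_P1 \<psi>"
  shows "integrable lborel (grad_dot (\<phi> \<circ> Some) (\<psi> \<circ> Some))"
proof -
  obtain K where K: "\<And>z h. \<bar>dd (\<phi> \<circ> Some) z h\<bar> \<le> K * cmod h / (1 + cmod z)\<^sup>2"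
    using smooth_P1_derivative_decay[OF assms(1)] by metis
  obtain M where M: "\<And>z h. \<bar>dd (\<psi> \<circ> Some) z h\<bar> \<le> M * cmod h / (1 + cmod z)\<^sup>2"
    using smooth_P1_derivative_decay[OF assms(2)] by metis
  have KM: "0 \<le> K" "0 \<le> M" using K[of 0 1] M[of 0 1] by auto
  show ?thesis
  proof (rule Bochner_Integration.integrable_bound)
    show "integrable lborel (\<lambda>z. 2 * (K * M) * decay z)" using integrable_decay by simp
    show "grad_dot (\<phi> \<circ> Some) (\<psi> \<circ> Some) \<in> borel_measurable lborel"
      using borel_measurable_continuous_onI[OF continuous_grad_dot[OF assms[THEN smooth_P1D]]] by simp
    show "AE z in lborel. norm (grad_dot (\<phi> \<circ> Some) (\<psi> \<circ> Some) z) \<le> norm (2 * (K * M) * decay z)"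
      using AE_lborel_singleton[of 0]
    proof eventually_elim
      case (elim z)
      have term_le: "\<bar>dd (\<phi> \<circ> Some) z b * dd (\<psi> \<circ> Some) z b\<bar>
          \<le> (K * M) * decay z" if "b \<in> Basis" for b
      proof -
        have "norm b = 1" using that by simp
        then have "\<bar>dd (\<phi> \<circ> Some) z b * dd (\<psi> \<circ> Some) z b\<bar>
            \<le> (K / (1 + cmod z)\<^sup>2) * (M / (1 + cmod z)\<^sup>2)"
          unfolding abs_mult using K[of z b] M[of z b] KM by (intro mult_mono) auto
        also have "\<dots> = (K * M) * (1 / ((1 + cmod z)\<^sup>2 * (1 + cmod z)\<^sup>2))" by simp
        also have "\<dots> \<le> (K * M) * decay z"
        proof (rule mult_left_mono)
          have "cmod z \<le> (1 + cmod z)\<^sup>2" by (simp add: power2_sum add_increasing)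
          then show "1 / ((1 + cmod z)\<^sup>2 * (1 + cmod z)\<^sup>2) \<le> decay z"
            unfolding decay_def using elim
            by (intro divide_left_mono mult_right_mono mult_pos_pos zero_less_power) (auto simp: add_pos_nonneg)
        qed (use KM in simp)
        finally show ?thesis .
      qed
      have "\<bar>grad_dot (\<phi> \<circ> Some) (\<psi> \<circ> Some) z\<bar>
          \<le> (\<Sum>b\<in>Basis. \<bar>dd (\<phi> \<circ> Some) z b * dd (\<psi> \<circ> Some) z b\<bar>)"
        unfolding grad_dot_def by (rule sum_abs)
      also have "\<dots> \<le> (\<Sum>b\<in>(Basis::complex set). (K * M) * decay z)"
        by (rule sum_mono) (rule term_le)
      finally show ?case using KM by simp
    qed
  qed
qed

lemma frechet_derivative_add_scaled:
  fixes f g :: "'a::euclidean_space \<Rightarrow> real"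
  assumes "smooth f" "smooth g"
  shows "dd (\<lambda>z. f z + t * g z) x h
    = dd f x h + t * dd g x h"
proof -
  have "((\<lambda>z. f z + t * g z) has_derivative
      (\<lambda>h. dd f x h + t * dd g x h)) (at x)"
    by (intro has_derivative_add has_derivative_mult_right smooth_imp_has_derivative assms)
  from frechet_derivative_at[OF this] show ?thesis by metis
qed

lemma S_0_eq: "S_0 \<phi> = (1 / 8) * (LBINT z. grad_dot (\<phi> \<circ> Some) (\<phi> \<circ> Some) z)"
  by (simp add: S_0_def grad_dot_def power2_eq_square)

lemma S_0_add_scaled:
  assumes "smooth_P1 \<phi>" "smooth_P1 \<psi>"
  shows "S_0 (\<lambda>p. \<phi> p + t * \<psi> p)
    = S_0 \<phi> + t * ((1 / 4) * (LBINT z. grad_dot (\<phi> \<circ> Some) (\<psi> \<circ> Some) z)) + t\<^sup>2 * S_0 \<psi>"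
proof -
  let ?a = "\<phi> \<circ> Some" and ?b = "\<psi> \<circ> Some"
  have s: "smooth ?a" "smooth ?b" using assms smooth_P1D by auto
  have eq: "(\<lambda>p. \<phi> p + t * \<psi> p) \<circ> Some = (\<lambda>z. ?a z + t * ?b z)" by (simp add: o_def)
  have expand: "grad_dot ((\<lambda>p. \<phi> p + t * \<psi> p) \<circ> Some) ((\<lambda>p. \<phi> p + t * \<psi> p) \<circ> Some)
      = (\<lambda>z. grad_dot ?a ?a z + (2 * t) * grad_dot ?a ?b z + t\<^sup>2 * grad_dot ?b ?b z)"
    unfolding eq grad_dot_def frechet_derivative_add_scaled[OF s]
    by (simp add: sum_distrib_left sum.distrib[symmetric] power2_eq_square algebra_simps)
  note int = integrable_grad_dot[OF assms(1) assms(1)] integrable_grad_dot[OF assms]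
    integrable_grad_dot[OF assms(2) assms(2)]
  show ?thesis
    unfolding S_0_eq expand using int by (simp add: algebra_simps)
qed

lemma continuous_AE_eq_0_imp_eq_0:
  fixes f :: "'a::euclidean_space \<Rightarrow> real"
  assumes c: "continuous_on UNIV f" and ae: "AE x in lborel. f x = 0"
  shows "f x = 0"
proof -
  have op: "open {x. f x \<noteq> 0}"
    using c by (intro open_Collect_neq continuous_on_const)
  have "emeasure lborel {x. f x \<noteq> 0} = 0"
    using ae op by (subst (asm) AE_iff_measurable[OF _ refl]) (auto simp: borel_open)
  then have "{x. f x \<noteq> 0} \<in> null_sets lborel" using op by (auto simp: null_sets_def borel_open)
  then have "negligible {x. f x \<noteq> 0}"
    using negligible_iff_null_sets null_sets_completionI by blast
  then show ?thesis using open_not_negligible[OF op] by auto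
qed

text \<open>The Dirichlet form is definite modulo constants: a vanishing gradient makes \<open>\<psi>\<close> constant on the
  plane, and the constant is the value at infinity.\<close>

lemma grad_dot_self_eq_0_imp:
  assumes \<psi>: "smooth_P1 \<psi>" and "\<psi> None = 0"
    and zero: "(LBINT z. grad_dot (\<psi> \<circ> Some) (\<psi> \<circ> Some) z) = 0"
  shows "\<psi> p = 0"
proof -
  let ?f = "\<psi> \<circ> Some"
  have f: "smooth ?f" using \<psi> smooth_P1D by blast
  have nn: "0 \<le> grad_dot ?f ?f z" for z
    unfolding grad_dot_def by (intro sum_nonneg) simp
  have "AE z in lborel. grad_dot ?f ?f z = 0"
    using integral_nonneg_eq_0_iff_AE[OF integrable_grad_dot[OF \<psi> \<psi>]] nn zero by simp
  then have "grad_dot ?f ?f z = 0" for z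
    by (rule continuous_AE_eq_0_imp_eq_0[OF continuous_grad_dot[OF f f]])
  then have "dd ?f z b = 0" if "b \<in> Basis" for z b
    using that unfolding grad_dot_def by (simp add: sum_nonneg_eq_0_iff)
  then have "dd ?f z h = 0" for z h
    by (subst frechet_derivative_expand[OF f]) simp
  then have D: "(?f has_derivative (\<lambda>h. 0)) (at z)" for z
    using smooth_imp_has_derivative[OF f, of z] by (metis (no_types, lifting) ext)
  have "\<exists>c. \<forall>z\<in>UNIV. ?f z = c"
    by (rule has_derivative_zero_constant[OF convex_UNIV]) (rule D)
  then obtain c where c: "?f = (\<lambda>z. c)" by (auto simp: fun_eq_iff)
  have "(?f \<longlongrightarrow> 0) at_infinity" using smooth_P1_tendsto_at_infinity[OF \<psi>] assms(2) by simp
  then have "c = 0" unfolding c by (rule tendsto_unique[OF trivial_limit_at_infinity tendsto_const])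
  then show ?thesis using c assms(2) by (cases p) (auto simp: fun_eq_iff)
qed

lemma integrable_mult_supported:
  fixes f g :: "complex \<Rightarrow> real"
  assumes "continuous_on UNIV f" "supported_in R f" "continuous_on UNIV g"
  shows "integrable lborel (\<lambda>z. f z * g z)"
proof -
  have "integrable lborel (\<lambda>z. indicator (cball 0 R) z *\<^sub>R (f z * g z))"
    using assms by (intro borel_integrable_compact compact_cball continuous_intros) (auto intro: continuous_on_subset)
  moreover have "(\<lambda>z. indicator (cball 0 R) z *\<^sub>R (f z * g z)) = (\<lambda>z. f z * g z)"
    using assms(2) by (auto simp: fun_eq_iff supported_in_def indicator_def)
  ultimately show ?thesis by simp
qed

lemma integrable_supported:
  fixes f :: "complex \<Rightarrow> real"
  assumes "continuous_on UNIV f" "supported_in R f"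
  shows "integrable lborel f"
  using integrable_mult_supported[OF assms, of "\<lambda>z. 1"] by simp

text \<open>Along a line \<open>\<Phi> + t \<psi>\<close> the action is a quadratic polynomial in \<open>t\<close>; the condition says that its
  linear coefficient vanishes.\<close>

lemma critical_point_iff:
  assumes f: "continuous_on UNIV (\<lambda>z. area \<Omega> * \<delta> z - chi z)" "supported_in R (\<lambda>z. area \<Omega> * \<delta> z - chi z)"
  shows "critical_point (S_reg \<Omega> chi \<delta>) \<Phi> \<longleftrightarrow> smooth_P1 \<Phi> \<and>
    (\<forall>\<psi>. smooth_P1 \<psi> \<longrightarrow> (1 / 4) * (LBINT z. grad_dot (\<Phi> \<circ> Some) (\<psi> \<circ> Some) z)
       + (LBINT z. (area \<Omega> * \<delta> z - chi z) * \<psi> (Some z)) = 0)"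
proof -
  have "((\<lambda>t. S_reg \<Omega> chi \<delta> (\<lambda>p. \<Phi> p + t * \<psi> p)) has_real_derivative 0) (at 0) \<longleftrightarrow>
      (1 / 4) * (LBINT z. grad_dot (\<Phi> \<circ> Some) (\<psi> \<circ> Some) z)
       + (LBINT z. (area \<Omega> * \<delta> z - chi z) * \<psi> (Some z)) = 0" (is "?D \<longleftrightarrow> ?B + ?L = 0")
    if \<Phi>: "smooth_P1 \<Phi>" and \<psi>: "smooth_P1 \<psi>" for \<psi>
  proof -
    have int: "integrable lborel (\<lambda>z. (area \<Omega> * \<delta> z - chi z) * \<phi> (Some z))" if "smooth_P1 \<phi>" for \<phi>
      using integrable_mult_supported[OF f smooth_imp_continuous[OF smooth_P1D[OF that]]] by simp
    have eq: "S_reg \<Omega> chi \<delta> (\<lambda>p. \<Phi> p + t * \<psi> p) = S_reg \<Omega> chi \<delta> \<Phi> + t * (?B + ?L) + t\<^sup>2 * S_0 \<psi>" for t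
    proof -
      have "(LBINT z. (area \<Omega> * \<delta> z - chi z) * (\<Phi> (Some z) + t * \<psi> (Some z)))
          = (LBINT z. (area \<Omega> * \<delta> z - chi z) * \<Phi> (Some z) + t * ((area \<Omega> * \<delta> z - chi z) * \<psi> (Some z)))"
        by (intro Bochner_Integration.integral_cong) (auto simp: algebra_simps)
      also have "\<dots> = (LBINT z. (area \<Omega> * \<delta> z - chi z) * \<Phi> (Some z)) + t * ?L"
        using int[OF \<Phi>] int[OF \<psi>] by (subst Bochner_Integration.integral_add) auto
      finally show ?thesis
        unfolding S_reg_def S_0_add_scaled[OF \<Phi> \<psi>] by (simp add: algebra_simps)
    qed
    have D: "((\<lambda>t. S_reg \<Omega> chi \<delta> (\<lambda>p. \<Phi> p + t * \<psi> p)) has_real_derivative (?B + ?L)) (at 0)"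
      unfolding eq by (auto intro!: derivative_eq_intros)
    then show ?thesis using DERIV_unique by auto
  qed
  then show ?thesis unfolding critical_point_def by blast
qed

text \<open>The Dirichlet form of the difference vanishes: test both weak equations with the difference itself.\<close>

lemma critical_point_unique:
  assumes f: "continuous_on UNIV (\<lambda>z. area \<Omega> * \<delta> z - chi z)" "supported_in R (\<lambda>z. area \<Omega> * \<delta> z - chi z)"
    and cp: "critical_point (S_reg \<Omega> chi \<delta>) \<Phi>" "\<Phi> None = 0"
      "critical_point (S_reg \<Omega> chi \<delta>) \<Phi>'" "\<Phi>' None = 0"
  shows "\<Phi> = \<Phi>'"
proof
  fix p
  let ?\<psi> = "\<lambda>p. \<Phi> p + (-1) * \<Phi>' p"
  note crit = critical_point_iff[OF f]
  have s: "smooth_P1 \<Phi>" "smooth_P1 \<Phi>'" using cp crit by blast+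
  have \<psi>: "smooth_P1 ?\<psi>" by (rule smooth_P1_add_scaled[OF s])
  have eq: "(LBINT z. grad_dot (\<Phi> \<circ> Some) (?\<psi> \<circ> Some) z) = (LBINT z. grad_dot (\<Phi>' \<circ> Some) (?\<psi> \<circ> Some) z)"
  proof -
    note crit' = cp(1)[unfolded crit, THEN conjunct2, rule_format, OF \<psi>]
      cp(3)[unfolded crit, THEN conjunct2, rule_format, OF \<psi>]
    show ?thesis using crit' by linarith
  qed
  have split: "grad_dot (?\<psi> \<circ> Some) (?\<psi> \<circ> Some) z
      = grad_dot (\<Phi> \<circ> Some) (?\<psi> \<circ> Some) z - grad_dot (\<Phi>' \<circ> Some) (?\<psi> \<circ> Some) z" for z
  proof -
    have c: "?\<psi> \<circ> Some = (\<lambda>z. (\<Phi> \<circ> Some) z + (-1) * (\<Phi>' \<circ> Some) z)" by (simp add: o_def)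
    have d: "dd (?\<psi> \<circ> Some) z b
        = dd (\<Phi> \<circ> Some) z b - dd (\<Phi>' \<circ> Some) z b" for b
      unfolding c frechet_derivative_add_scaled[OF s[THEN smooth_P1D]] by simp
    show ?thesis
      unfolding grad_dot_def sum_subtractf[symmetric] left_diff_distrib[symmetric] d ..
  qed
  have zero: "(LBINT z. grad_dot (?\<psi> \<circ> Some) (?\<psi> \<circ> Some) z) = 0"
    unfolding split using eq integrable_grad_dot[OF s(1) \<psi>] integrable_grad_dot[OF s(2) \<psi>] by simp
  have "?\<psi> None = 0" using cp(2,4) by simp
  then have "?\<psi> p = 0" by (rule grad_dot_self_eq_0_imp[OF \<psi> _ zero])
  then show "\<Phi> p = \<Phi>' p" by simp
qed

section \<open>Integration by parts against the logarithm\<close>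

text \<open>A function smooth across the origin that decreases to \<open>ln|u|\<close> as \<open>\<eta>\<close> tends to 0.\<close>

definition reg_ln :: "real \<Rightarrow> complex \<Rightarrow> real" where
  "reg_ln \<eta> u = ln ((cmod u)\<^sup>2 + \<eta>\<^sup>2) / 2"

text \<open>Smoothness of real functions such as \<open>ln\<close> and \<open>x \<mapsto> 1/x\<^sup>2\<close> on the positive axis is read off from
  their holomorphic extensions.\<close>

lemma smooth_on_Re_holomorphic:
  fixes f :: "complex \<Rightarrow> complex" and g :: "'a::euclidean_space \<Rightarrow> real"
  assumes f: "f holomorphic_on {w. Re w > 0}" and g: "smooth_on U g" and U: "open U"
    and pos: "\<And>x. x \<in> U \<Longrightarrow> g x > 0"
  shows "smooth_on U (\<lambda>x. Re (f (complex_of_real (g x))))"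
proof -
  have op: "open {w. Re w > 0}" by (rule open_halfspace_Re_gt)
  have "smooth_on U (\<lambda>x. complex_of_real (g x))"
    by (rule smooth_on_linear[OF bounded_linear_of_real U g])
  then have "smooth_on U (\<lambda>x. f (complex_of_real (g x)))"
    by (rule smooth_on_compose[OF smooth_on_holomorphic[OF op f] _ U op]) (use pos in auto)
  then show ?thesis by (rule smooth_on_linear[OF bounded_linear_Re U])
qed

lemma smooth_on_ln:
  fixes g :: "'a::euclidean_space \<Rightarrow> real"
  assumes "smooth_on U g" "open U" "\<And>x. x \<in> U \<Longrightarrow> g x > 0"
  shows "smooth_on U (\<lambda>x. ln (g x))"
proof (rule smooth_on_cong[OF assms(2)])
  have "Ln holomorphic_on {w. Re w > 0}"
    by (intro holomorphic_intros) (auto simp: complex_nonpos_Reals_iff)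
  from smooth_on_Re_holomorphic[OF this assms]
  show "smooth_on U (\<lambda>x. Re (Ln (complex_of_real (g x))))" .
  show "Re (Ln (complex_of_real (g x))) = ln (g x)" if "x \<in> U" for x
    using assms(3)[OF that] by (simp add: Ln_of_real)
qed

lemma smooth_norm_sq: "smooth (\<lambda>u::'a::euclidean_space. (norm u)\<^sup>2)"
  unfolding smooth_eq_smooth_on power2_norm_eq_inner
  by (intro smooth_on_inner smooth_on_id open_UNIV)

lemma smooth_reg_ln:
  assumes "\<eta> > 0"
  shows "smooth (reg_ln \<eta>)"
proof -
  have "smooth_on UNIV (\<lambda>u::complex. ln ((cmod u)\<^sup>2 + \<eta>\<^sup>2))"
    using assms smooth_norm_sq
    by (intro smooth_on_ln smooth_on_add smooth_on_const open_UNIV) (auto simp: smooth_eq_smooth_on add_nonneg_pos)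
  then have "smooth_on UNIV (\<lambda>u::complex. (1 / 2) * ln ((cmod u)\<^sup>2 + \<eta>\<^sup>2))"
    by (rule smooth_on_cmult[OF open_UNIV])
  then show ?thesis unfolding smooth_eq_smooth_on reg_ln_def by simp
qed

text \<open>With \<open>x = \<eta>/|u|\<close> the difference is \<open>ln (1 + x\<^sup>2)/2 \<le> ln (1 + x) \<le> x\<close>.\<close>

lemma reg_ln_approx:
  assumes u: "u \<noteq> 0" and \<eta>: "\<eta> > 0"
  shows "\<bar>reg_ln \<eta> u - ln (cmod u)\<bar> \<le> \<eta> * (1 / cmod u)"
proof -
  define x where "x = \<eta> / cmod u"
  have r: "cmod u > 0" using u by simp
  have x: "x > 0" using r \<eta> by (simp add: x_def)
  have "reg_ln \<eta> u = ln ((cmod u)\<^sup>2 * (1 + x\<^sup>2)) / 2"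
    unfolding reg_ln_def x_def using u by (simp add: power_divide distrib_left)
  also have "\<dots> = ln (cmod u) + ln (1 + x\<^sup>2) / 2"
  proof -
    have "1 + x\<^sup>2 > 0" by (simp add: add_pos_nonneg)
    then show ?thesis using r by (simp add: ln_mult ln_realpow)
  qed
  finally have eq: "reg_ln \<eta> u - ln (cmod u) = ln (1 + x\<^sup>2) / 2" by simp
  have "ln (1 + x\<^sup>2) \<le> ln ((1 + x)\<^sup>2)"
    using x by (subst ln_le_cancel_iff) (auto simp: power2_sum add_pos_nonneg)
  also have "\<dots> = 2 * ln (1 + x)" using x by (simp add: ln_realpow)
  also have "\<dots> \<le> 2 * x" using x ln_add_one_self_le_self[of x] by simp
  finally have "ln (1 + x\<^sup>2) / 2 \<le> x" by simp
  moreover have "0 \<le> ln (1 + x\<^sup>2) / 2" by simp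
  ultimately show ?thesis unfolding eq by (simp add: x_def)
qed

lemma has_derivative_reg_ln:
  assumes "\<eta> > 0"
  shows "(reg_ln \<eta> has_derivative (\<lambda>h. (u \<bullet> h) / ((cmod u)\<^sup>2 + \<eta>\<^sup>2))) (at u)"
proof -
  have pos: "0 < u \<bullet> u + \<eta>\<^sup>2" using assms by (simp add: add_nonneg_pos)
  have "((\<lambda>u. ln (u \<bullet> u + \<eta>\<^sup>2) / 2) has_derivative (\<lambda>h. (u \<bullet> h) / (u \<bullet> u + \<eta>\<^sup>2))) (at u)"
    using pos by (auto intro!: derivative_eq_intros simp: inner_commute field_simps)
  then show ?thesis unfolding reg_ln_def[abs_def] power2_norm_eq_inner .
qed

lemma reg_ln_tendsto: "((\<lambda>\<eta>. reg_ln \<eta> u) \<longlongrightarrow> ln (cmod u)) (at_right 0)" if u: "u \<noteq> 0"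
proof (rule Lim_null[THEN iffD2], rule Lim_null_comparison)
  show "\<forall>\<^sub>F \<eta> in at_right 0. norm (reg_ln \<eta> u - ln (cmod u)) \<le> \<eta> * (1 / cmod u)"
    using reg_ln_approx[OF u] by (auto simp: eventually_at_right_less eventually_at_topological intro!: exI[of _ UNIV])
  have "((\<lambda>\<eta>. \<eta> * (1 / cmod u)) \<longlongrightarrow> 0 * (1 / cmod u)) (at_right 0)" by (intro tendsto_intros)
  then show "((\<lambda>\<eta>. \<eta> * (1 / cmod u)) \<longlongrightarrow> 0) (at_right 0)" by simp
qed

lemma supported_in_reflect:
  fixes z :: "'a::real_normed_vector"
  assumes "supported_in R f"
  shows "supported_in (norm z + R) (\<lambda>w. f (z - w))"
  unfolding supported_in_def
proof (intro allI impI)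
  fix w :: 'a assume "norm z + R < norm w"
  then have "R < norm (z - w)" using norm_triangle_ineq2[of w z] by (simp add: norm_minus_commute)
  then show "f (z - w) = 0" using assms by (simp add: supported_in_def)
qed

lemma smooth_reflect:
  fixes f :: "'a::euclidean_space \<Rightarrow> real"
  assumes "smooth f"
  shows "smooth (\<lambda>w. f (z - w))"
proof -
  have "smooth_on UNIV (\<lambda>w. z + (-1) *\<^sub>R w)"
    by (intro smooth_on_add smooth_on_const smooth_on_linear[OF bounded_linear_scaleR_right] smooth_on_id open_UNIV)
  then have "smooth_on UNIV (\<lambda>w. f (z + (-1) *\<^sub>R w))"
    by (rule smooth_on_compose[OF assms[unfolded smooth_eq_smooth_on] _ open_UNIV open_UNIV subset_UNIV])
  then show ?thesis by (simp add: smooth_eq_smooth_on)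
qed

lemma smooth_mult:
  fixes f g :: "'a::euclidean_space \<Rightarrow> real"
  shows "smooth f \<Longrightarrow> smooth g \<Longrightarrow> smooth (\<lambda>x. f x * g x)"
  unfolding smooth_eq_smooth_on by (intro smooth_on_mult open_UNIV)

text \<open>Integration by parts against the singular function \<open>ln|u|\<close>, whose gradient is \<open>u/|u|\<^sup>2\<close>: it holds
  for the smooth \<open>reg_ln \<eta>\<close>, and both sides converge as \<open>\<eta>\<close> tends to 0, with majorants \<open>|ln|u|| + 1/|u|\<close>
  and \<open>1/|u|\<close> times bounded functions of compact support.\<close>

lemma integral_ln_derivative:
  fixes f :: "complex \<Rightarrow> real"
  assumes f: "smooth f" and R: "supported_in R f"
  shows "(LBINT u. ln (cmod u) * dd f (z - u) h)
    = (LBINT u. (u \<bullet> h) / (cmod u)\<^sup>2 * f (z - u))"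
proof -
  define g where "g = (\<lambda>u. f (z - u))"
  define g' where "g' = (\<lambda>u. dd f (z - u) h)"
  have g: "smooth g" "supported_in (norm z + R) g"
    unfolding g_def by (rule smooth_reflect[OF f] supported_in_reflect[OF R])+
  have g'_supp: "supported_in (norm z + R) g'"
    unfolding g'_def using supported_in_frechet_derivative[OF R]
    by (intro supported_in_reflect) (simp add: supported_in_def)
  have g'_cont: "continuous_on UNIV g'"
    unfolding g'_def by (intro continuous_on_frechet_derivative[OF f] continuous_intros)
  have g_meas [measurable]: "g \<in> borel_measurable borel"
    using smooth_imp_continuous[OF g(1)] by (rule borel_measurable_continuous_onI)
  have g'_meas [measurable]: "g' \<in> borel_measurable borel"
    using g'_cont by (rule borel_measurable_continuous_onI)
  obtain B where B: "\<And>u. \<bar>g u\<bar> \<le> B"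
    using continuous_supported_in_bounded[OF smooth_imp_continuous[OF g(1)] g(2)] by metis
  obtain B' where B': "\<And>u. \<bar>g' u\<bar> \<le> B'"
    using continuous_supported_in_bounded[OF g'_cont g'_supp] by metis
  have Dg: "(g has_derivative (\<lambda>k. - dd f (z - u) k)) (at u)" for u
  proof -
    have "((\<lambda>u. z - u) has_derivative (\<lambda>k. - k)) (at u)" by (auto intro!: derivative_eq_intros)
    from has_derivative_compose[OF this smooth_imp_has_derivative[OF f]]
    have "(g has_derivative (\<lambda>k. dd f (z - u) (- k))) (at u)" by (simp add: g_def)
    moreover have "dd f (z - u) (- k) = - dd f (z - u) k" for k
      using linear_neg[OF has_derivative_linear[OF smooth_imp_has_derivative[OF f]]] .
    ultimately show ?thesis by simp
  qed
  have li1: "integrable lborel (\<lambda>u. (1 / cmod u) * \<bar>g u\<bar>)"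
    using B g(2) by (intro locally_integrable_mult[OF locally_integrable_inverse_norm, where R = "norm z + R" and B = B])
      (auto simp: supported_in_def)
  have li2: "integrable lborel (\<lambda>u. (1 / cmod u) * \<bar>g' u\<bar>)"
    using B' g'_supp by (intro locally_integrable_mult[OF locally_integrable_inverse_norm, where R = "norm z + R" and B = B'])
      (auto simp: supported_in_def)
  have li3: "integrable lborel (\<lambda>u. ln (cmod u) * \<bar>g' u\<bar>)"
    using B' g'_supp by (intro locally_integrable_mult[OF locally_integrable_ln, where R = "norm z + R" and B = B'])
      (auto simp: supported_in_def)
  have reg: "(LBINT u. reg_ln \<eta> u * g' u) = (LBINT u. (u \<bullet> h) / ((cmod u)\<^sup>2 + \<eta>\<^sup>2) * g u)"
    if \<eta>: "\<eta> > 0" for \<eta>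
  proof -
    let ?F = "\<lambda>u. reg_ln \<eta> u * g u"
    have F: "smooth ?F" by (rule smooth_mult[OF smooth_reg_ln[OF \<eta>] g(1)])
    have "supported_in (norm z + R) ?F" using g(2) by (simp add: supported_in_def)
    from integral_frechet_derivative_eq_0[OF F this, of h]
    have "(LBINT u. dd ?F u h) = 0" .
    moreover have "dd ?F u h = (u \<bullet> h) / ((cmod u)\<^sup>2 + \<eta>\<^sup>2) * g u - reg_ln \<eta> u * g' u" for u
    proof -
      have "(?F has_derivative (\<lambda>k. reg_ln \<eta> u * (- dd f (z - u) k) + (u \<bullet> k) / ((cmod u)\<^sup>2 + \<eta>\<^sup>2) * g u)) (at u)"
        by (rule has_derivative_mult[OF has_derivative_reg_ln[OF \<eta>] Dg])
      from frechet_derivative_at[OF this, THEN fun_cong, of h] show ?thesis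
        by (simp add: g'_def)
    qed
    moreover have "integrable lborel (\<lambda>u. g' u * reg_ln \<eta> u)"
      by (rule integrable_mult_supported[OF g'_cont g'_supp smooth_imp_continuous[OF smooth_reg_ln[OF \<eta>]]])
    moreover have "integrable lborel (\<lambda>u. g u * ((u \<bullet> h) / ((cmod u)\<^sup>2 + \<eta>\<^sup>2)))"
      using \<eta> by (intro integrable_mult_supported[OF smooth_imp_continuous[OF g(1)] g(2)] continuous_intros)
        (auto simp: sum_power2_eq_zero_iff)
    ultimately show ?thesis by (simp add: mult.commute)
  qed
  have lim1: "((\<lambda>\<eta>. LBINT u. reg_ln \<eta> u * g' u) \<longlongrightarrow> (LBINT u. ln (cmod u) * g' u)) (at_right 0)"
  proof (rule dominated_convergence_within[where w = "\<lambda>u. \<bar>ln (cmod u) * \<bar>g' u\<bar>\<bar> + (1 / cmod u) * \<bar>g' u\<bar>"])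
    show "integrable lborel (\<lambda>u. \<bar>ln (cmod u) * \<bar>g' u\<bar>\<bar> + (1 / cmod u) * \<bar>g' u\<bar>)"
      using li2 li3 by (intro Bochner_Integration.integrable_add integrable_abs)
    show "\<forall>\<^sub>F \<eta> in at_right 0. (\<lambda>u. reg_ln \<eta> u * g' u) \<in> borel_measurable lborel \<and>
        (AE u in lborel. norm (reg_ln \<eta> u * g' u) \<le> \<bar>ln (cmod u) * \<bar>g' u\<bar>\<bar> + (1 / cmod u) * \<bar>g' u\<bar>)"
    proof -
      have "\<forall>\<^sub>F \<eta>::real in at_right 0. 0 < \<eta> \<and> \<eta> < 1"
        using eventually_at_right_real[of 0 1] by (auto simp: greaterThanLessThan_iff)
      then show ?thesis
      proof eventually_elim
        case (elim \<eta>)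
        have "AE u in lborel. norm (reg_ln \<eta> u * g' u) \<le> \<bar>ln (cmod u) * \<bar>g' u\<bar>\<bar> + (1 / cmod u) * \<bar>g' u\<bar>"
          using AE_lborel_singleton[of 0]
        proof eventually_elim
          case u: (elim u)
          have "\<eta> * (1 / cmod u) \<le> 1 * (1 / cmod u)" using elim by (intro mult_right_mono) auto
          then have "\<bar>reg_ln \<eta> u\<bar> \<le> \<bar>ln (cmod u)\<bar> + 1 / cmod u"
            using reg_ln_approx[OF u, of \<eta>] elim by linarith
          then have "\<bar>reg_ln \<eta> u\<bar> * \<bar>g' u\<bar> \<le> (\<bar>ln (cmod u)\<bar> + 1 / cmod u) * \<bar>g' u\<bar>"
            by (intro mult_right_mono) auto
          then show ?case by (simp add: abs_mult distrib_right)
        qed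
        moreover have "reg_ln \<eta> \<in> borel_measurable borel" unfolding reg_ln_def[abs_def] by measurable
        ultimately show ?case by auto
      qed
    qed
    show "AE u in lborel. ((\<lambda>\<eta>. reg_ln \<eta> u * g' u) \<longlongrightarrow> ln (cmod u) * g' u) (at_right 0)"
      using AE_lborel_singleton[of 0]
      by eventually_elim (intro tendsto_intros reg_ln_tendsto)
  qed measurable
  have lim2: "((\<lambda>\<eta>. LBINT u. (u \<bullet> h) / ((cmod u)\<^sup>2 + \<eta>\<^sup>2) * g u) \<longlongrightarrow> (LBINT u. (u \<bullet> h) / (cmod u)\<^sup>2 * g u)) (at_right 0)"
  proof (rule dominated_convergence_within[where w = "\<lambda>u. cmod h * ((1 / cmod u) * \<bar>g u\<bar>)"])
    show "integrable lborel (\<lambda>u. cmod h * ((1 / cmod u) * \<bar>g u\<bar>))"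
      using li1 by (rule integrable_mult_right)
    have bd: "norm ((u \<bullet> h) / ((cmod u)\<^sup>2 + \<eta>\<^sup>2) * g u) \<le> cmod h * ((1 / cmod u) * \<bar>g u\<bar>)"
      if u: "u \<noteq> 0" for u \<eta>
    proof -
      have "\<bar>u \<bullet> h\<bar> / ((cmod u)\<^sup>2 + \<eta>\<^sup>2) \<le> (cmod u * cmod h) / (cmod u)\<^sup>2"
        using u by (intro frac_le Cauchy_Schwarz_ineq2) auto
      also have "\<dots> = cmod h * (1 / cmod u)" using u by (simp add: power2_eq_square)
      finally have "\<bar>u \<bullet> h\<bar> / ((cmod u)\<^sup>2 + \<eta>\<^sup>2) * \<bar>g u\<bar> \<le> cmod h * (1 / cmod u) * \<bar>g u\<bar>"
        by (rule mult_right_mono) simp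
      then show ?thesis by (simp add: abs_mult)
    qed
    have "AE u in lborel. norm ((u \<bullet> h) / ((cmod u)\<^sup>2 + \<eta>\<^sup>2) * g u) \<le> cmod h * ((1 / cmod u) * \<bar>g u\<bar>)" for \<eta>
      using AE_lborel_singleton[of 0] by eventually_elim (rule bd)
    moreover have "(\<lambda>u. (u \<bullet> h) / ((cmod u)\<^sup>2 + \<eta>\<^sup>2) * g u) \<in> borel_measurable lborel" for \<eta>
      by measurable
    ultimately show "\<forall>\<^sub>F \<eta> in at_right 0. (\<lambda>u. (u \<bullet> h) / ((cmod u)\<^sup>2 + \<eta>\<^sup>2) * g u) \<in> borel_measurable lborel \<and>
        (AE u in lborel. norm ((u \<bullet> h) / ((cmod u)\<^sup>2 + \<eta>\<^sup>2) * g u) \<le> cmod h * ((1 / cmod u) * \<bar>g u\<bar>))"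
      by (intro always_eventually) blast
    show "AE u in lborel. ((\<lambda>\<eta>. (u \<bullet> h) / ((cmod u)\<^sup>2 + \<eta>\<^sup>2) * g u) \<longlongrightarrow> (u \<bullet> h) / (cmod u)\<^sup>2 * g u) (at_right 0)"
      using AE_lborel_singleton[of 0]
    proof eventually_elim
      case (elim u)
      have "((\<lambda>\<eta>. (u \<bullet> h) / ((cmod u)\<^sup>2 + \<eta>\<^sup>2) * g u) \<longlongrightarrow> (u \<bullet> h) / ((cmod u)\<^sup>2 + 0\<^sup>2) * g u) (at_right 0)"
        using elim by (intro tendsto_intros) auto
      then show ?case by simp
    qed
  qed measurable
  have "\<forall>\<^sub>F \<eta> in at_right 0. (LBINT u. (u \<bullet> h) / ((cmod u)\<^sup>2 + \<eta>\<^sup>2) * g u) = (LBINT u. reg_ln \<eta> u * g' u)"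
    using eventually_at_right_less[of 0] by eventually_elim (rule reg[symmetric])
  from Lim_transform_eventually[OF lim2 this] lim1
  have "(LBINT u. (u \<bullet> h) / (cmod u)\<^sup>2 * g u) = (LBINT u. ln (cmod u) * g' u)"
    by (intro tendsto_unique[OF trivial_limit_at_right_real])
  then show ?thesis by (simp add: g_def g'_def)
qed

section \<open>The logarithmic potential\<close>

definition log_potential :: "(complex \<Rightarrow> real) \<Rightarrow> complex \<Rightarrow> real" where
  "log_potential f z = (LBINT w. ln (cmod (z - w)) * f w)"

lemma log_potential_eq_convolution:
  assumes "f \<in> borel_measurable borel"
  shows "log_potential f z = (LBINT u. ln (cmod u) * f (z - u))"
proof -
  have "(\<lambda>u. ln (cmod u) * f (z - u)) \<in> borel_measurable borel" using assms by measurable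
  from lborel_integral_reflect[OF this, of z] show ?thesis by (simp add: log_potential_def)
qed

lemma smooth_measurable: "smooth (f :: 'a::euclidean_space \<Rightarrow> real) \<Longrightarrow> f \<in> borel_measurable borel"
  using smooth_imp_continuous by (rule borel_measurable_continuous_onI)

lemma smooth_log_potential:
  assumes f: "smooth f" and R: "supported_in R f"
  shows "smooth (log_potential f)"
  using smooth_convolution[OF locally_integrable_ln f R]
  by (simp add: log_potential_eq_convolution[OF smooth_measurable[OF f], abs_def])

lemma locally_integrable_cauchy_kernel: "locally_integrable (\<lambda>u::complex. (u \<bullet> h) / (cmod u)\<^sup>2)"
proof (rule locally_integrable_dominated)
  show "\<bar>(u \<bullet> h) / (cmod u)\<^sup>2\<bar> \<le> (cmod h * (1 + R)\<^sup>2) * decay u" if "cmod u \<le> R" "u \<noteq> 0" for R u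
  proof -
    have u: "cmod u > 0" using that by simp
    have "\<bar>(u \<bullet> h) / (cmod u)\<^sup>2\<bar> \<le> (cmod u * cmod h) / (cmod u)\<^sup>2"
      by (simp add: abs_divide divide_right_mono Cauchy_Schwarz_ineq2)
    also have "\<dots> = cmod h * (1 + cmod u)\<^sup>2 * decay u"
    proof -
      have "r * c / r\<^sup>2 = c * (1 + r)\<^sup>2 * (1 / (r * (1 + r)\<^sup>2))" if "r > 0" for r c :: real
        using that by (simp add: power2_eq_square)
      then show ?thesis using u unfolding decay_def by blast
    qed
    also have "\<dots> \<le> cmod h * (1 + R)\<^sup>2 * decay u"
      using that by (intro mult_right_mono mult_left_mono power_mono) auto
    finally show ?thesis .
  qed
qed measurable

lemma integrable_cauchy_kernel:
  assumes f: "smooth f" and R: "supported_in R f"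
  shows "integrable lborel (\<lambda>w. ((z - w) \<bullet> h) / (cmod (z - w))\<^sup>2 * f w)"
proof -
  obtain B where B: "\<And>w. \<bar>f w\<bar> \<le> B"
    using continuous_supported_in_bounded[OF smooth_imp_continuous[OF f] R] by metis
  have "integrable lborel (\<lambda>u. (u \<bullet> h) / (cmod u)\<^sup>2 * f (z - u))"
    using smooth_measurable[OF f] B
    by (intro locally_integrable_mult[OF locally_integrable_cauchy_kernel _ _ supported_in_reflect[OF R]]) auto
  from lborel_integrable_affine[OF _ this, of "-1" z] show ?thesis by simp
qed

lemma log_potential_derivative:
  assumes f: "smooth f" and R: "supported_in R f"
  shows "dd (log_potential f) z h = (LBINT w. ((z - w) \<bullet> h) / (cmod (z - w))\<^sup>2 * f w)"
proof -
  note fm [measurable] = smooth_measurable[OF f]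
  have "(log_potential f has_derivative (\<lambda>h. LBINT u. ln (cmod u) * dd f (z - u) h)) (at z)"
    using has_derivative_convolution[OF locally_integrable_ln f R, of z]
    by (simp add: log_potential_eq_convolution[OF fm, abs_def])
  from frechet_derivative_at[OF this, THEN fun_cong, of h]
  have "dd (log_potential f) z h = (LBINT u. ln (cmod u) * dd f (z - u) h)"
    by simp
  also have "\<dots> = (LBINT u. (u \<bullet> h) / (cmod u)\<^sup>2 * f (z - u))"
    by (rule integral_ln_derivative[OF f R])
  also have "\<dots> = (LBINT w. ((z - w) \<bullet> h) / (cmod (z - w))\<^sup>2 * f w)"
  proof -
    have "(\<lambda>u. (u \<bullet> h) / (cmod u)\<^sup>2 * f (z - u)) \<in> borel_measurable borel" by measurable
    from lborel_integral_reflect[OF this, of z] show ?thesis by simp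
  qed
  finally show ?thesis .
qed

text \<open>Peetre's inequality: it turns decay about the origin into decay about \<open>w\<close>.\<close>

lemma inverse_square_shift_le:
  "1 / (1 + cmod z)\<^sup>2 \<le> (1 + cmod w)\<^sup>2 / (1 + cmod (z - w))\<^sup>2"
proof -
  have "0 \<le> cmod z * cmod w" by simp
  then have "1 + cmod (z - w) \<le> (1 + cmod z) * (1 + cmod w)"
    using norm_triangle_ineq4[of z w] unfolding distrib_left distrib_right by linarith
  then have "(1 + cmod (z - w))\<^sup>2 \<le> ((1 + cmod z) * (1 + cmod w))\<^sup>2"
    by (intro power_mono) auto
  moreover have pos: "0 < (1 + cmod u)\<^sup>2" for u :: complex
    by (intro zero_less_power add_pos_nonneg) simp_all
  ultimately show ?thesis using pos[of z] pos[of "z - w"] by (simp add: divide_simps power_mult_distrib mult.commute)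
qed

text \<open>The weak form of \<open>\<Delta> ln|z| = 2\<pi> \<delta>_0\<close>. By Fubini the left side is the integral of \<open>f(w)\<close> against
  \<open>\<integral>D\<psi>(z)(z - w)/|z - w|\<^sup>2 = 2\<pi> (\<psi>(\<infinity>) - \<psi>(w))\<close>; the value at infinity drops out by
  neutrality.\<close>

lemma log_potential_weak_equation:
  assumes f: "smooth f" and R: "supported_in R f" and \<psi>: "smooth_P1 \<psi>"
    and neutral: "(LBINT z. f z) = 0"
  shows "(LBINT z. grad_dot (log_potential f) (\<psi> \<circ> Some) z) = - 2 * pi * (LBINT z. f z * \<psi> (Some z))"
proof -
  define q where "q = \<psi> \<circ> Some"
  define D where "D = (\<lambda>z. dd q z)"
  have q: "smooth q" using smooth_P1D[OF \<psi>] by (simp add: q_def)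
  obtain K where K: "\<And>z h. \<bar>D z h\<bar> \<le> K * cmod h / (1 + cmod z)\<^sup>2"
    using smooth_P1_derivative_decay[OF \<psi>] unfolding D_def q_def by metis
  have K0: "0 \<le> K" using K[of 0 1] by simp
  have fc: "continuous_on UNIV f" using f smooth_imp_continuous by blast
  note [measurable] = smooth_measurable[OF f]
  define P where "P = (\<lambda>w z. f w * (D z (z - w) / (cmod (z - w))\<^sup>2))"
  have P_meas: "case_prod P \<in> borel_measurable (lborel \<Otimes>\<^sub>M lborel)"
  proof -
    have "continuous_on UNIV (\<lambda>x::complex \<times> complex. D (snd x) (snd x - fst x))"
      unfolding D_def by (intro continuous_on_frechet_derivative[OF q] continuous_intros)
    then have "(\<lambda>x::complex \<times> complex. D (snd x) (snd x - fst x)) \<in> borel_measurable borel"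
      by (rule borel_measurable_continuous_onI)
    then have [measurable]: "(\<lambda>x::complex \<times> complex. D (snd x) (snd x - fst x)) \<in> borel_measurable (lborel \<Otimes>\<^sub>M lborel)"
      unfolding lborel_prod by simp
    show ?thesis unfolding P_def case_prod_beta' by measurable
  qed
  have kernel_le: "\<bar>D z (z - w) / (cmod (z - w))\<^sup>2\<bar> \<le> K * (1 + cmod w)\<^sup>2 * decay (z - w)" for z w
  proof (cases "z = w")
    case False
    define r where "r = cmod (z - w)"
    have r: "r > 0" using False by (simp add: r_def)
    have "\<bar>D z (z - w) / (cmod (z - w))\<^sup>2\<bar> = \<bar>D z (z - w)\<bar> / r\<^sup>2" by (simp add: r_def)
    also have "\<dots> \<le> (K * r / (1 + cmod z)\<^sup>2) / r\<^sup>2"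
      unfolding r_def by (rule divide_right_mono[OF K]) simp
    also have "\<dots> = (K / r) * (1 / (1 + cmod z)\<^sup>2)" using r by (simp add: power2_eq_square)
    also have "\<dots> \<le> (K / r) * ((1 + cmod w)\<^sup>2 / (1 + r)\<^sup>2)"
      using K0 r inverse_square_shift_le[of z w] by (intro mult_left_mono) (auto simp: r_def)
    also have "\<dots> = K * (1 + cmod w)\<^sup>2 * decay (z - w)" by (simp add: decay_def r_def)
    finally show ?thesis .
  qed (use K0 in simp)
  have decay_shift: "integrable lborel (\<lambda>z. decay (z - w))" "(LBINT z. decay (z - w)) = (LBINT z. decay z)" for w
    using lborel_integrable_affine[OF _ integrable_decay, of 1 "- w"] lborel_integral_translate[of decay "- w"]
    by (simp_all add: algebra_simps)
  have P_sec: "P w \<in> borel_measurable lborel" for w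
    using measurable_compose_Pair1[OF _ P_meas, of w] by simp
  have P_le: "\<bar>P w z\<bar> \<le> \<bar>f w\<bar> * (K * (1 + cmod w)\<^sup>2) * decay (z - w)" for w z
    unfolding P_def abs_mult[of "f w"] using mult_left_mono[OF kernel_le[of z w] abs_ge_zero[of "f w"]]
    by (simp add: mult_ac)
  have P_int: "integrable lborel (P w)" for w
    by (rule Bochner_Integration.integrable_bound[OF integrable_mult_right[OF decay_shift(1)] P_sec])
       (rule AE_I2, unfold real_norm_def, rule order_trans[OF P_le abs_ge_self])
  have P_pair: "integrable (lborel \<Otimes>\<^sub>M lborel) (case_prod P)"
  proof (rule integrable_pairI[OF P_meas, where B = "\<lambda>w. \<bar>f w\<bar> * (K * (1 + cmod w)\<^sup>2 * (LBINT z. decay z))"])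
    show "AE w in lborel. integrable lborel (P w)" using P_int by simp
    have "(LBINT z. \<bar>P w z\<bar>) \<le> (LBINT z. \<bar>f w\<bar> * (K * (1 + cmod w)\<^sup>2) * decay (z - w))" for w
      by (intro integral_mono integrable_abs P_int integrable_mult_right decay_shift P_le)
    then show "AE w in lborel. (LBINT z. \<bar>P w z\<bar>) \<le> \<bar>f w\<bar> * (K * (1 + cmod w)\<^sup>2 * (LBINT z. decay z))"
      by (simp add: decay_shift(2) mult_ac)
    show "integrable lborel (\<lambda>w. \<bar>f w\<bar> * (K * (1 + cmod w)\<^sup>2 * (LBINT z. decay z)))"
      using fc R by (intro integrable_mult_supported[where R = R] continuous_intros) (auto simp: supported_in_def)
  qed
  have grad: "grad_dot (log_potential f) q z = (LBINT w. P w z)" for z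
  proof -
    have "grad_dot (log_potential f) q z
        = (\<Sum>b\<in>Basis. (LBINT w. ((z - w) \<bullet> b) / (cmod (z - w))\<^sup>2 * f w * D z b))"
      unfolding grad_dot_def log_potential_derivative[OF f R] D_def integral_mult_left_zero ..
    also have "\<dots> = (LBINT w. (\<Sum>b\<in>Basis. ((z - w) \<bullet> b) / (cmod (z - w))\<^sup>2 * f w * D z b))"
      by (rule Bochner_Integration.integral_sum[symmetric]) (intro integrable_mult_left integrable_cauchy_kernel[OF f R])
    also have "\<dots> = (LBINT w. P w z)"
    proof (rule Bochner_Integration.integral_cong[OF refl])
      fix w
      have "D z (z - w) = (\<Sum>b\<in>Basis. ((z - w) \<bullet> b) * D z b)"
        unfolding D_def by (subst frechet_derivative_expand[OF q]) simp
      then show "(\<Sum>b\<in>Basis. ((z - w) \<bullet> b) / (cmod (z - w))\<^sup>2 * f w * D z b) = P w z"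
        by (simp add: P_def sum_distrib_left sum_divide_distrib mult_ac)
    qed
    finally show ?thesis .
  qed
  have inner: "(LBINT z. P w z) = f w * (2 * pi * (\<psi> None - q w))" for w
  proof -
    have D_shift: "((\<lambda>u. q (w + u)) has_derivative D (w + u)) (at u)" for u
    proof -
      have "((\<lambda>u. w + u) has_derivative (\<lambda>h. h)) (at u)" by (auto intro!: derivative_eq_intros)
      from has_derivative_compose[OF this smooth_imp_has_derivative[OF q]] show ?thesis by (simp add: D_def)
    qed
    have D_eq: "dd (\<lambda>u. q (w + u)) u = D (w + u)" for u
      using frechet_derivative_at[OF D_shift] by simp
    have qs: "smooth (\<lambda>u. q (w + u))"
      unfolding smooth_eq_smooth_on
      by (rule smooth_on_compose[OF q[unfolded smooth_eq_smooth_on]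
            smooth_on_add[OF open_UNIV smooth_on_const smooth_on_id[OF open_UNIV]] open_UNIV open_UNIV subset_UNIV])
    have lim: "((\<lambda>u. q (w + u)) \<longlongrightarrow> \<psi> None) at_infinity"
    proof (rule filterlim_compose[OF smooth_P1_tendsto_at_infinity[OF \<psi>, folded q_def]])
      show "filterlim ((+) w) at_infinity at_infinity"
        by (rule tendsto_add_filterlim_at_infinity[OF tendsto_const filterlim_ident])
    qed
    have bd: "\<bar>dd (\<lambda>u. q (w + u)) u h\<bar> \<le> (K * (1 + cmod w)\<^sup>2) * cmod h / (1 + cmod u)\<^sup>2" for u h
    proof -
      have "\<bar>D (w + u) h\<bar> \<le> K * cmod h * (1 / (1 + cmod (w + u))\<^sup>2)" using K[of "w + u" h] by simp
      also have "\<dots> \<le> K * cmod h * ((1 + cmod w)\<^sup>2 / (1 + cmod u)\<^sup>2)"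
        using K0 inverse_square_shift_le[of "w + u" w] by (intro mult_left_mono) auto
      finally show ?thesis unfolding D_eq by (simp add: mult_ac)
    qed
    have "(LBINT u. D (w + u) u / (cmod u)\<^sup>2) = 2 * pi * (\<psi> None - q w)"
      using radial_derivative_integral[OF qs bd lim] by (simp add: D_eq)
    moreover have "(LBINT z. D z (z - w) / (cmod (z - w))\<^sup>2) = (LBINT u. D (w + u) u / (cmod u)\<^sup>2)"
    proof -
      have "continuous_on UNIV (\<lambda>z. D z (z - w))"
        unfolding D_def by (intro continuous_on_frechet_derivative[OF q] continuous_intros)
      then have [measurable]: "(\<lambda>z. D z (z - w)) \<in> borel_measurable borel" by (rule borel_measurable_continuous_onI)
      have "(\<lambda>z. D z (z - w) / (cmod (z - w))\<^sup>2) \<in> borel_measurable borel" by measurable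
      from lborel_integral_translate[OF this, of w] show ?thesis by simp
    qed
    ultimately show ?thesis unfolding P_def integral_mult_right_zero by simp
  qed
  have fi: "integrable lborel f" using integrable_supported[OF fc R] by simp
  have fqi: "integrable lborel (\<lambda>w. f w * q w)"
    by (rule integrable_mult_supported[OF fc R smooth_imp_continuous[OF q]])
  have "(LBINT z. grad_dot (log_potential f) q z) = (LBINT z. (LBINT w. P w z))"
    by (simp only: grad)
  also have "\<dots> = (LBINT w. (LBINT z. P w z))"
    by (rule lborel_pair.Fubini_integral[OF P_pair])
  also have "\<dots> = (LBINT w. (2 * pi * \<psi> None) * f w - (2 * pi) * (f w * q w))"
    unfolding inner by (intro Bochner_Integration.integral_cong) (auto simp: algebra_simps)
  also have "\<dots> = - 2 * pi * (LBINT w. f w * q w)"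
    using fi fqi neutral by simp
  finally show ?thesis by (simp add: q_def)
qed

text \<open>For small \<open>w \<noteq> 0\<close> one has \<open>ln|1/w - u| = ln|1 - w u| - ln|w|\<close> on the support of \<open>f\<close>. The second
  term integrates to 0 by neutrality, and the first is the real part of the holomorphic function
  \<open>Ln (1 - w u)\<close> of \<open>w\<close>.\<close>

lemma smooth_log_potential_at_infinity:
  assumes f: "smooth f" and R: "supported_in R f" and neutral: "(LBINT z. f z) = 0"
  shows "smooth (\<lambda>w. if w = 0 then 0 else log_potential f (1 / w))"
proof -
  define R' where "R' = max R 1"
  \<comment> \<open>For \<open>|w| < r\<close> and \<open>u\<close> in the support, \<open>|w u| < 1/2\<close>, so \<open>1 - w u\<close> avoids the branch cut of \<open>Ln\<close>.\<close>
  define r where "r = 1 / (2 * R')"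
  have R': "R' > 0" "R \<le> R'" and r: "r > 0" by (auto simp: R'_def r_def)
  define F where "F = (\<lambda>w u. indicat_real (cball 0 R') u *\<^sub>R (Ln (1 - w * u) * complex_of_real (f u)))"
  define F' where "F' = (\<lambda>w u h. indicat_real (cball 0 R') u *\<^sub>R ((- u / (1 - w * u)) * complex_of_real (f u) * h))"
  have small: "cmod (w * u) < 1 / 2" if "w \<in> ball 0 r" "u \<in> cball 0 R'" for w u :: complex
  proof -
    have "cmod (w * u) \<le> cmod w * R'" using that by (simp add: norm_mult mult_left_mono)
    also have "\<dots> < r * R'" using that R' by simp
    finally show ?thesis using R' by (simp add: r_def)
  qed
  have Re_pos: "Re (1 - w * u) > 1 / 2" if "w \<in> ball 0 r" "u \<in> cball 0 R'" for w u :: complex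
    using small[OF that] complex_Re_le_cmod[of "w * u"] by simp
  have not_np: "1 - w * u \<notin> \<real>\<^sub>\<le>\<^sub>0" if "w \<in> ball 0 r" "u \<in> cball 0 R'" for w u :: complex
    using Re_pos[OF that] by (auto simp: complex_nonpos_Reals_iff)
  have ne: "1 - w * u \<noteq> 0" if "w \<in> ball 0 r" "u \<in> cball 0 R'" for w u :: complex
    using not_np[OF that] by auto
  have fc: "continuous_on A (\<lambda>u. complex_of_real (f u))" for A
    by (intro continuous_on_of_real smooth_imp_continuous[OF f])
  have F_int: "integrable lborel (F w)" if "w \<in> ball 0 r" for w
    unfolding F_def using not_np[OF that]
    by (intro borel_integrable_compact compact_cball continuous_intros fc) auto
  have F'_int: "integrable lborel (\<lambda>u. F' w u h)" if "w \<in> ball 0 r" for w h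
    unfolding F'_def using ne[OF that]
    by (intro borel_integrable_compact compact_cball continuous_intros fc) auto
  have deriv: "((\<lambda>w. LBINT u. F w u) has_derivative (\<lambda>h. LBINT u. F' w u h)) (at w)"
    if w: "w \<in> ball 0 r" for w
  proof (rule has_derivative_lebesgue_integral[where U = "ball 0 r" and F' = F'
        and B = "\<lambda>u. indicat_real (cball 0 R') u *\<^sub>R (2 * R' * \<bar>f u\<bar>)", OF _ _ w])
    show "integrable lborel (F y)" if "y \<in> ball 0 r" for y using F_int[OF that] .
    show "(\<lambda>u. F' w u h) \<in> borel_measurable lborel" for h using F'_int[OF w] by auto
    show "((\<lambda>y. F y u) has_derivative F' y u) (at y)" if y: "y \<in> ball 0 r" for y u
    proof (cases "u \<in> cball 0 R'")
      case True
      have "((\<lambda>y. Ln (1 - y * u) * complex_of_real (f u)) has_field_derivative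
          (- u / (1 - y * u)) * complex_of_real (f u)) (at y)"
        using not_np[OF y True] ne[OF y True]
        by (auto intro!: derivative_eq_intros simp: field_simps)
      then have "((\<lambda>y. Ln (1 - y * u) * complex_of_real (f u)) has_derivative
          (\<lambda>h. (- u / (1 - y * u)) * complex_of_real (f u) * h)) (at y)"
        unfolding has_field_derivative_def .
      then show ?thesis using True by (simp add: F_def F'_def)
    qed (simp add: F_def F'_def)
    show "norm (F' y u h) \<le> indicat_real (cball 0 R') u *\<^sub>R (2 * R' * \<bar>f u\<bar>) * norm h"
      if y: "y \<in> ball 0 r" for y u h
    proof (cases "u \<in> cball 0 R'")
      case True
      have "1 / 2 \<le> cmod (1 - y * u)" using Re_pos[OF y True] complex_Re_le_cmod[of "1 - y * u"] by linarith
      then have "cmod u / cmod (1 - y * u) \<le> R' / (1 / 2)"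
        using True R' by (intro frac_le) auto
      then have "cmod u / cmod (1 - y * u) * \<bar>f u\<bar> * cmod h \<le> 2 * R' * \<bar>f u\<bar> * cmod h"
        by (intro mult_right_mono) auto
      then show ?thesis using True by (simp add: F'_def norm_mult norm_divide)
    qed (simp add: F'_def)
    show "integrable lborel (\<lambda>u. indicat_real (cball 0 R') u *\<^sub>R (2 * R' * \<bar>f u\<bar>))"
      by (intro borel_integrable_compact compact_cball continuous_intros smooth_imp_continuous[OF f])
  qed auto
  have "(\<lambda>w. LBINT u. F w u) holomorphic_on ball 0 r"
    unfolding holomorphic_on_open[OF open_ball]
  proof (intro ballI exI)
    fix w assume w: "w \<in> ball (0::complex) r"
    have eq: "(\<lambda>h. LBINT u. F' w u h) = (\<lambda>h. (LBINT u. F' w u 1) * h)"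
    proof
      fix h
      have "(LBINT u. F' w u h) = (LBINT u. F' w u 1 * h)"
        by (simp add: F'_def mult.assoc)
      then show "(LBINT u. F' w u h) = (LBINT u. F' w u 1) * h" by simp
    qed
    show "((\<lambda>w. LBINT u. F w u) has_field_derivative (LBINT u. F' w u 1)) (at w)"
      unfolding has_field_derivative_def by (rule has_derivative_eq_rhs[OF deriv[OF w] eq])
  qed
  then have near: "smooth_on (ball 0 r) (\<lambda>w. Re (LBINT u. F w u))"
    by (intro smooth_on_linear[OF bounded_linear_Re] smooth_on_holomorphic) auto
  have fi: "integrable lborel f"
    using integrable_supported[OF smooth_imp_continuous[OF f] R] by simp
  have eq: "Re (LBINT u. F w u) = (if w = 0 then 0 else log_potential f (1 / w))" if w: "w \<in> ball 0 r" for w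
  proof (cases "w = 0")
    case False
    have Re_int: "integrable lborel (\<lambda>u. Re (F w u))" using F_int[OF w] by simp
    have "ln (cmod (1 / w - u)) * f u = Re (F w u) - ln (cmod w) * f u" for u
    proof (cases "u \<in> cball 0 R'")
      case True
      have "1 / w - u = (1 - w * u) / w" using False by (simp add: field_simps)
      then have "ln (cmod (1 / w - u)) = ln (cmod (1 - w * u)) - ln (cmod w)"
        using False ne[OF w True] by (simp add: norm_divide ln_div)
      moreover have "Re (F w u) = ln (cmod (1 - w * u)) * f u"
        using True ne[OF w True] by (simp add: F_def)
      ultimately show ?thesis by (simp only: left_diff_distrib)
    next
      case outside: False
      then have "f u = 0" using R R' by (simp add: supported_in_def)
      then show ?thesis using outside by (simp add: F_def)
    qed
    then have "log_potential f (1 / w) = (LBINT u. Re (F w u) - ln (cmod w) * f u)"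
      by (simp add: log_potential_def)
    also have "\<dots> = (LBINT u. Re (F w u))"
      using Re_int fi neutral by simp
    also have "\<dots> = Re (LBINT u. F w u)"
      using F_int[OF w] by simp
    finally show ?thesis using False by simp
  qed (simp add: F_def)
  have 1: "smooth_on (ball 0 r) (\<lambda>w. if w = 0 then 0 else log_potential f (1 / w))"
    by (rule smooth_on_cong[OF open_ball eq near])
  have op: "open (- {0::complex})" by auto
  have "smooth_on (- {0::complex}) (\<lambda>w. 1 / w)"
    by (intro smooth_on_holomorphic op holomorphic_intros) auto
  then have "smooth_on (- {0}) (\<lambda>w. log_potential f (1 / w))"
    by (rule smooth_on_compose[OF smooth_log_potential[OF f R, unfolded smooth_eq_smooth_on] _ op open_UNIV subset_UNIV])
  then have 2: "smooth_on (- {0}) (\<lambda>w. if w = 0 then 0 else log_potential f (1 / w))"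
    by (rule smooth_on_cong[OF op, rotated]) auto
  have "ball 0 r \<union> - {0} = (UNIV :: complex set)" using r by auto
  then show ?thesis
    using smooth_on_Un[OF open_ball op 1 2] by (simp add: smooth_eq_smooth_on)
qed

section \<open>The critical point and the critical value\<close>

text \<open>The factor \<open>2/\<pi>\<close> is \<open>4/(2\<pi>)\<close>: the equation is \<open>\<Delta>\<Phi> = 4 f\<close>, and \<open>\<Delta> ln|z| = 2\<pi> \<delta>_0\<close>.\<close>

definition green_potential :: "(complex \<Rightarrow> real) \<Rightarrow> complex option \<Rightarrow> real" where
  "green_potential f p = (case p of None \<Rightarrow> 0 | Some z \<Rightarrow> (2 / pi) * log_potential f z)"

lemma green_potential_Some: "green_potential f \<circ> Some = (\<lambda>z. (2 / pi) * log_potential f z)"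
  by (simp add: green_potential_def fun_eq_iff)

lemma smooth_P1_green_potential:
  assumes f: "smooth f" "supported_in R f" "(LBINT z. f z) = 0"
  shows "smooth_P1 (green_potential f)"
proof -
  have "green_potential f \<circ> chart_inf = (\<lambda>w. (2 / pi) * (if w = 0 then 0 else log_potential f (1 / w)))"
    by (auto simp: green_potential_def chart_inf_def)
  then show ?thesis
    using smooth_log_potential[OF f(1,2)] smooth_log_potential_at_infinity[OF f]
    unfolding smooth_P1_def green_potential_Some smooth_eq_smooth_on
    by (simp only: smooth_on_cmult[OF open_UNIV] simp_thms)
qed

lemma grad_dot_cmult:
  assumes "smooth f"
  shows "grad_dot (\<lambda>z. c * f z) g z = c * grad_dot f g z"
proof -
  have "((\<lambda>z. c * f z) has_derivative (\<lambda>h. c * dd f z h)) (at z)"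
    by (intro has_derivative_mult_right smooth_imp_has_derivative assms)
  then have "dd (\<lambda>z. c * f z) z = (\<lambda>h. c * dd f z h)"
    by (rule frechet_derivative_at[symmetric])
  then show ?thesis by (simp add: grad_dot_def sum_distrib_left mult.assoc)
qed

lemma green_potential_weak_equation:
  assumes f: "smooth f" "supported_in R f" "(LBINT z. f z) = 0" and \<psi>: "smooth_P1 \<psi>"
  shows "(LBINT z. grad_dot (green_potential f \<circ> Some) (\<psi> \<circ> Some) z) = - 4 * (LBINT z. f z * \<psi> (Some z))"
  unfolding green_potential_Some grad_dot_cmult[OF smooth_log_potential[OF f(1,2)]]
  using log_potential_weak_equation[OF f(1,2) \<psi> f(3)] by simp

lemma critical_point_green_potential:
  assumes f: "smooth (\<lambda>z. area \<Omega> * \<delta> z - chi z)" "supported_in R (\<lambda>z. area \<Omega> * \<delta> z - chi z)"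
    "(LBINT z. area \<Omega> * \<delta> z - chi z) = 0"
  shows "critical_point (S_reg \<Omega> chi \<delta>) (green_potential (\<lambda>z. area \<Omega> * \<delta> z - chi z))"
  unfolding critical_point_iff[OF smooth_imp_continuous[OF f(1)] f(2)]
  using smooth_P1_green_potential[OF f] green_potential_weak_equation[OF f] by simp

lemma ex1_normalized_critical_point:
  assumes f: "smooth (\<lambda>z. area \<Omega> * \<delta> z - chi z)" "supported_in R (\<lambda>z. area \<Omega> * \<delta> z - chi z)"
    "(LBINT z. area \<Omega> * \<delta> z - chi z) = 0"
  shows "\<exists>!\<Phi>. critical_point (S_reg \<Omega> chi \<delta>) \<Phi> \<and> \<Phi> None = 0"
    and "normalized_critical_point (S_reg \<Omega> chi \<delta>) = green_potential (\<lambda>z. area \<Omega> * \<delta> z - chi z)"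
proof -
  let ?G = "green_potential (\<lambda>z. area \<Omega> * \<delta> z - chi z)"
  have G: "critical_point (S_reg \<Omega> chi \<delta>) ?G \<and> ?G None = 0"
    using critical_point_green_potential[OF f] by (simp add: green_potential_def)
  have uniq: "\<Phi> = ?G" if "critical_point (S_reg \<Omega> chi \<delta>) \<Phi> \<and> \<Phi> None = 0" for \<Phi>
    using critical_point_unique[OF smooth_imp_continuous[OF f(1)] f(2)] that G by blast
  show "\<exists>!\<Phi>. critical_point (S_reg \<Omega> chi \<delta>) \<Phi> \<and> \<Phi> None = 0"
    using G uniq by (rule ex1I)
  show "normalized_critical_point (S_reg \<Omega> chi \<delta>) = ?G"
    unfolding normalized_critical_point_def using G uniq by (rule the_equality)
qed

definition log_energy :: "(complex \<Rightarrow> real) \<Rightarrow> (complex \<Rightarrow> real) \<Rightarrow> real" where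
  "log_energy a b = (LBINT z. (LBINT w. ln (cmod (z - w)) * a z * b w))"

lemma log_energy_eq: "log_energy a b = (LBINT z. a z * log_potential b z)"
proof -
  have "(LBINT w. ln (cmod (z - w)) * a z * b w) = a z * log_potential b z" for z
  proof -
    have "(LBINT w. ln (cmod (z - w)) * a z * b w) = (LBINT w. a z * (ln (cmod (z - w)) * b w))"
      by (simp add: mult_ac)
    then show ?thesis by (simp add: log_potential_def)
  qed
  then show ?thesis by (simp add: log_energy_def)
qed

text \<open>The weak equation tested with the solution itself says that the quadratic part of the action is
  minus half of the linear part.\<close>

lemma action_at_green_potential:
  assumes f: "smooth (\<lambda>z. area \<Omega> * \<delta> z - chi z)" "supported_in R (\<lambda>z. area \<Omega> * \<delta> z - chi z)"
    "(LBINT z. area \<Omega> * \<delta> z - chi z) = 0"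
  defines "q \<equiv> \<lambda>z. area \<Omega> * \<delta> z - chi z"
  shows "S_reg \<Omega> chi \<delta> (green_potential q) = (1 / pi) * log_energy q q"
proof -
  note q = f[folded q_def]
  have "S_0 (green_potential q) = - (1 / 2) * (LBINT z. q z * green_potential q (Some z))"
    unfolding S_0_eq green_potential_weak_equation[OF q smooth_P1_green_potential[OF q]] by simp
  then have "S_reg \<Omega> chi \<delta> (green_potential q) = (1 / 2) * (LBINT z. q z * green_potential q (Some z))"
    unfolding S_reg_def q_def[symmetric] by (simp add: q_def)
  also have "\<dots> = (1 / 2) * (LBINT z. (2 / pi) * (q z * log_potential q z))"
    by (simp add: green_potential_def mult_ac)
  also have "\<dots> = (1 / pi) * log_energy q q"
    by (simp add: log_energy_eq)
  finally show ?thesis .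
qed

section \<open>Mollifiers, cutoffs and smooth kernels\<close>

text \<open>The functions \<open>exp (-1/x)/x\<^sup>n\<close>, extended by 0, form a family closed under differentiation up to
  linear combinations; this makes an induction on the order of differentiability possible.\<close>

definition flat_power :: "nat \<Rightarrow> real \<Rightarrow> real" where
  "flat_power n x = (if x > 0 then exp (- 1 / x) / x ^ n else 0)"

lemma flat_power_tendsto_0: "(flat_power n \<longlongrightarrow> 0) (at_right 0)"
proof -
  have "((\<lambda>x. inverse x ^ n / exp (inverse x)) \<longlongrightarrow> (0::real)) (at_right 0)"
    by (rule filterlim_compose[OF tendsto_power_div_exp_0 filterlim_inverse_at_top_right])
  moreover have "\<forall>\<^sub>F x in at_right 0. inverse x ^ n / exp (inverse x) = flat_power n x"
    using eventually_at_right_less[of 0]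
    by eventually_elim (simp add: flat_power_def exp_minus divide_simps power_inverse)
  ultimately show ?thesis by (rule Lim_transform_eventually)
qed

lemma flat_power_has_derivative:
  "(flat_power n has_real_derivative flat_power (n + 2) x - real n * flat_power (n + 1) x) (at x)"
proof -
  consider "x > 0" | "x < 0" | "x = 0" by linarith
  then show ?thesis
  proof cases
    case 1
    have "((\<lambda>x. exp (- 1 / x) / x ^ n) has_real_derivative
        flat_power (n + 2) x - real n * flat_power (n + 1) x) (at x)"
    proof -
      have "((\<lambda>x. exp (- 1 / x) / x ^ n) has_real_derivative
          (exp (- 1 / x) * (1 / x\<^sup>2) * x ^ n - exp (- 1 / x) * (real n * x ^ (n - 1))) / (x ^ n * x ^ n)) (at x)"
        using 1 by (auto intro!: derivative_eq_intros simp: power2_eq_square)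
      moreover have "(exp (- 1 / x) * (1 / x\<^sup>2) * x ^ n - exp (- 1 / x) * (real n * x ^ (n - 1))) / (x ^ n * x ^ n)
          = flat_power (n + 2) x - real n * flat_power (n + 1) x"
        using 1 by (cases n) (simp_all add: flat_power_def field_simps power2_eq_square)
      ultimately show ?thesis by simp
    qed
    then show ?thesis
      by (rule DERIV_cong_ev[THEN iffD1, OF refl _ refl, rotated])
         (use 1 in \<open>auto simp: flat_power_def eventually_nhds intro!: exI[of _ "{0<..}"]\<close>)
  next
    case 2
    have "((\<lambda>x. 0) has_real_derivative 0) (at x)" by simp
    moreover have "flat_power (n + 2) x - real n * flat_power (n + 1) x = 0" using 2 by (simp add: flat_power_def)
    ultimately have "((\<lambda>x. 0) has_real_derivative flat_power (n + 2) x - real n * flat_power (n + 1) x) (at x)"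
      by simp
    then show ?thesis
      by (rule DERIV_cong_ev[THEN iffD1, OF refl _ refl, rotated])
         (use 2 in \<open>auto simp: flat_power_def eventually_nhds intro!: exI[of _ "{..<0}"]\<close>)
  next
    case 3
    have "((\<lambda>y. (flat_power n y - flat_power n 0) / (y - 0)) \<longlongrightarrow> 0) (at 0)"
      unfolding filterlim_split_at
    proof (intro filterlim_split_at)
      show "((\<lambda>y. (flat_power n y - flat_power n 0) / (y - 0)) \<longlongrightarrow> 0) (at_left 0)"
      proof (rule Lim_transform_eventually[OF tendsto_const])
        show "\<forall>\<^sub>F y in at_left 0. 0 = (flat_power n y - flat_power n 0) / (y - 0)"
          by (auto simp: eventually_at_filter flat_power_def)
      qed
      show "((\<lambda>y. (flat_power n y - flat_power n 0) / (y - 0)) \<longlongrightarrow> 0) (at_right 0)"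
      proof (rule Lim_transform_eventually[OF flat_power_tendsto_0[of "n + 1"]])
        show "\<forall>\<^sub>F y in at_right 0. flat_power (n + 1) y = (flat_power n y - flat_power n 0) / (y - 0)"
          using eventually_at_right_less[of 0] by eventually_elim (simp add: flat_power_def)
      qed
    qed
    then have "(flat_power n has_real_derivative 0) (at 0)"
      by (simp add: has_field_derivative_iff)
    then show ?thesis using 3 by (simp add: flat_power_def)
  qed
qed

lemma smooth_flat_power: "smooth (flat_power n)"
proof -
  have "C_k_on k UNIV (flat_power n)" for k
  proof (induction k arbitrary: n)
    case 0
    show ?case using DERIV_continuous[OF flat_power_has_derivative]
      by (simp add: continuous_at_imp_continuous_on)
  next
    case (Suc k)
    show ?case
    proof (rule C_k_on_SucI[OF open_UNIV])
      show "(flat_power n has_derivative (\<lambda>h. (flat_power (n + 2) x + (- real n) *\<^sub>R flat_power (n + 1) x) * h)) (at x)" for x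
        using flat_power_has_derivative[of n x] by (simp add: has_field_derivative_def)
      show "C_k_on k UNIV (\<lambda>x. (flat_power (n + 2) x + (- real n) *\<^sub>R flat_power (n + 1) x) * b)" for b
        by (intro C_k_on_bilinear[OF bounded_bilinear_mult] C_k_on_add C_k_on_const
            C_k_on_linear[OF bounded_linear_scaleR_right] Suc.IH open_UNIV)
    qed
  qed
  then show ?thesis by (simp add: smooth_eq_smooth_on smooth_on_def)
qed

lemma integral_pos_of_continuous:
  fixes f :: "'a::euclidean_space \<Rightarrow> real"
  assumes "continuous_on UNIV f" "integrable lborel f" "\<And>x. 0 \<le> f x" "f y > 0"
  shows "(LBINT x. f x) > 0"
proof (rule ccontr)
  assume "\<not> ?thesis"
  moreover have "(LBINT x. f x) \<ge> 0" using assms(3) by simp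
  ultimately have "(LBINT x. f x) = 0" by simp
  then have "AE x in lborel. f x = 0"
    using integral_nonneg_eq_0_iff_AE[OF assms(2)] assms(3) by simp
  then have "f y = 0" by (rule continuous_AE_eq_0_imp_eq_0[OF assms(1)])
  then show False using assms(4) by simp
qed

definition mollifier :: "(complex \<Rightarrow> real) \<Rightarrow> bool" where
  "mollifier \<eta> \<longleftrightarrow> smooth \<eta> \<and> supported_in 1 \<eta> \<and> (\<forall>z. 0 \<le> \<eta> z) \<and> (LBINT z. \<eta> z) = 1"

lemma mollifier_exists: "\<exists>\<eta>. mollifier \<eta>"
proof -
  define b where "b = (\<lambda>z::complex. flat_power 0 (1 - (cmod z)\<^sup>2))"
  have sb: "smooth b"
    unfolding b_def smooth_eq_smooth_on
    by (rule smooth_on_compose[OF smooth_flat_power[unfolded smooth_eq_smooth_on]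
          smooth_on_diff[OF open_UNIV smooth_on_const smooth_norm_sq[unfolded smooth_eq_smooth_on]] open_UNIV open_UNIV subset_UNIV])
  have supp: "supported_in 1 b"
    unfolding supported_in_def b_def flat_power_def by (auto simp: power2_eq_square) (smt (verit) mult_le_cancel_right1 norm_ge_zero)
  have nn: "0 \<le> b z" for z by (simp add: b_def flat_power_def)
  have int: "integrable lborel b"
    using integrable_supported[OF smooth_imp_continuous[OF sb] supp] by simp
  have pos: "(LBINT z. b z) > 0"
    by (rule integral_pos_of_continuous[OF smooth_imp_continuous[OF sb] int nn, of 0]) (simp add: b_def flat_power_def)
  have "mollifier (\<lambda>z. (1 / (LBINT z. b z)) * b z)"
    unfolding mollifier_def
  proof (intro conjI allI)
    show "smooth (\<lambda>z. (1 / (LBINT z. b z)) * b z)"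
      using sb unfolding smooth_eq_smooth_on by (rule smooth_on_cmult[OF open_UNIV])
    show "supported_in 1 (\<lambda>z. (1 / (LBINT z. b z)) * b z)"
      using supp by (simp add: supported_in_def)
    show "0 \<le> (1 / (LBINT z. b z)) * b z" for z
      using nn pos by simp
    show "(LBINT z. (1 / (LBINT z. b z)) * b z) = 1"
      using pos by simp
  qed
  then show ?thesis by blast
qed

lemma locally_integrable_indicator:
  assumes "S \<in> sets borel"
  shows "locally_integrable (indicat_real S :: 'a::euclidean_space \<Rightarrow> real)"
proof -
  have "integrable lborel (\<lambda>x. indicat_real (cball 0 R) x *\<^sub>R indicat_real S x)" for R
  proof (rule Bochner_Integration.integrable_bound)
    show "integrable lborel (indicat_real (cball (0::'a) R))"
      by (auto intro!: integrable_real_indicator emeasure_bounded_finite[OF bounded_cball])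
    show "(\<lambda>x. indicat_real (cball 0 R) x *\<^sub>R indicat_real S x) \<in> borel_measurable lborel"
      using assms by (intro borel_measurable_scaleR borel_measurable_indicator) auto
  qed (auto simp: indicator_def)
  then show ?thesis
    using assms by (auto simp: locally_integrable_def set_integrable_def intro: borel_measurable_indicator)
qed

text \<open>Mollify the indicator of a disc of radius \<open>\<rho> + 1\<close>.\<close>

lemma cutoff_exists:
  obtains \<theta> :: "complex \<Rightarrow> real" where "smooth \<theta>" "supported_in (\<rho> + 2) \<theta>" "\<And>z. cmod z \<le> \<rho> \<Longrightarrow> \<theta> z = 1"
proof -
  obtain \<eta> where \<eta>: "mollifier \<eta>" using mollifier_exists by blast
  define \<theta> where "\<theta> = (\<lambda>z. LBINT w. indicat_real (cball 0 (\<rho> + 1)) w * \<eta> (z - w))"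
  have "smooth \<theta>"
    unfolding \<theta>_def using \<eta> by (intro smooth_convolution locally_integrable_indicator) (auto simp: mollifier_def)
  moreover have "supported_in (\<rho> + 2) \<theta>"
    unfolding supported_in_def
  proof (intro allI impI)
    fix z assume z: "\<rho> + 2 < cmod z"
    have "indicat_real (cball 0 (\<rho> + 1)) w * \<eta> (z - w) = 0" for w
    proof (cases "cmod w \<le> \<rho> + 1")
      case True
      then have "1 < cmod (z - w)" using z norm_triangle_ineq2[of z w] by linarith
      then show ?thesis using \<eta> by (simp add: mollifier_def supported_in_def)
    qed simp
    then show "\<theta> z = 0" unfolding \<theta>_def by (simp only: Bochner_Integration.integral_zero)
  qed
  moreover have "\<theta> z = 1" if z: "cmod z \<le> \<rho>" for z
  proof -
    have "indicat_real (cball 0 (\<rho> + 1)) w * \<eta> (z - w) = \<eta> (z - w)" for w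
    proof (cases "cmod w \<le> \<rho> + 1")
      case False
      then have "1 < cmod (z - w)" using z norm_triangle_ineq2[of w z] by (simp add: norm_minus_commute)
      then show ?thesis using \<eta> by (simp add: mollifier_def supported_in_def)
    qed simp
    then have "\<theta> z = (LBINT w. \<eta> (z - w))" unfolding \<theta>_def by (simp only:)
    also have "\<dots> = 1"
    proof -
      have "\<eta> \<in> borel_measurable borel" using \<eta> by (intro smooth_measurable) (simp add: mollifier_def)
      from lborel_integral_reflect[OF this, of z] show ?thesis using \<eta> by (simp add: mollifier_def)
    qed
    finally show ?thesis .
  qed
  ultimately show thesis by (rule that)
qed

text \<open>Test functions must have compact support, so the regularized logarithm is cut off far out, where
  differences of points of the relevant ball do not reach.\<close>

lemma smooth_kernel_approximation:
  assumes "\<eta> > 0"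
  obtains K :: "complex \<Rightarrow> real" where "smooth K" "compactly_supported K"
    "\<And>u. u \<noteq> 0 \<Longrightarrow> cmod u \<le> \<rho> \<Longrightarrow> \<bar>K u - ln (cmod u)\<bar> \<le> \<eta> * (1 / cmod u)"
proof -
  obtain \<theta> :: "complex \<Rightarrow> real" where \<theta>: "smooth \<theta>" "supported_in (\<rho> + 2) \<theta>" "\<And>z. cmod z \<le> \<rho> \<Longrightarrow> \<theta> z = 1"
    using cutoff_exists by metis
  show thesis
  proof (rule that[of "\<lambda>u. reg_ln \<eta> u * \<theta> u"])
    show "smooth (\<lambda>u. reg_ln \<eta> u * \<theta> u)" by (rule smooth_mult[OF smooth_reg_ln[OF assms] \<theta>(1)])
    have "supported_in (\<rho> + 2) (\<lambda>u. reg_ln \<eta> u * \<theta> u)"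
      using \<theta>(2) by (simp add: supported_in_def)
    then show "compactly_supported (\<lambda>u. reg_ln \<eta> u * \<theta> u)" unfolding compactly_supported_iff by blast
    show "\<bar>reg_ln \<eta> u * \<theta> u - ln (cmod u)\<bar> \<le> \<eta> * (1 / cmod u)" if "u \<noteq> 0" "cmod u \<le> \<rho>" for u
      using reg_ln_approx[OF that(1) assms] \<theta>(3)[OF that(2)] by simp
  qed
qed

section \<open>Convergence of logarithmic energies\<close>

text \<open>Controls the potential \<open>\<integral>|b(w)|/|z - w|\<close> on the ball of radius \<open>R\<close>, for \<open>|b| \<le> 1\<close> supported
  there; the differences \<open>z - w\<close> fill the ball of radius \<open>2 R\<close>.\<close>

definition riesz_bound :: "real \<Rightarrow> real" where
  "riesz_bound R = (LBINT u. indicat_real (cball 0 (2 * R)) u * (1 / cmod u))"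

lemma integrable_indicator_mult:
  assumes "locally_integrable k"
  shows "integrable lborel (\<lambda>u. indicat_real (cball 0 R) u * k u)"
  using assms by (simp add: locally_integrable_def set_integrable_def)

lemma locally_integrable_smooth:
  fixes f :: "'a::euclidean_space \<Rightarrow> real"
  assumes "smooth f"
  shows "locally_integrable f"
  unfolding locally_integrable_def set_integrable_def
  using smooth_imp_continuous[OF assms] smooth_measurable[OF assms]
  by (intro conjI allI borel_integrable_compact compact_cball)

text \<open>For \<open>|z| \<le> R\<close> only differences \<open>z - w\<close> in the ball of radius \<open>2 R\<close> occur, where the two kernels differ
  by at most \<open>\<eta>/|z - w|\<close>.\<close>

lemma kernel_approximation_error:
  fixes K b :: "complex \<Rightarrow> real"
  assumes K: "locally_integrable K"
    and approx: "\<And>u. u \<noteq> 0 \<Longrightarrow> cmod u \<le> 2 * R \<Longrightarrow> \<bar>K u - ln (cmod u)\<bar> \<le> \<eta> * (1 / cmod u)"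
    and b: "b \<in> borel_measurable borel" "supported_in R b" "\<And>w. \<bar>b w\<bar> \<le> M"
    and z: "cmod z \<le> R" and \<eta>: "\<eta> \<ge> 0"
  shows "\<bar>(LBINT w. b w * K (z - w)) - log_potential b z\<bar> \<le> M * \<eta> * riesz_bound R"
proof -
  have M: "M \<ge> 0" using b(3)[of 0] by linarith
  have [measurable]: "K \<in> borel_measurable borel" using K by (simp add: locally_integrable_def)
  note [measurable] = b(1)
  have supp: "supported_in (cmod z + R) (\<lambda>u. b (z - u))" by (rule supported_in_reflect[OF b(2)])
  have i1: "integrable lborel (\<lambda>u. K u * b (z - u))"
    by (rule locally_integrable_mult[OF K _ b(3) supp]) measurable
  have i2: "integrable lborel (\<lambda>u. ln (cmod u) * b (z - u))"
    by (rule locally_integrable_mult[OF locally_integrable_ln _ b(3) supp]) measurable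
  have "(LBINT w. b w * K (z - w)) = (LBINT u. K u * b (z - u))"
  proof -
    have "(\<lambda>u. K u * b (z - u)) \<in> borel_measurable borel" by measurable
    from lborel_integral_reflect[OF this, of z] show ?thesis by (simp add: mult.commute)
  qed
  then have "(LBINT w. b w * K (z - w)) - log_potential b z = (LBINT u. K u * b (z - u) - ln (cmod u) * b (z - u))"
    using i1 i2 by (simp add: log_potential_eq_convolution[OF b(1)])
  also have "\<bar>\<dots>\<bar> \<le> (LBINT u. \<bar>K u * b (z - u) - ln (cmod u) * b (z - u)\<bar>)"
    by (rule integral_abs_bound)
  also have "\<dots> \<le> (LBINT u. M * \<eta> * (indicat_real (cball 0 (2 * R)) u * (1 / cmod u)))"
  proof (rule integral_mono_AE)
    show "integrable lborel (\<lambda>u::complex. M * \<eta> * (indicat_real (cball 0 (2 * R)) u * (1 / cmod u)))"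
      by (intro integrable_mult_right integrable_indicator_mult locally_integrable_inverse_norm)
    show "AE u in lborel. \<bar>K u * b (z - u) - ln (cmod u) * b (z - u)\<bar>
        \<le> M * \<eta> * (indicat_real (cball 0 (2 * R)) u * (1 / cmod u))"
      using AE_lborel_singleton[of 0]
    proof eventually_elim
      case (elim u)
      show ?case
      proof (cases "cmod u \<le> 2 * R")
        case True
        have "\<bar>K u - ln (cmod u)\<bar> * \<bar>b (z - u)\<bar> \<le> (\<eta> * (1 / cmod u)) * M"
          using approx[OF elim True] b(3) \<eta> by (intro mult_mono) auto
        then show ?thesis using True
          by (simp add: left_diff_distrib[symmetric] abs_mult mult_ac)
      next
        case False
        then have "R < cmod (z - u)" using z norm_triangle_ineq2[of u z] by (simp add: norm_minus_commute)
        then show ?thesis using b(2) False by (simp add: supported_in_def)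
      qed
    qed
  qed (use i1 i2 in auto)
  also have "\<dots> = M * \<eta> * riesz_bound R"
    unfolding riesz_bound_def by (rule integral_mult_right_zero)
  finally show ?thesis .
qed

text \<open>Pointwise convergence on a finite net of mesh \<open>d\<close> extends to the whole set with an error \<open>2 B d\<close>.\<close>

lemma equilipschitz_tendsto_uniform:
  fixes v :: "real \<Rightarrow> 'a::euclidean_space \<Rightarrow> real"
  assumes C: "compact S" and l: "\<And>z. z \<in> S \<Longrightarrow> ((\<lambda>\<epsilon>. v \<epsilon> z) \<longlongrightarrow> v0 z) F"
    and lip: "\<forall>\<^sub>F \<epsilon> in F. \<forall>z\<in>S. \<forall>z'\<in>S. \<bar>v \<epsilon> z - v \<epsilon> z'\<bar> \<le> B * dist z z'"
    and lip0: "\<And>z z'. z \<in> S \<Longrightarrow> z' \<in> S \<Longrightarrow> \<bar>v0 z - v0 z'\<bar> \<le> B * dist z z'"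
    and e: "e > 0" and B: "B \<ge> 0"
  shows "\<forall>\<^sub>F \<epsilon> in F. \<forall>z\<in>S. \<bar>v \<epsilon> z - v0 z\<bar> \<le> e"
proof -
  define d where "d = e / (3 * (B + 1))"
  have d: "d > 0" and Bd: "B * d \<le> e / 3"
    using e B by (auto simp: d_def divide_simps)
  obtain N where N: "finite N" "N \<subseteq> S" "S \<subseteq> (\<Union>x\<in>N. ball x d)"
    using compactE_image[OF C, of S "\<lambda>x. ball x d"] d by (metis (no_types, lifting) UN_I centre_in_ball open_ball subsetI)
  have "\<forall>\<^sub>F \<epsilon> in F. \<forall>x\<in>N. \<bar>v \<epsilon> x - v0 x\<bar> < e / 3"
  proof (rule eventually_ball_finite[OF N(1)], intro ballI)
    fix x assume "x \<in> N"
    then have "((\<lambda>\<epsilon>. v \<epsilon> x) \<longlongrightarrow> v0 x) F" using l N by auto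
    from tendstoD[OF this, of "e / 3"] e
    show "\<forall>\<^sub>F \<epsilon> in F. \<bar>v \<epsilon> x - v0 x\<bar> < e / 3" by (simp add: dist_real_def)
  qed
  then show ?thesis
    using lip
  proof eventually_elim
    case (elim \<epsilon>)
    show ?case
    proof
      fix z assume z: "z \<in> S"
      then obtain x where x: "x \<in> N" "dist x z < d" using N by auto
      have xS: "x \<in> S" using x N by auto
      have le: "B * dist z x \<le> e / 3"
        using mult_left_mono[of "dist z x" d B] x B Bd by (simp add: dist_commute)
      have "\<bar>v \<epsilon> z - v \<epsilon> x\<bar> \<le> B * dist z x" using elim(2) z xS by blast
      moreover have "\<bar>v0 z - v0 x\<bar> \<le> B * dist z x" using lip0 z xS by blast
      moreover have "\<bar>v \<epsilon> x - v0 x\<bar> < e / 3" using elim(1) x by blast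
      ultimately show "\<bar>v \<epsilon> z - v0 z\<bar> \<le> e" using le by linarith
    qed
  qed
qed

lemma convolution_lipschitz:
  fixes K b :: "complex \<Rightarrow> real"
  assumes K: "smooth K" "supported_in \<rho> K" and B: "\<And>z h. \<bar>dd K z h\<bar> \<le> B * cmod h"
    and b: "integrable lborel b" "(LBINT w. \<bar>b w\<bar>) \<le> M"
  shows "\<bar>(LBINT w. b w * K (z - w)) - (LBINT w. b w * K (z' - w))\<bar> \<le> B * M * dist z z'"
proof -
  have B0: "B \<ge> 0" using B[of 0 1] by simp
  obtain C where C: "\<And>z. \<bar>K z\<bar> \<le> C"
    using continuous_supported_in_bounded[OF smooth_imp_continuous[OF K(1)] K(2)] by metis
  have [measurable]: "K \<in> borel_measurable borel" using smooth_measurable[OF K(1)] .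
  have [measurable]: "b \<in> borel_measurable borel" using b(1) by auto
  have int: "integrable lborel (\<lambda>w. b w * K (y - w))" for y
  proof (rule Bochner_Integration.integrable_bound[OF integrable_mult_left[OF integrable_abs[OF b(1)], of C]])
    show "AE w in lborel. norm (b w * K (y - w)) \<le> norm (\<bar>b w\<bar> * C)"
      using C order_trans[OF abs_ge_zero C] by (auto simp: abs_mult intro!: AE_I2 mult_left_mono)
  qed measurable
  have "onorm (dd K z) \<le> B" for z
    by (rule onorm_le) (simp add: B)
  then have lipK: "\<bar>K x - K y\<bar> \<le> B * dist x y" for x y
    using differentiable_bound[OF convex_UNIV, of K "\<lambda>z. dd K z" B x y]
      smooth_imp_has_derivative[OF K(1)] by (simp add: dist_norm)
  have "(LBINT w. b w * K (z - w)) - (LBINT w. b w * K (z' - w)) = (LBINT w. b w * K (z - w) - b w * K (z' - w))"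
    using int by simp
  also have "\<bar>\<dots>\<bar> \<le> (LBINT w. \<bar>b w * K (z - w) - b w * K (z' - w)\<bar>)" by (rule integral_abs_bound)
  also have "\<dots> \<le> (LBINT w. B * dist z z' * \<bar>b w\<bar>)"
  proof (rule integral_mono)
    fix w
    have "\<bar>K (z - w) - K (z' - w)\<bar> \<le> B * dist z z'"
      using lipK[of "z - w" "z' - w"] by (simp add: dist_norm)
    then have "\<bar>b w\<bar> * \<bar>K (z - w) - K (z' - w)\<bar> \<le> \<bar>b w\<bar> * (B * dist z z')" by (intro mult_left_mono) auto
    then show "\<bar>b w * K (z - w) - b w * K (z' - w)\<bar> \<le> B * dist z z' * \<bar>b w\<bar>"
      by (simp add: right_diff_distrib[symmetric] abs_mult mult_ac)
  qed (use int b in auto)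
  also have "\<dots> \<le> B * dist z z' * M"
    using b(2) B0 by (simp add: mult_left_mono)
  finally show ?thesis by (simp add: mult_ac)
qed

text \<open>The family \<open>a\<close> converges weakly to the functional \<open>\<alpha>\<close>, and \<open>b\<close> to the function \<open>\<beta>\<close>. The
  number \<open>L\<close> plays the part of \<open>\<alpha>\<close> applied to the potential of \<open>\<beta>\<close>, which is not a test function; the last
  hypothesis is continuity of \<open>\<alpha>\<close> for the uniform norm on the ball. It is applied with \<open>\<alpha>\<close> equal to evaluation
  at 0 and to integration over \<open>\<Omega>\<close>.
  
  Replace \<open>ln\<close> by a smooth kernel \<open>K\<close> with error \<open>\<eta>/|u|\<close>. The potentials of \<open>b\<close> and \<open>\<beta>\<close> change by
  \<open>O(\<eta>)\<close> on the ball, hence so do the energy and \<open>L\<close>. For the kernel \<open>K\<close>, the potentials \<open>v \<epsilon>\<close> of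
  \<open>b \<epsilon>\<close> converge pointwise because \<open>w \<mapsto> K (z - w)\<close> is a test function, hence uniformly by equicontinuity, to
  \<open>v0\<close>, which is itself a test function.\<close>

lemma log_energy_tendsto:
  fixes a b :: "real \<Rightarrow> complex \<Rightarrow> real" and \<beta> :: "complex \<Rightarrow> real"
  assumes R: "R \<ge> 0" and smooth_ab: "\<And>\<epsilon>. \<epsilon> > 0 \<Longrightarrow> smooth (a \<epsilon>) \<and> smooth (b \<epsilon>)"
    and a: "\<forall>\<^sub>F \<epsilon> in at_right 0. supported_in R (a \<epsilon>) \<and> (LBINT z. \<bar>a \<epsilon> z\<bar>) \<le> M"
    and b: "\<forall>\<^sub>F \<epsilon> in at_right 0. supported_in R (b \<epsilon>) \<and> (\<forall>z. \<bar>b \<epsilon> z\<bar> \<le> M) \<and> (LBINT z. \<bar>b \<epsilon> z\<bar>) \<le> M'"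
    and \<beta>: "\<beta> \<in> borel_measurable borel" "supported_in R \<beta>" "\<And>w. \<bar>\<beta> w\<bar> \<le> 1"
      "integrable lborel \<beta>" "(LBINT z. \<bar>\<beta> z\<bar>) \<le> M'"
    and a_lim: "\<And>\<psi>. smooth \<psi> \<Longrightarrow> compactly_supported \<psi> \<Longrightarrow> ((\<lambda>\<epsilon>. LBINT z. a \<epsilon> z * \<psi> z) \<longlongrightarrow> \<alpha> \<psi>) (at_right 0)"
    and b_lim: "\<And>\<psi>. smooth \<psi> \<Longrightarrow> compactly_supported \<psi> \<Longrightarrow>
      ((\<lambda>\<epsilon>. LBINT z. b \<epsilon> z * \<psi> z) \<longlongrightarrow> (LBINT z. \<beta> z * \<psi> z)) (at_right 0)"
    and \<alpha>: "\<And>\<psi> e. smooth \<psi> \<Longrightarrow> compactly_supported \<psi> \<Longrightarrow> (\<And>z. cmod z \<le> R \<Longrightarrow> \<bar>\<psi> z - log_potential \<beta> z\<bar> \<le> e) \<Longrightarrow>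
      \<bar>\<alpha> \<psi> - L\<bar> \<le> A * e"
  shows "((\<lambda>\<epsilon>. log_energy (a \<epsilon>) (b \<epsilon>)) \<longlongrightarrow> L) (at_right 0)"
proof (rule tendstoI)
  fix e :: real assume e: "e > 0"
  have pos: "\<forall>\<^sub>F \<epsilon>::real in at_right 0. \<epsilon> > 0" by (rule eventually_at_right_less)
  obtain \<epsilon>0 where "\<bar>b \<epsilon>0 0\<bar> \<le> M" "(LBINT z. \<bar>a \<epsilon>0 z\<bar>) \<le> M"
    using eventually_happens[OF eventually_conj[OF a b]] by auto
  then have M: "M \<ge> 0" by linarith
  have M': "M' \<ge> 0" using \<beta>(5) by (rule order_trans[rotated]) simp
  have Q: "riesz_bound R \<ge> 0" unfolding riesz_bound_def by simp
  \<comment> \<open>The errors of the two replacements of \<open>ln\<close> by \<open>K\<close> add up to at most \<open>\<eta> T = e/2\<close>.\<close>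
  define T where "T = M * M * riesz_bound R + \<bar>A\<bar> * riesz_bound R + 1"
  have T: "T > 0" using M Q by (simp add: T_def add_nonneg_pos)
  define \<eta> where "\<eta> = e / (2 * T)"
  have \<eta>: "\<eta> > 0" using e T by (simp add: \<eta>_def)
  obtain K where K: "smooth K" "compactly_supported K"
      "\<And>u. u \<noteq> 0 \<Longrightarrow> cmod u \<le> 2 * R \<Longrightarrow> \<bar>K u - ln (cmod u)\<bar> \<le> \<eta> * (1 / cmod u)"
    using smooth_kernel_approximation[OF \<eta>] by metis
  obtain \<rho> where \<rho>: "supported_in \<rho> K" using K(2) unfolding compactly_supported_iff by blast
  obtain B where B: "B \<ge> 0" "\<And>z h. \<bar>dd K z h\<bar> \<le> B * cmod h"
    using frechet_derivative_bounded[OF K(1) \<rho>] by metis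
  note Kl = locally_integrable_smooth[OF K(1)]
  define v where "v = (\<lambda>\<epsilon> z. LBINT w. b \<epsilon> w * K (z - w))"
  define v0 where "v0 = (\<lambda>z. LBINT w. \<beta> w * K (z - w))"
  have \<beta>l: "locally_integrable \<beta>"
    unfolding locally_integrable_def set_integrable_def using \<beta>(1,4)
    by (intro conjI allI integrable_mult_indicator) auto
  have v0_smooth: "smooth v0" unfolding v0_def by (rule smooth_convolution[OF \<beta>l K(1) \<rho>])
  have v0_supp: "supported_in (R + \<rho>) v0"
    unfolding supported_in_def
  proof (intro allI impI)
    fix z assume z: "R + \<rho> < cmod z"
    have "\<beta> w * K (z - w) = 0" for w
    proof (cases "cmod w \<le> R")
      case True
      then have "\<rho> < cmod (z - w)" using z norm_triangle_ineq2[of z w] by linarith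
      then show ?thesis using \<rho> by (simp add: supported_in_def)
    qed (use \<beta>(2) in \<open>simp add: supported_in_def\<close>)
    then show "v0 z = 0" unfolding v0_def by (simp only: Bochner_Integration.integral_zero)
  qed
  then have v0_cs: "compactly_supported v0" unfolding compactly_supported_iff by blast
  have v0_close: "\<bar>v0 z - log_potential \<beta> z\<bar> \<le> \<eta> * riesz_bound R" if "cmod z \<le> R" for z
    using kernel_approximation_error[OF Kl K(3) \<beta>(1-3) that] \<eta> by (simp add: v0_def)
  have \<alpha>_close: "\<bar>\<alpha> v0 - L\<bar> \<le> A * (\<eta> * riesz_bound R)"
    by (rule \<alpha>[OF v0_smooth v0_cs v0_close])
  \<comment> \<open>The potentials need only be uniformly \<open>d\<close>-close, as the \<open>L\<^sup>1\<close> norm of \<open>a \<epsilon>\<close> is at most \<open>M\<close>.\<close>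
  define d where "d = e / (4 * (M + 1))"
  have d: "d > 0" and Md: "M * d \<le> e / 4"
    using e M by (auto simp: d_def divide_simps)
  have uniform: "\<forall>\<^sub>F \<epsilon> in at_right 0. \<forall>z\<in>cball 0 R. \<bar>v \<epsilon> z - v0 z\<bar> \<le> d"
  proof (rule equilipschitz_tendsto_uniform[where B = "B * M'"])
    fix z :: complex
    have "smooth (\<lambda>w. K (z - w))" by (rule smooth_reflect[OF K(1)])
    moreover have "compactly_supported (\<lambda>w. K (z - w))"
      using supported_in_reflect[OF \<rho>] unfolding compactly_supported_iff by blast
    ultimately show "((\<lambda>\<epsilon>. v \<epsilon> z) \<longlongrightarrow> v0 z) (at_right 0)"
      unfolding v_def v0_def by (rule b_lim)
  next
    show "\<forall>\<^sub>F \<epsilon> in at_right 0. \<forall>z\<in>cball 0 R. \<forall>z'\<in>cball 0 R. \<bar>v \<epsilon> z - v \<epsilon> z'\<bar> \<le> B * M' * dist z z'"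
      using b pos
    proof eventually_elim
      case (elim \<epsilon>)
      have "integrable lborel (b \<epsilon>)"
        using integrable_supported[OF smooth_imp_continuous, of "b \<epsilon>" R] elim smooth_ab by auto
      then show ?case
        unfolding v_def using convolution_lipschitz[OF K(1) \<rho> B(2)] elim by blast
    qed
    show "\<bar>v0 z - v0 z'\<bar> \<le> B * M' * dist z z'" for z z'
      unfolding v0_def by (rule convolution_lipschitz[OF K(1) \<rho> B(2) \<beta>(4,5)])
  qed (use d B M' in auto)
  have test: "\<forall>\<^sub>F \<epsilon> in at_right 0. \<bar>(LBINT z. a \<epsilon> z * v0 z) - \<alpha> v0\<bar> < e / 4"
    using tendstoD[OF a_lim[OF v0_smooth v0_cs], of "e / 4"] e by (simp add: dist_real_def)
  show "\<forall>\<^sub>F \<epsilon> in at_right 0. dist (log_energy (a \<epsilon>) (b \<epsilon>)) L < e"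
    using pos a b uniform test
  proof eventually_elim
    case (elim \<epsilon>)
    have sa: "smooth (a \<epsilon>)" and sb: "smooth (b \<epsilon>)" using smooth_ab elim by auto
    have a_supp: "supported_in R (a \<epsilon>)" and a_L1: "(LBINT z. \<bar>a \<epsilon> z\<bar>) \<le> M"
      and b_supp: "supported_in R (b \<epsilon>)" and b_bd: "\<And>z. \<bar>b \<epsilon> z\<bar> \<le> M" using elim by auto
    have ai: "integrable lborel (\<lambda>z. \<bar>a \<epsilon> z\<bar>)"
      using integrable_supported[OF smooth_imp_continuous[OF sa] a_supp] by simp
    let ?p = "log_potential (b \<epsilon>)"
    have ip: "integrable lborel (\<lambda>z. a \<epsilon> z * ?p z)"
      by (intro integrable_mult_supported[OF smooth_imp_continuous[OF sa] a_supp] smooth_imp_continuous smooth_log_potential[OF sb b_supp])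
    have iv: "integrable lborel (\<lambda>z. a \<epsilon> z * v0 z)"
      by (intro integrable_mult_supported[OF smooth_imp_continuous[OF sa] a_supp] smooth_imp_continuous v0_smooth)
    define D where "D = M * \<eta> * riesz_bound R + d"
    have D: "D \<ge> 0" using M \<eta> Q d by (simp add: D_def)
    have close: "\<bar>?p z - v0 z\<bar> \<le> D" if z: "cmod z \<le> R" for z
    proof -
      have "\<bar>v \<epsilon> z - ?p z\<bar> \<le> M * \<eta> * riesz_bound R"
        unfolding v_def using \<eta>
        by (intro kernel_approximation_error[OF Kl K(3) smooth_measurable[OF sb] b_supp b_bd z]) auto
      moreover have "\<bar>v \<epsilon> z - v0 z\<bar> \<le> d" using elim(4) z by simp
      ultimately show ?thesis unfolding D_def by linarith
    qed
    have "log_energy (a \<epsilon>) (b \<epsilon>) - (LBINT z. a \<epsilon> z * v0 z) = (LBINT z. a \<epsilon> z * ?p z - a \<epsilon> z * v0 z)"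
      unfolding log_energy_eq using ip iv by simp
    also have "\<bar>\<dots>\<bar> \<le> (LBINT z. \<bar>a \<epsilon> z * ?p z - a \<epsilon> z * v0 z\<bar>)" by (rule integral_abs_bound)
    also have "\<dots> \<le> (LBINT z. D * \<bar>a \<epsilon> z\<bar>)"
    proof (rule integral_mono)
      fix z
      show "\<bar>a \<epsilon> z * ?p z - a \<epsilon> z * v0 z\<bar> \<le> D * \<bar>a \<epsilon> z\<bar>"
      proof (cases "cmod z \<le> R")
        case True
        have "\<bar>a \<epsilon> z\<bar> * \<bar>?p z - v0 z\<bar> \<le> \<bar>a \<epsilon> z\<bar> * D" by (intro mult_left_mono close True) simp
        then show ?thesis by (simp only: right_diff_distrib[symmetric] abs_mult mult.commute[of D])
      next
        case False
        then show ?thesis using a_supp by (simp add: supported_in_def)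
      qed
    qed (use ip iv ai in auto)
    also have "\<dots> \<le> D * M" using a_L1 D by (simp add: mult_left_mono)
    finally have 1: "\<bar>log_energy (a \<epsilon>) (b \<epsilon>) - (LBINT z. a \<epsilon> z * v0 z)\<bar> \<le> D * M" .
    have "D * M + A * (\<eta> * riesz_bound R) \<le> \<eta> * T + M * d"
    proof -
      have "A * (\<eta> * riesz_bound R) \<le> \<bar>A\<bar> * (\<eta> * riesz_bound R)"
        using \<eta> Q by (intro mult_right_mono) auto
      then have "D * M + A * (\<eta> * riesz_bound R) \<le> \<eta> * (M * M * riesz_bound R + \<bar>A\<bar> * riesz_bound R) + M * d"
        by (simp add: D_def algebra_simps)
      also have "\<dots> \<le> \<eta> * T + M * d" using \<eta> by (simp add: T_def distrib_left)
      finally show ?thesis .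
    qed
    moreover have "\<eta> * T = e / 2" using T by (simp add: \<eta>_def)
    ultimately have "D * M + A * (\<eta> * riesz_bound R) \<le> e / 2 + e / 4" using Md by linarith
    then show ?case using 1 elim(5) \<alpha>_close unfolding dist_real_def by linarith
  qed
qed

section \<open>Existence of metrics and regularizations\<close>

text \<open>The round metric, which has the same form in both charts.\<close>

lemma conformal_metric_exists: "\<exists>\<rho>. conformal_metric \<rho>"
proof -
  define \<rho> where "\<rho> = (\<lambda>z::complex. 1 / (1 + (cmod z)\<^sup>2)\<^sup>2)"
  have pos: "0 < 1 + (cmod z)\<^sup>2" for z by (simp add: add_pos_nonneg)
  have "smooth_on UNIV (\<lambda>z::complex. 1 + (cmod z)\<^sup>2)"
    by (rule smooth_on_add[OF open_UNIV smooth_on_const smooth_norm_sq[unfolded smooth_eq_smooth_on]])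
  moreover have "(\<lambda>w. 1 / w\<^sup>2) holomorphic_on {w. Re w > 0}"
    by (intro holomorphic_intros) auto
  ultimately have "smooth_on UNIV (\<lambda>z::complex. Re (1 / (complex_of_real (1 + (cmod z)\<^sup>2))\<^sup>2))"
    using pos by (intro smooth_on_Re_holomorphic[where f = "\<lambda>w. 1 / w\<^sup>2"]) auto
  moreover have "Re (1 / (complex_of_real (1 + (cmod z)\<^sup>2))\<^sup>2) = \<rho> z" for z
  proof -
    have "1 / (complex_of_real (1 + (cmod z)\<^sup>2))\<^sup>2 = complex_of_real (\<rho> z)"
      by (simp only: \<rho>_def of_real_divide of_real_power of_real_1)
    then show ?thesis by simp
  qed
  ultimately have s: "smooth \<rho>" by (simp add: smooth_eq_smooth_on)
  have p: "\<rho> z > 0" for z using pos[of z] unfolding \<rho>_def by (intro divide_pos_pos zero_less_power) auto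
  have "\<rho> w = \<rho> (1 / w) / cmod w ^ 4" if "w \<noteq> 0" for w
  proof -
    have "(1 + (1 / r)\<^sup>2)\<^sup>2 * r ^ 4 = (1 + r\<^sup>2)\<^sup>2" if "r \<noteq> 0" for r :: real
    proof -
      have "(1 + (1 / r)\<^sup>2)\<^sup>2 * r ^ 4 = ((1 + (1 / r)\<^sup>2) * r\<^sup>2)\<^sup>2" by (simp add: power_mult_distrib)
      also have "(1 + (1 / r)\<^sup>2) * r\<^sup>2 = 1 + r\<^sup>2" using that by (simp add: field_simps)
      finally show ?thesis .
    qed
    from this[of "cmod w"] that show ?thesis by (simp add: \<rho>_def norm_divide)
  qed
  then have "conformal_metric \<rho>" unfolding conformal_metric_def using s p by blast
  then show ?thesis by blast
qed

text \<open>The zeta-determinant is an exponential, so only the area matters; a smooth metric on the sphere has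
  density \<open>O(|z|\<^sup>-\<^sup>4)\<close> at infinity and thus finite area.\<close>

lemma partition_0_pos:
  assumes "conformal_metric \<rho>"
  shows "partition_0 \<rho> > 0"
proof -
  obtain \<rho>' where \<rho>: "smooth \<rho>" "\<And>z. \<rho> z > 0" and \<rho>': "smooth \<rho>'" "\<And>w. \<rho>' w > 0"
      "\<And>w. w \<noteq> 0 \<Longrightarrow> \<rho>' w = \<rho> (1 / w) / cmod w ^ 4"
    using assms unfolding conformal_metric_def by blast
  have bdd: "\<exists>B. \<forall>z. cmod z \<le> 1 \<longrightarrow> f z \<le> B" if "smooth f" for f :: "complex \<Rightarrow> real"
  proof -
    have "bounded (f ` cball 0 1)"
      by (intro compact_imp_bounded compact_continuous_image smooth_imp_continuous[OF that] compact_cball)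
    then obtain B where "\<forall>x\<in>f ` cball 0 1. \<bar>x\<bar> \<le> B" unfolding bounded_iff by auto
    then show ?thesis by (intro exI[of _ B]) (auto dest: abs_le_D1)
  qed
  obtain B where B: "\<And>z. cmod z \<le> 1 \<Longrightarrow> \<rho> z \<le> B" using bdd[OF \<rho>(1)] by blast
  obtain B' where B': "\<And>z. cmod z \<le> 1 \<Longrightarrow> \<rho>' z \<le> B'" using bdd[OF \<rho>'(1)] by blast
  have B0: "B > 0" "B' > 0" using B[of 0] B'[of 0] \<rho>(2)[of 0] \<rho>'(2)[of 0] by auto
  have bound: "\<rho> z \<le> (4 * (B + B')) * decay z" if z: "z \<noteq> 0" for z
  proof -
    define r where "r = cmod z"
    have r: "r > 0" using z by (simp add: r_def)
    show ?thesis
    proof (cases "r \<le> 1")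
      case True
      have "r * (1 + r)\<^sup>2 \<le> 1 * 2\<^sup>2" using r True by (intro mult_mono power_mono) auto
      then have "1 \<le> 4 * (1 / (r * (1 + r)\<^sup>2))" using r by (simp add: divide_simps)
      then have "B * 1 \<le> (B + B') * (4 * (1 / (r * (1 + r)\<^sup>2)))"
        using B0 by (intro mult_mono) auto
      then have "\<rho> z \<le> (B + B') * (4 * (1 / (r * (1 + r)\<^sup>2)))" using B[of z] True by (simp add: r_def)
      also have "\<dots> = (4 * (B + B')) * decay z" by (simp add: decay_def r_def)
      finally show ?thesis .
    next
      case False
      have "\<rho>' (1 / z) = \<rho> z / cmod (1 / z) ^ 4" using \<rho>'(3)[of "1 / z"] z by simp
      then have "\<rho> z = \<rho>' (1 / z) * (1 / r ^ 4)" using r by (simp add: r_def norm_divide field_simps)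
      also have "\<dots> \<le> (B + B') * (4 * (1 / (r * (1 + r)\<^sup>2)))"
      proof (rule mult_mono)
        have "cmod (1 / z) \<le> 1" using False r by (simp add: norm_divide r_def divide_simps)
        then show "\<rho>' (1 / z) \<le> B + B'" using B'[of "1 / z"] B0 by linarith
        have "r * (1 + r)\<^sup>2 \<le> r\<^sup>2 * (2 * r)\<^sup>2"
          using False by (intro mult_mono power_mono) (auto simp: power2_eq_square)
        also have "\<dots> = 4 * r ^ 4" by (simp add: power_mult_distrib)
        finally show "1 / r ^ 4 \<le> 4 * (1 / (r * (1 + r)\<^sup>2))" using r by (simp add: divide_simps)
      qed (use B0 r in auto)
      also have "\<dots> = (4 * (B + B')) * decay z" by (simp add: decay_def r_def)
      finally show ?thesis .
    qed
  qed
  have int: "integrable lborel \<rho>"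
  proof (rule Bochner_Integration.integrable_bound)
    show "integrable lborel (\<lambda>z. (4 * (B + B')) * decay z)" using integrable_decay by simp
    show "AE z in lborel. norm (\<rho> z) \<le> norm ((4 * (B + B')) * decay z)"
      using AE_lborel_singleton[of 0]
    proof eventually_elim
      case (elim z)
      then show ?case using bound[of z] \<rho>(2)[of z] by simp
    qed
  qed (use smooth_measurable[OF \<rho>(1)] in simp)
  have "area_P1 \<rho> > 0"
    unfolding area_P1_def
    by (rule integral_pos_of_continuous[OF smooth_imp_continuous[OF \<rho>(1)] int less_imp_le[OF \<rho>(2)] \<rho>(2)])
  then show ?thesis by (simp add: partition_0_def det_zeta_def)
qed

lemma area_pos:
  assumes "open \<Omega>" "bounded \<Omega>" "z \<in> \<Omega>"
  shows "area \<Omega> > 0"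
proof -
  obtain r where r: "r > 0" "ball z r \<subseteq> \<Omega>" using assms(1,3) open_contains_ball by blast
  have "0 < measure lborel (ball z r)" using r by (simp add: content_ball)
  also have "\<dots> \<le> area \<Omega>"
    using r assms by (intro measure_mono_fmeasurable) (auto intro!: fmeasurableI emeasure_bounded_finite)
  finally show ?thesis .
qed

definition rescale :: "real \<Rightarrow> (complex \<Rightarrow> real) \<Rightarrow> complex \<Rightarrow> real" where
  "rescale \<epsilon> \<eta> z = \<eta> ((1 / \<epsilon>) *\<^sub>R z) / \<epsilon>\<^sup>2"

lemma scaled_mollifier:
  assumes \<eta>: "mollifier \<eta>" and \<epsilon>: "\<epsilon> > 0"
  shows "smooth (rescale \<epsilon> \<eta>)" "supported_in \<epsilon> (rescale \<epsilon> \<eta>)" "\<And>z. 0 \<le> (rescale \<epsilon> \<eta>) z"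
    "\<And>\<psi>. \<psi> \<in> borel_measurable borel \<Longrightarrow> (LBINT z. (rescale \<epsilon> \<eta>) z * \<psi> z) = (LBINT z. \<eta> z * \<psi> (\<epsilon> *\<^sub>R z))"
    "integrable lborel (rescale \<epsilon> \<eta>)" "\<And>z. (LBINT w. (rescale \<epsilon> \<eta>) (z - w)) = 1"
proof -
  have m: "smooth \<eta>" "supported_in 1 \<eta>" "\<And>z. 0 \<le> \<eta> z" "(LBINT z. \<eta> z) = 1"
    using \<eta> by (auto simp: mollifier_def)
  have "smooth_on UNIV (\<lambda>z. \<eta> ((1 / \<epsilon>) *\<^sub>R z))"
    by (rule smooth_on_compose[OF m(1)[unfolded smooth_eq_smooth_on]
          smooth_on_linear[OF bounded_linear_scaleR_right open_UNIV smooth_on_id[OF open_UNIV]] open_UNIV open_UNIV subset_UNIV])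
  then have "smooth_on UNIV (\<lambda>z. (1 / \<epsilon>\<^sup>2) * \<eta> ((1 / \<epsilon>) *\<^sub>R z))" by (rule smooth_on_cmult[OF open_UNIV])
  then show s: "smooth (rescale \<epsilon> \<eta>)" by (simp add: smooth_eq_smooth_on rescale_def[abs_def])
  show supp: "supported_in \<epsilon> (rescale \<epsilon> \<eta>)"
    using m(2) \<epsilon> by (auto simp: supported_in_def rescale_def field_simps)
  show "0 \<le> (rescale \<epsilon> \<eta>) z" for z using m(3) by (simp add: rescale_def)
  show conv: "(LBINT z. (rescale \<epsilon> \<eta>) z * \<psi> z) = (LBINT z. \<eta> z * \<psi> (\<epsilon> *\<^sub>R z))"
    if [measurable]: "\<psi> \<in> borel_measurable borel" for \<psi>
  proof -
    have [measurable]: "rescale \<epsilon> \<eta> \<in> borel_measurable borel" using smooth_measurable[OF s] .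
    have "(\<lambda>z. (rescale \<epsilon> \<eta>) z * \<psi> z) \<in> borel_measurable borel" by measurable
    from lborel_integral_affine[OF _ this, of \<epsilon> 0]
    have "(LBINT z. (rescale \<epsilon> \<eta>) z * \<psi> z) = (LBINT z. \<epsilon>\<^sup>2 * ((rescale \<epsilon> \<eta>) (\<epsilon> *\<^sub>R z) * \<psi> (\<epsilon> *\<^sub>R z)))"
      using \<epsilon> by simp
    also have "(\<lambda>z. \<epsilon>\<^sup>2 * ((rescale \<epsilon> \<eta>) (\<epsilon> *\<^sub>R z) * \<psi> (\<epsilon> *\<^sub>R z))) = (\<lambda>z. \<eta> z * \<psi> (\<epsilon> *\<^sub>R z))"
      using \<epsilon> by (simp add: rescale_def)
    finally show ?thesis .
  qed
  show "integrable lborel (rescale \<epsilon> \<eta>)"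
    using integrable_supported[OF smooth_imp_continuous[OF s] supp] by simp
  show "(LBINT w. (rescale \<epsilon> \<eta>) (z - w)) = 1" for z
    using lborel_integral_reflect[OF smooth_measurable[OF s], of z] conv[of "\<lambda>z. 1"] m(4) by simp
qed

text \<open>Mollify at scale \<open>\<epsilon>\<close> the indicator of the points at distance at least \<open>2 \<epsilon>\<close> from the complement.
  The result lives inside \<open>\<Omega>\<close> and converges at every point, including those of the boundary.\<close>

lemma smooth_inner_approximation_of_indicator:
  fixes \<Omega> :: "complex set"
  assumes \<Omega>: "open \<Omega>" "bounded \<Omega>"
  shows "\<exists>chi :: real \<Rightarrow> complex \<Rightarrow> real.
    (\<forall>\<epsilon>>0. smooth (chi \<epsilon>) \<and> (\<forall>z. 0 \<le> chi \<epsilon> z \<and> chi \<epsilon> z \<le> 1 \<and> (z \<notin> \<Omega> \<longrightarrow> chi \<epsilon> z = 0))) \<and>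
    (\<forall>z. ((\<lambda>\<epsilon>. chi \<epsilon> z) \<longlongrightarrow> indicat_real \<Omega> z) (at_right 0))"
proof -
  obtain \<eta> where \<eta>: "mollifier \<eta>" using mollifier_exists by blast
  define \<eta>s where "\<eta>s = (\<lambda>\<epsilon>. rescale \<epsilon> \<eta>)"
  have "rescale \<epsilon> \<eta> = \<eta>s \<epsilon>" for \<epsilon> by (simp add: \<eta>s_def)
  note \<eta>s = scaled_mollifier[OF \<eta>, unfolded this]
  define D where "D = (\<lambda>z. infdist z (- \<Omega>))"
  have ne: "- \<Omega> \<noteq> {}"
  proof
    assume "- \<Omega> = {}"
    then have "\<Omega> = UNIV" by blast
    then show False using \<Omega>(2) not_bounded_UNIV[where 'a = complex] by simp
  qed
  have D_lip: "D z \<le> D w + cmod (z - w)" for z w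
    unfolding D_def using infdist_triangle[of z "- \<Omega>" w] by (simp add: dist_norm)
  have D_out: "D z = 0" if "z \<notin> \<Omega>" for z using that by (simp add: D_def)
  have D_in: "D z > 0" if "z \<in> \<Omega>" for z
    using that \<Omega>(1) ne in_closed_iff_infdist_zero[of "- \<Omega>" z] infdist_nonneg[of z "- \<Omega>"]
    by (simp add: D_def closed_Compl less_le)
  define core where "core = (\<lambda>\<epsilon>. {w. 2 * \<epsilon> \<le> D w})"
  have core_sets: "core \<epsilon> \<in> sets borel" for \<epsilon>
    unfolding core_def D_def by (intro borel_closed closed_Collect_le continuous_intros)
  define chi where "chi = (\<lambda>\<epsilon> z. LBINT w. indicat_real (core \<epsilon>) w * \<eta>s \<epsilon> (z - w))"
  have chi_smooth: "smooth (chi \<epsilon>)" if "\<epsilon> > 0" for \<epsilon>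
    unfolding chi_def by (rule smooth_convolution[OF locally_integrable_indicator[OF core_sets] \<eta>s(1,2)[OF that]])
  have \<eta>s_shift: "integrable lborel (\<lambda>w. \<eta>s \<epsilon> (z - w))" if "\<epsilon> > 0" for \<epsilon> z
    using lborel_integrable_affine[OF _ \<eta>s(5)[OF that], of "-1" z] by simp
  have chi_int: "integrable lborel (\<lambda>w. indicat_real (core \<epsilon>) w * \<eta>s \<epsilon> (z - w))" if "\<epsilon> > 0" for \<epsilon> z
    using integrable_mult_indicator[OF _ \<eta>s_shift[OF that], of "core \<epsilon>"] core_sets by simp
  have chi_ge: "0 \<le> chi \<epsilon> z" if "\<epsilon> > 0" for \<epsilon> z
    unfolding chi_def using \<eta>s(3)[OF that] by (intro integral_nonneg_AE AE_I2) auto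
  have chi_le: "chi \<epsilon> z \<le> 1" if "\<epsilon> > 0" for \<epsilon> z
  proof -
    have "chi \<epsilon> z \<le> (LBINT w. \<eta>s \<epsilon> (z - w))"
      unfolding chi_def using \<eta>s(3)[OF that]
      by (intro integral_mono chi_int \<eta>s_shift that) (auto simp: indicator_def)
    then show ?thesis using \<eta>s(6)[OF that] by simp
  qed
  have chi_out: "chi \<epsilon> z = 0" if \<epsilon>: "\<epsilon> > 0" and z: "z \<notin> \<Omega>" for \<epsilon> z
  proof -
    have "indicat_real (core \<epsilon>) w * \<eta>s \<epsilon> (z - w) = 0" for w
    proof (cases "w \<in> core \<epsilon>")
      case True
      then have "\<epsilon> < cmod (z - w)" using D_lip[of w z] D_out[OF z] \<epsilon> by (simp add: core_def norm_minus_commute)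
      then show ?thesis using \<eta>s(2)[OF \<epsilon>] by (simp add: supported_in_def)
    qed simp
    then show ?thesis unfolding chi_def by (simp only: Bochner_Integration.integral_zero)
  qed
  have chi_in: "chi \<epsilon> z = 1" if \<epsilon>: "\<epsilon> > 0" and z: "3 * \<epsilon> \<le> D z" for \<epsilon> z
  proof -
    have "indicat_real (core \<epsilon>) w * \<eta>s \<epsilon> (z - w) = \<eta>s \<epsilon> (z - w)" for w
    proof (cases "w \<in> core \<epsilon>")
      case False
      then have "\<epsilon> < cmod (z - w)" using D_lip[of z w] z by (simp add: core_def)
      then show ?thesis using \<eta>s(2)[OF \<epsilon>] by (simp add: supported_in_def)
    qed simp
    then show ?thesis unfolding chi_def using \<eta>s(6)[OF \<epsilon>] by (simp only:)
  qed
  have chi_lim: "((\<lambda>\<epsilon>. chi \<epsilon> z) \<longlongrightarrow> indicat_real \<Omega> z) (at_right 0)" for z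
  proof (cases "z \<in> \<Omega>")
    case True
    have "\<forall>\<^sub>F \<epsilon> in at_right 0. \<epsilon> \<in> {0<..<D z / 3}"
      using D_in[OF True] by (intro eventually_at_right_real) simp
    then have "\<forall>\<^sub>F \<epsilon> in at_right 0. 1 = chi \<epsilon> z"
      by eventually_elim (use chi_in in auto)
    from Lim_transform_eventually[OF tendsto_const this] show ?thesis using True by simp
  next
    case False
    have "\<forall>\<^sub>F \<epsilon> in at_right 0. 0 = chi \<epsilon> z"
      using eventually_at_right_less[of 0] by eventually_elim (use chi_out[OF _ False] in simp)
    from Lim_transform_eventually[OF tendsto_const this] show ?thesis using False by simp
  qed
  show ?thesis
    by (rule exI[of _ chi]) (simp add: chi_smooth chi_ge chi_le chi_out chi_lim)
qed

text \<open>Take for \<open>\<delta>\<close> a mollifier rescaled to the disc of radius \<open>\<epsilon>\<close>. Neutrality is achieved by the factor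
  \<open>c \<epsilon> = \<integral>\<chi>/A\<close>, which tends to 1.\<close>

lemma admissible_regularization_exists:
  assumes \<Omega>: "open \<Omega>" "bounded \<Omega>" "0 \<in> \<Omega>"
  shows "\<exists>chi \<delta>. admissible_regularization \<Omega> chi \<delta>"
proof -
  obtain \<eta> where \<eta>: "mollifier \<eta>" using mollifier_exists by blast
  define \<eta>s where "\<eta>s = (\<lambda>\<epsilon>. rescale \<epsilon> \<eta>)"
  have "rescale \<epsilon> \<eta> = \<eta>s \<epsilon>" for \<epsilon> by (simp add: \<eta>s_def)
  note \<eta>s = scaled_mollifier[OF \<eta>, unfolded this]
  obtain chi :: "real \<Rightarrow> complex \<Rightarrow> real" where
    chi: "\<forall>\<epsilon>>0. smooth (chi \<epsilon>) \<and> (\<forall>z. 0 \<le> chi \<epsilon> z \<and> chi \<epsilon> z \<le> 1 \<and> (z \<notin> \<Omega> \<longrightarrow> chi \<epsilon> z = 0))"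
    and lim: "\<forall>z. ((\<lambda>\<epsilon>. chi \<epsilon> z) \<longlongrightarrow> indicat_real \<Omega> z) (at_right 0)"
    using smooth_inner_approximation_of_indicator[OF \<Omega>(1,2)] by metis
  have chi_smooth: "smooth (chi \<epsilon>)" if "\<epsilon> > 0" for \<epsilon> using chi that by simp
  have chi_ge: "0 \<le> chi \<epsilon> z" and chi_le: "chi \<epsilon> z \<le> 1" if "\<epsilon> > 0" for \<epsilon> z using chi that by simp_all
  have chi_out: "chi \<epsilon> z = 0" if "\<epsilon> > 0" "z \<notin> \<Omega>" for \<epsilon> z using chi that by simp
  have chi_lim: "((\<lambda>\<epsilon>. chi \<epsilon> z) \<longlongrightarrow> indicat_real \<Omega> z) (at_right 0)" for z using lim by simp
  obtain R where R: "\<And>z. z \<in> \<Omega> \<Longrightarrow> cmod z \<le> R" using \<Omega>(2) unfolding bounded_iff by blast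
  have A: "area \<Omega> > 0" by (rule area_pos[OF \<Omega>])
  have chi_supp: "supported_in R (chi \<epsilon>)" if "\<epsilon> > 0" for \<epsilon>
    unfolding supported_in_def using chi_out[OF that] R by force
  have chi_test: "((\<lambda>\<epsilon>. LBINT z. chi \<epsilon> z * \<psi> z) \<longlongrightarrow> (LBINT z. indicat_real \<Omega> z * \<psi> z)) (at_right 0)"
    if \<psi>: "\<psi> \<in> borel_measurable borel" and w: "integrable lborel w" "\<And>z. indicat_real \<Omega> z * \<bar>\<psi> z\<bar> \<le> w z" for \<psi> w
  proof (rule dominated_convergence_within[OF _ w(1)])
    show "(\<lambda>z. indicat_real \<Omega> z * \<psi> z) \<in> borel_measurable lborel"
      using \<psi> \<Omega>(1) by (intro borel_measurable_times borel_measurable_indicator) (auto simp: borel_open)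
    show "\<forall>\<^sub>F \<epsilon> in at_right 0. (\<lambda>z. chi \<epsilon> z * \<psi> z) \<in> borel_measurable lborel \<and> (AE z in lborel. norm (chi \<epsilon> z * \<psi> z) \<le> w z)"
      using eventually_at_right_less[of 0]
    proof eventually_elim
      case (elim \<epsilon>)
      have "\<bar>chi \<epsilon> z\<bar> \<le> indicat_real \<Omega> z" for z
        using chi_ge[OF elim, of z] chi_le[OF elim, of z] chi_out[OF elim, of z] by (cases "z \<in> \<Omega>") auto
      then have "norm (chi \<epsilon> z * \<psi> z) \<le> w z" for z
        using order_trans[OF mult_right_mono[of "\<bar>chi \<epsilon> z\<bar>" "indicat_real \<Omega> z" "\<bar>\<psi> z\<bar>"] w(2)] by (simp add: abs_mult)
      moreover have "(\<lambda>z. chi \<epsilon> z * \<psi> z) \<in> borel_measurable lborel"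
        using smooth_measurable[OF chi_smooth[OF elim]] \<psi> by (intro borel_measurable_times) auto
      ultimately show ?case by simp
    qed
    show "AE z in lborel. ((\<lambda>\<epsilon>. chi \<epsilon> z * \<psi> z) \<longlongrightarrow> indicat_real \<Omega> z * \<psi> z) (at_right 0)"
      by (intro AE_I2 tendsto_intros chi_lim)
  qed
  have \<Omega>_fin: "integrable lborel (indicat_real \<Omega>)"
    using \<Omega> by (auto intro!: integrable_real_indicator emeasure_bounded_finite simp: borel_open)
  define c where "c = (\<lambda>\<epsilon>. (LBINT z. chi \<epsilon> z) / area \<Omega>)"
  have chi_integrable: "integrable lborel (chi \<epsilon>)" if "\<epsilon> > 0" for \<epsilon>
    using integrable_supported[OF smooth_imp_continuous[OF chi_smooth[OF that]] chi_supp[OF that]] by simp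
  have c_lim: "(c \<longlongrightarrow> 1) (at_right 0)"
  proof -
    have "((\<lambda>\<epsilon>. LBINT z. chi \<epsilon> z * 1) \<longlongrightarrow> (LBINT z. indicat_real \<Omega> z * 1)) (at_right 0)"
      by (rule chi_test[OF _ \<Omega>_fin]) auto
    then have "((\<lambda>\<epsilon>. LBINT z. chi \<epsilon> z) \<longlongrightarrow> area \<Omega>) (at_right 0)"
      using \<Omega>(1) by (simp add: borel_open)
    from tendsto_divide[OF this tendsto_const, of "area \<Omega>"] show ?thesis using A by (simp add: c_def[abs_def])
  qed
  have c_bd: "0 \<le> c \<epsilon>" "c \<epsilon> \<le> 1" if \<epsilon>: "\<epsilon> > 0" for \<epsilon>
  proof -
    show "0 \<le> c \<epsilon>" unfolding c_def using chi_ge[OF \<epsilon>] A by (intro divide_nonneg_pos) auto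
    have "(LBINT z. chi \<epsilon> z) \<le> (LBINT z. indicat_real \<Omega> z)"
    proof (rule integral_mono[OF chi_integrable[OF \<epsilon>] \<Omega>_fin])
      show "chi \<epsilon> z \<le> indicat_real \<Omega> z" for z
        using chi_le[OF \<epsilon>, of z] chi_out[OF \<epsilon>, of z] by (cases "z \<in> \<Omega>") auto
    qed
    then show "c \<epsilon> \<le> 1" unfolding c_def using A \<Omega>(1) by (simp add: borel_open)
  qed
  define \<delta> where "\<delta> = (\<lambda>\<epsilon> z. c \<epsilon> * \<eta>s \<epsilon> z)"
  have \<delta>_smooth: "smooth (\<delta> \<epsilon>)" if "\<epsilon> > 0" for \<epsilon>
    using \<eta>s(1)[OF that] unfolding \<delta>_def smooth_eq_smooth_on by (rule smooth_on_cmult[OF open_UNIV])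
  have \<delta>_supp: "supported_in \<epsilon> (\<delta> \<epsilon>)" if "\<epsilon> > 0" for \<epsilon>
    using \<eta>s(2)[OF that] by (simp add: \<delta>_def supported_in_def)
  have \<delta>_integral: "(LBINT z. \<delta> \<epsilon> z) = c \<epsilon>" "integrable lborel (\<delta> \<epsilon>)" if "\<epsilon> > 0" for \<epsilon>
  proof -
    have "(LBINT z. \<eta>s \<epsilon> z) = 1"
      using \<eta>s(6)[OF that, of 0] lborel_integral_reflect[OF smooth_measurable[OF \<eta>s(1)[OF that]], of 0] by simp
    then show "(LBINT z. \<delta> \<epsilon> z) = c \<epsilon>" by (simp add: \<delta>_def)
    show "integrable lborel (\<delta> \<epsilon>)" using \<eta>s(5)[OF that] by (simp add: \<delta>_def)
  qed
  have \<delta>_lim: "((\<lambda>\<epsilon>. LBINT z. \<delta> \<epsilon> z * \<psi> z) \<longlongrightarrow> \<psi> 0) (at_right 0)"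
    if \<psi>: "smooth \<psi>" "compactly_supported \<psi>" for \<psi>
  proof -
    obtain \<rho> where "supported_in \<rho> \<psi>" using \<psi>(2) unfolding compactly_supported_iff by blast
    then obtain B where B: "\<And>z. \<bar>\<psi> z\<bar> \<le> B"
      using continuous_supported_in_bounded[OF smooth_imp_continuous[OF \<psi>(1)]] by metis
    have m: "smooth \<eta>" "supported_in 1 \<eta>" "\<And>z. 0 \<le> \<eta> z" "(LBINT z. \<eta> z) = 1"
      using \<eta> by (auto simp: mollifier_def)
    note [measurable] = smooth_measurable[OF \<psi>(1)] smooth_measurable[OF m(1)]
    have mi: "integrable lborel \<eta>"
      using integrable_supported[OF smooth_imp_continuous[OF m(1)] m(2)] by simp
    have "((\<lambda>\<epsilon>. LBINT z. \<eta> z * \<psi> (\<epsilon> *\<^sub>R z)) \<longlongrightarrow> (LBINT z. \<eta> z * \<psi> 0)) (at_right 0)"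
    proof (rule dominated_convergence_within[OF _ integrable_mult_left[OF mi, of B]])
      have "\<bar>\<eta> z * \<psi> (\<epsilon> *\<^sub>R z)\<bar> \<le> \<eta> z * B" for \<epsilon> z
        using m(3)[of z] B by (simp add: abs_mult mult_left_mono)
      moreover have "(\<lambda>z. \<eta> z * \<psi> (\<epsilon> *\<^sub>R z)) \<in> borel_measurable lborel" for \<epsilon> by measurable
      ultimately show "\<forall>\<^sub>F \<epsilon> in at_right 0. (\<lambda>z. \<eta> z * \<psi> (\<epsilon> *\<^sub>R z)) \<in> borel_measurable lborel
          \<and> (AE z in lborel. norm (\<eta> z * \<psi> (\<epsilon> *\<^sub>R z)) \<le> \<eta> z * B)"
        by (intro always_eventually) simp
      have "((\<lambda>\<epsilon>. \<psi> (\<epsilon> *\<^sub>R z)) \<longlongrightarrow> \<psi> (0 *\<^sub>R z)) (at_right 0)" for z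
        by (intro tendsto_intros continuous_on_tendsto_compose[OF smooth_imp_continuous[OF \<psi>(1), of UNIV]]) auto
      then show "AE z in lborel. ((\<lambda>\<epsilon>. \<eta> z * \<psi> (\<epsilon> *\<^sub>R z)) \<longlongrightarrow> \<eta> z * \<psi> 0) (at_right 0)"
        by (intro AE_I2 tendsto_intros) simp
    qed measurable
    then have "((\<lambda>\<epsilon>. c \<epsilon> * (LBINT z. \<eta> z * \<psi> (\<epsilon> *\<^sub>R z))) \<longlongrightarrow> 1 * \<psi> 0) (at_right 0)"
      using m(4) by (intro tendsto_mult c_lim) simp
    moreover have "\<forall>\<^sub>F \<epsilon> in at_right 0. c \<epsilon> * (LBINT z. \<eta> z * \<psi> (\<epsilon> *\<^sub>R z)) = (LBINT z. \<delta> \<epsilon> z * \<psi> z)"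
      using eventually_at_right_less[of 0]
    proof eventually_elim
      case (elim \<epsilon>)
      have "(LBINT z. \<delta> \<epsilon> z * \<psi> z) = c \<epsilon> * (LBINT z. \<eta>s \<epsilon> z * \<psi> z)"
        by (simp add: \<delta>_def mult.assoc)
      then show ?case using \<eta>s(4)[OF elim smooth_measurable[OF \<psi>(1)]] by simp
    qed
    ultimately show ?thesis using Lim_transform_eventually by fastforce
  qed
  have "admissible_regularization \<Omega> chi \<delta>"
    unfolding admissible_regularization_def
  proof (intro conjI allI impI)
    fix \<epsilon> :: real assume \<epsilon>: "\<epsilon> > 0"
    show "smooth (chi \<epsilon>)" "smooth (\<delta> \<epsilon>)" using \<epsilon> chi_smooth \<delta>_smooth by auto
    show "compactly_supported (chi \<epsilon>)" "compactly_supported (\<delta> \<epsilon>)"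
      unfolding compactly_supported_iff using chi_supp[OF \<epsilon>] \<delta>_supp[OF \<epsilon>] by blast+
    show "(LBINT z. area \<Omega> * \<delta> \<epsilon> z - chi \<epsilon> z) = 0"
      using \<delta>_integral[OF \<epsilon>] chi_integrable[OF \<epsilon>] A by (simp add: c_def)
  next
    fix \<psi> :: "complex \<Rightarrow> real" assume \<psi>: "smooth \<psi> \<and> compactly_supported \<psi>"
    then obtain \<rho> where "supported_in \<rho> \<psi>" unfolding compactly_supported_iff by blast
    then have "integrable lborel \<psi>"
      using integrable_supported[OF smooth_imp_continuous, of \<psi> \<rho>] \<psi> by simp
    then have "integrable lborel (\<lambda>z. \<bar>\<psi> z\<bar>)" by simp
    from chi_test[OF smooth_measurable this] \<psi>
    show "((\<lambda>\<epsilon>. LBINT z. chi \<epsilon> z * \<psi> z) \<longlongrightarrow> (\<integral>z\<in>\<Omega>. \<psi> z \<partial>lborel)) (at_right 0)"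
      by (simp add: set_lebesgue_integral_def indicator_def)
    show "((\<lambda>\<epsilon>. LBINT z. \<delta> \<epsilon> z * \<psi> z) \<longlongrightarrow> \<psi> 0) (at_right 0)" using \<delta>_lim \<psi> by blast
  next
    have "\<forall>\<^sub>F \<epsilon>::real in at_right 0. \<epsilon> \<in> {0<..<1}" by (rule eventually_at_right_real) simp
    then have "\<forall>\<^sub>F \<epsilon> in at_right 0. (\<forall>z. cmod z > max R 1 \<longrightarrow> chi \<epsilon> z = 0 \<and> \<delta> \<epsilon> z = 0) \<and>
        (\<forall>z. \<bar>chi \<epsilon> z\<bar> \<le> 1) \<and> (LBINT z. \<bar>\<delta> \<epsilon> z\<bar>) \<le> 1"
    proof eventually_elim
      case (elim \<epsilon>)
      then have \<epsilon>: "\<epsilon> > 0" "\<epsilon> < 1" by auto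
      have "\<bar>\<delta> \<epsilon> z\<bar> = \<delta> \<epsilon> z" for z using c_bd[OF \<epsilon>(1)] \<eta>s(3)[OF \<epsilon>(1)] by (simp add: \<delta>_def)
      then have "(LBINT z. \<bar>\<delta> \<epsilon> z\<bar>) \<le> 1" using \<delta>_integral(1)[OF \<epsilon>(1)] c_bd[OF \<epsilon>(1)] by simp
      then show ?case
        using chi_supp[OF \<epsilon>(1)] \<delta>_supp[OF \<epsilon>(1)] chi_ge[OF \<epsilon>(1)] chi_le[OF \<epsilon>(1)] \<epsilon>
        by (auto simp: supported_in_def)
    qed
    then show "\<exists>R M. \<forall>\<^sub>F \<epsilon> in at_right 0. (\<forall>z. cmod z > R \<longrightarrow> chi \<epsilon> z = 0 \<and> \<delta> \<epsilon> z = 0) \<and>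
        (\<forall>z. \<bar>chi \<epsilon> z\<bar> \<le> M) \<and> (LBINT z. \<bar>\<delta> \<epsilon> z\<bar>) \<le> M" by blast
  qed
  then show ?thesis by blast
qed

section \<open>The regularized partition function\<close>

lemma locally_integrable_abs: "locally_integrable k \<Longrightarrow> locally_integrable (\<lambda>u. \<bar>k u\<bar>)"
  using integrable_abs[of lborel "\<lambda>x. indicat_real (cball 0 _) x *\<^sub>R k x"]
  unfolding locally_integrable_def set_integrable_def
  by (auto simp: abs_mult intro: borel_measurable_abs)

lemma log_kernel_integrable:
  assumes b: "b \<in> borel_measurable borel" "supported_in R b" "\<And>w. \<bar>b w\<bar> \<le> M"
  shows "integrable lborel (\<lambda>w. ln (cmod (z - w)) * b w)"
proof -
  note [measurable] = b(1)
  have "integrable lborel (\<lambda>u. ln (cmod u) * b (z - u))"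
    by (intro locally_integrable_mult[OF locally_integrable_ln _ b(3) supported_in_reflect[OF b(2)]]) measurable
  from lborel_integrable_affine[OF _ this, of "-1" z] show ?thesis by simp
qed

lemma log_kernel_bound:
  assumes b: "b \<in> borel_measurable borel" "supported_in R b" "\<And>w. \<bar>b w\<bar> \<le> M" and z: "cmod z \<le> R"
  shows "(LBINT w. \<bar>ln (cmod (z - w)) * b w\<bar>)
    \<le> M * (LBINT u. indicat_real (cball 0 (2 * R)) u * \<bar>ln (cmod u)\<bar>)"
proof -
  have M: "M \<ge> 0" using b(3)[of 0] by linarith
  note [measurable] = b(1)
  have "(\<lambda>u. \<bar>ln (cmod u) * b (z - u)\<bar>) \<in> borel_measurable borel" by measurable
  from lborel_integral_reflect[OF this, of z]
  have "(LBINT w. \<bar>ln (cmod (z - w)) * b w\<bar>) = (LBINT u. \<bar>ln (cmod u) * b (z - u)\<bar>)" by simp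
  also have "\<dots> \<le> (LBINT u. M * (indicat_real (cball 0 (2 * R)) u * \<bar>ln (cmod u)\<bar>))"
  proof (rule integral_mono)
    show "integrable lborel (\<lambda>u. \<bar>ln (cmod u) * b (z - u)\<bar>)"
      by (intro integrable_abs locally_integrable_mult[OF locally_integrable_ln _ b(3) supported_in_reflect[OF b(2)]]) measurable
    show "integrable lborel (\<lambda>u::complex. M * (indicat_real (cball 0 (2 * R)) u * \<bar>ln (cmod u)\<bar>))"
      by (intro integrable_mult_right integrable_indicator_mult locally_integrable_abs locally_integrable_ln)
    fix u
    show "\<bar>ln (cmod u) * b (z - u)\<bar> \<le> M * (indicat_real (cball 0 (2 * R)) u * \<bar>ln (cmod u)\<bar>)"
    proof (cases "cmod u \<le> 2 * R")
      case True
      have "\<bar>b (z - u)\<bar> * \<bar>ln (cmod u)\<bar> \<le> M * \<bar>ln (cmod u)\<bar>" by (intro mult_right_mono b) simp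
      then show ?thesis using True by (simp add: abs_mult mult.commute)
    next
      case False
      then have "R < cmod (z - u)" using z norm_triangle_ineq2[of u z] by (simp add: norm_minus_commute)
      then show ?thesis using b(2) M by (simp add: supported_in_def)
    qed
  qed
  also have "\<dots> = M * (LBINT u. indicat_real (cball 0 (2 * R)) u * \<bar>ln (cmod u)\<bar>)"
    by (rule integral_mult_right_zero)
  finally show ?thesis .
qed

lemma ln_kernel_measurable:
  "(\<lambda>x::complex \<times> complex. ln (cmod (fst x - snd x))) \<in> borel_measurable (lborel \<Otimes>\<^sub>M lborel)"
proof -
  have "continuous_on UNIV (\<lambda>x::complex \<times> complex. fst x - snd x)"
    by (rule continuous_on_diff[OF continuous_on_fst[OF continuous_on_id] continuous_on_snd[OF continuous_on_id]])
  then have "(\<lambda>x::complex \<times> complex. fst x - snd x) \<in> borel_measurable borel"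
    by (rule borel_measurable_continuous_onI)
  then have "(\<lambda>x::complex \<times> complex. fst x - snd x) \<in> borel_measurable (lborel \<Otimes>\<^sub>M lborel)"
    unfolding lborel_prod measurable_lborel2 .
  from measurable_compose[OF this ln_cmod_measurable] show ?thesis .
qed

text \<open>Fubini's theorem, since the kernel is symmetric.\<close>

lemma log_energy_commute:
  assumes a: "integrable lborel a" "supported_in R a" and b: "b \<in> borel_measurable borel" "supported_in R b" "\<And>w. \<bar>b w\<bar> \<le> M"
  shows "log_energy a b = log_energy b a"
proof -
  have M: "M \<ge> 0" using b(3)[of 0] by linarith
  have am: "a \<in> borel_measurable borel" using a(1) by auto
  let ?C = "M * (LBINT u. indicat_real (cball 0 (2 * R)) u * \<bar>ln (cmod u)\<bar>)"
  have pair: "integrable (lborel \<Otimes>\<^sub>M lborel) (\<lambda>(z, w). ln (cmod (z - w)) * a z * b w)"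
  proof (rule integrable_pairI[where B = "\<lambda>z. \<bar>a z\<bar> * ?C"])
    show "(\<lambda>(z, w). ln (cmod (z - w)) * a z * b w) \<in> borel_measurable (lborel \<Otimes>\<^sub>M lborel)"
    proof -
      have "(\<lambda>x. a (fst x)) \<in> borel_measurable (lborel \<Otimes>\<^sub>M lborel)"
        using am by (intro measurable_compose[OF measurable_fst]) simp
      moreover have "(\<lambda>x. b (snd x)) \<in> borel_measurable (lborel \<Otimes>\<^sub>M lborel)"
        using b(1) by (intro measurable_compose[OF measurable_snd]) simp
      ultimately show ?thesis
        unfolding case_prod_beta' by (intro borel_measurable_times ln_kernel_measurable)
    qed
    have eq: "ln (cmod (z - w)) * a z * b w = a z * (ln (cmod (z - w)) * b w)" for z w by simp
    show "AE z in lborel. integrable lborel (\<lambda>w. ln (cmod (z - w)) * a z * b w)"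
      unfolding eq by (rule AE_I2, rule integrable_mult_right, rule log_kernel_integrable[OF b])
    show "AE z in lborel. (LBINT w. \<bar>ln (cmod (z - w)) * a z * b w\<bar>) \<le> \<bar>a z\<bar> * ?C"
    proof (rule AE_I2)
      fix z
      have "(LBINT w. \<bar>ln (cmod (z - w)) * a z * b w\<bar>) = \<bar>a z\<bar> * (LBINT w. \<bar>ln (cmod (z - w)) * b w\<bar>)"
        unfolding eq abs_mult[of "a z"] by (rule integral_mult_right_zero)
      also have "\<dots> \<le> \<bar>a z\<bar> * ?C"
      proof (cases "cmod z \<le> R")
        case True
        then show ?thesis by (intro mult_left_mono log_kernel_bound[OF b]) auto
      next
        case False
        then show ?thesis using a(2) by (simp add: supported_in_def)
      qed
      finally show "(LBINT w. \<bar>ln (cmod (z - w)) * a z * b w\<bar>) \<le> \<bar>a z\<bar> * ?C" .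
    qed
    show "integrable lborel (\<lambda>z. \<bar>a z\<bar> * ?C)" using a(1) by (intro integrable_mult_left integrable_abs)
  qed
  have "log_energy a b = (LBINT w. (LBINT z. ln (cmod (z - w)) * a z * b w))"
    unfolding log_energy_def by (rule lborel_pair.Fubini_integral[OF pair, symmetric])
  also have "\<dots> = log_energy b a"
    unfolding log_energy_def by (simp add: norm_minus_commute mult_ac)
  finally show ?thesis .
qed

lemma log_energy_diff:
  assumes s: "smooth chi" "smooth \<delta>" and supp: "supported_in R chi" "supported_in R \<delta>"
  shows "log_energy (\<lambda>z. A * \<delta> z - chi z) (\<lambda>z. A * \<delta> z - chi z)
    = A\<^sup>2 * log_energy \<delta> \<delta> - 2 * A * log_energy \<delta> chi + log_energy chi chi"
proof -
  have c: "continuous_on UNIV chi" "continuous_on UNIV \<delta>"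
    using s smooth_imp_continuous by blast+
  obtain B1 where B1: "\<And>z. \<bar>chi z\<bar> \<le> B1" using continuous_supported_in_bounded[OF c(1) supp(1)] by metis
  obtain B2 where B2: "\<And>z. \<bar>\<delta> z\<bar> \<le> B2" using continuous_supported_in_bounded[OF c(2) supp(2)] by metis
  have m: "chi \<in> borel_measurable borel" "\<delta> \<in> borel_measurable borel"
    using s smooth_measurable by blast+
  have di: "integrable lborel \<delta>" using integrable_supported[OF c(2) supp(2)] by simp
  have pot: "log_potential (\<lambda>z. A * \<delta> z - chi z) z = A * log_potential \<delta> z - log_potential chi z" for z
  proof -
    have "log_potential (\<lambda>z. A * \<delta> z - chi z) z
        = (LBINT w. A * (ln (cmod (z - w)) * \<delta> w) - ln (cmod (z - w)) * chi w)"
      unfolding log_potential_def by (intro Bochner_Integration.integral_cong) (auto simp: algebra_simps)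
    also have "\<dots> = A * log_potential \<delta> z - log_potential chi z"
      using log_kernel_integrable[OF m(2) supp(2) B2, of z] log_kernel_integrable[OF m(1) supp(1) B1, of z]
      by (simp add: log_potential_def)
    finally show ?thesis .
  qed
  have pc: "continuous_on UNIV (log_potential chi)" "continuous_on UNIV (log_potential \<delta>)"
    using s supp by (auto intro!: smooth_imp_continuous smooth_log_potential)
  have i: "integrable lborel (\<lambda>z. \<delta> z * log_potential \<delta> z)" "integrable lborel (\<lambda>z. \<delta> z * log_potential chi z)"
    "integrable lborel (\<lambda>z. chi z * log_potential \<delta> z)" "integrable lborel (\<lambda>z. chi z * log_potential chi z)"
    by (intro integrable_mult_supported[OF c(2) supp(2)] integrable_mult_supported[OF c(1) supp(1)] pc)+
  have "log_energy (\<lambda>z. A * \<delta> z - chi z) (\<lambda>z. A * \<delta> z - chi z)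
      = (LBINT z. A\<^sup>2 * (\<delta> z * log_potential \<delta> z) - A * (\<delta> z * log_potential chi z)
          - A * (chi z * log_potential \<delta> z) + chi z * log_potential chi z)"
    unfolding log_energy_eq pot
    by (intro Bochner_Integration.integral_cong) (auto simp: algebra_simps power2_eq_square)
  also have "\<dots> = A\<^sup>2 * log_energy \<delta> \<delta> - A * log_energy \<delta> chi - A * log_energy chi \<delta> + log_energy chi chi"
    unfolding log_energy_eq using i by simp
  also have "log_energy chi \<delta> = log_energy \<delta> chi"
    by (rule log_energy_commute[OF di supp(2) m(1) supp(1) B1, symmetric])
  finally show ?thesis by simp
qed

text \<open>The divergent self-energy of \<open>\<delta>\<close> occurs in the critical value of the action with the coefficient that
  the renormalizing prefactor cancels.\<close>

lemma partition_reg_eq: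
  assumes s: "smooth chi" "smooth \<delta>" and supp: "supported_in R chi" "supported_in R \<delta>"
    and neutral: "(LBINT z. area \<Omega> * \<delta> z - chi z) = 0"
  shows "\<exists>!\<Phi>. critical_point (S_reg \<Omega> chi \<delta>) \<Phi> \<and> \<Phi> None = 0"
    and "partition_reg \<rho> \<Omega> chi \<delta>
      = partition_0 \<rho> * exp (- (1 / pi\<^sup>2) * (log_energy chi chi - 2 * area \<Omega> * log_energy \<delta> chi))"
proof -
  let ?q = "\<lambda>z. area \<Omega> * \<delta> z - chi z"
  have q: "smooth ?q" "supported_in R ?q"
    using s supp unfolding smooth_eq_smooth_on
    by (auto intro!: smooth_on_diff smooth_on_cmult simp: supported_in_def)
  show "\<exists>!\<Phi>. critical_point (S_reg \<Omega> chi \<delta>) \<Phi> \<and> \<Phi> None = 0"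
    by (rule ex1_normalized_critical_point[OF q neutral])
  have "partition_reg \<rho> \<Omega> chi \<delta> = exp ((area \<Omega>)\<^sup>2 / pi\<^sup>2 * log_energy \<delta> \<delta>) *
      (partition_0 \<rho> * exp (- (1 / pi) * ((1 / pi) * log_energy ?q ?q)))"
    unfolding partition_reg_def gaussian_integral_def ex1_normalized_critical_point(2)[OF q neutral]
      action_at_green_potential[OF q neutral] log_energy_def[of \<delta> \<delta>] ..
  also have "\<dots> = partition_0 \<rho> * exp ((area \<Omega>)\<^sup>2 / pi\<^sup>2 * log_energy \<delta> \<delta> - (1 / pi\<^sup>2) * log_energy ?q ?q)"
    by (simp add: exp_diff exp_minus divide_inverse power2_eq_square mult_ac)
  also have "(area \<Omega>)\<^sup>2 / pi\<^sup>2 * log_energy \<delta> \<delta> - (1 / pi\<^sup>2) * log_energy ?q ?q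
      = - (1 / pi\<^sup>2) * (log_energy chi chi - 2 * area \<Omega> * log_energy \<delta> chi)"
    unfolding log_energy_diff[OF s supp] by (simp add: algebra_simps)
  finally show "partition_reg \<rho> \<Omega> chi \<delta>
      = partition_0 \<rho> * exp (- (1 / pi\<^sup>2) * (log_energy chi chi - 2 * area \<Omega> * log_energy \<delta> chi))" .
qed

lemma log_potential_measurable_bounded:
  assumes b: "b \<in> borel_measurable borel" "supported_in R b" "\<And>w. \<bar>b w\<bar> \<le> M"
  shows "log_potential b \<in> borel_measurable borel"
    and "cmod z \<le> R \<Longrightarrow> \<bar>log_potential b z\<bar> \<le> M * (LBINT u. indicat_real (cball 0 (2 * R)) u * \<bar>ln (cmod u)\<bar>)"
proof -
  note [measurable] = b(1) ln_kernel_measurable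
  have "(\<lambda>z. LBINT w. ln (cmod (z - w)) * b w) \<in> borel_measurable lborel"
    by (intro lborel.borel_measurable_lebesgue_integral) (unfold case_prod_beta', measurable)
  then show "log_potential b \<in> borel_measurable borel" by (simp add: log_potential_def[abs_def])
  show "\<bar>log_potential b z\<bar> \<le> M * (LBINT u. indicat_real (cball 0 (2 * R)) u * \<bar>ln (cmod u)\<bar>)" if "cmod z \<le> R"
    unfolding log_potential_def
    by (rule order_trans[OF integral_abs_bound log_kernel_bound[OF b that]])
qed

lemma indicator_open_bounded:
  fixes \<Omega> :: "complex set"
  assumes \<Omega>: "open \<Omega>" and R: "\<And>z. z \<in> \<Omega> \<Longrightarrow> cmod z \<le> R"
  shows "indicat_real \<Omega> \<in> borel_measurable borel" "supported_in R (indicat_real \<Omega>)"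
    "\<bar>indicat_real \<Omega> w\<bar> \<le> 1" "integrable lborel (indicat_real \<Omega>)" "(LBINT z. indicat_real \<Omega> z) = area \<Omega>"
proof -
  show "indicat_real \<Omega> \<in> borel_measurable borel" using \<Omega> by (intro borel_measurable_indicator borel_open)
  show "supported_in R (indicat_real \<Omega>)" using R by (force simp: supported_in_def indicator_def)
  have "bounded \<Omega>" using R unfolding bounded_iff by blast
  then show "integrable lborel (indicat_real \<Omega>)"
    using \<Omega> by (auto intro!: integrable_real_indicator emeasure_bounded_finite simp: borel_open)
  show "(LBINT z. indicat_real \<Omega> z) = area \<Omega>" using \<Omega> by (simp add: borel_open)
qed (auto simp: indicator_def)

lemma integrable_log_potential_indicator:
  fixes \<Omega> :: "complex set"
  assumes \<Omega>: "open \<Omega>" and R: "\<And>z. z \<in> \<Omega> \<Longrightarrow> cmod z \<le> R"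
  shows "integrable lborel (\<lambda>z. indicat_real \<Omega> z * log_potential (indicat_real \<Omega>) z)"
proof (rule Bochner_Integration.integrable_bound)
  note ind = indicator_open_bounded[OF \<Omega> R]
  let ?C = "1 * (LBINT u. indicat_real (cball 0 (2 * R)) u * \<bar>ln (cmod u)\<bar>)"
  show "integrable lborel (\<lambda>z. indicat_real \<Omega> z * ?C)" using ind(4) by (rule integrable_mult_left)
  show "(\<lambda>z. indicat_real \<Omega> z * log_potential (indicat_real \<Omega>) z) \<in> borel_measurable lborel"
    using log_potential_measurable_bounded(1)[OF ind(1-3)] ind(1) by (intro borel_measurable_times) auto
  show "AE z in lborel. norm (indicat_real \<Omega> z * log_potential (indicat_real \<Omega>) z) \<le> norm (indicat_real \<Omega> z * ?C)"
  proof (rule AE_I2)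
    fix z
    show "norm (indicat_real \<Omega> z * log_potential (indicat_real \<Omega>) z) \<le> norm (indicat_real \<Omega> z * ?C)"
      using log_potential_measurable_bounded(2)[OF ind(1-3), of z] R[of z] by (cases "z \<in> \<Omega>") auto
  qed
qed

lemma log_energy_regularization_tendsto:
  assumes \<Omega>: "open \<Omega>" "bounded \<Omega>" and adm: "admissible_regularization \<Omega> chi \<delta>"
  defines "p \<equiv> log_potential (indicat_real \<Omega>)"
  shows "((\<lambda>\<epsilon>. log_energy (chi \<epsilon>) (chi \<epsilon>)) \<longlongrightarrow> (\<integral>z\<in>\<Omega>. p z \<partial>lborel)) (at_right 0)"
    and "((\<lambda>\<epsilon>. log_energy (\<delta> \<epsilon>) (chi \<epsilon>)) \<longlongrightarrow> p 0) (at_right 0)"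
proof -
  note adm' = adm[unfolded admissible_regularization_def]
  have smooth: "smooth (chi \<epsilon>)" "smooth (\<delta> \<epsilon>)" if "\<epsilon> > 0" for \<epsilon> using adm' that by auto
  have chi_lim: "((\<lambda>\<epsilon>. LBINT z. chi \<epsilon> z * \<psi> z) \<longlongrightarrow> (\<integral>z\<in>\<Omega>. \<psi> z \<partial>lborel)) (at_right 0)"
    and \<delta>_lim: "((\<lambda>\<epsilon>. LBINT z. \<delta> \<epsilon> z * \<psi> z) \<longlongrightarrow> \<psi> 0) (at_right 0)"
    if "smooth \<psi>" "compactly_supported \<psi>" for \<psi> using adm' that by auto
  obtain R0 M0 where ev: "\<forall>\<^sub>F \<epsilon> in at_right 0. (\<forall>z. cmod z > R0 \<longrightarrow> chi \<epsilon> z = 0 \<and> \<delta> \<epsilon> z = 0) \<and>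
        (\<forall>z. \<bar>chi \<epsilon> z\<bar> \<le> M0) \<and> (LBINT z. \<bar>\<delta> \<epsilon> z\<bar>) \<le> M0" using adm' by blast
  obtain R1 where R1: "\<And>z. z \<in> \<Omega> \<Longrightarrow> cmod z \<le> R1" using \<Omega>(2) unfolding bounded_iff by blast
  define R where "R = max 0 (max R0 R1)"
  have R: "R \<ge> 0" "R0 \<le> R" "R1 \<le> R" by (auto simp: R_def)
  \<comment> \<open>\<open>N\<close> bounds the \<open>L\<^sup>1\<close> norm of \<open>chi \<epsilon>\<close>; \<open>M\<close> and \<open>M'\<close> are common bounds for the cases below.\<close>
  define N where "N = \<bar>M0\<bar> * (pi * R\<^sup>2)"
  define M where "M = \<bar>M0\<bar> + N"
  define M' where "M' = N + area \<Omega>"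
  have N0: "0 \<le> N" by (simp add: N_def)
  have chi_L1: "(LBINT z. \<bar>chi \<epsilon> z\<bar>) \<le> N"
    if "\<epsilon> > 0" "supported_in R (chi \<epsilon>)" "\<And>z. \<bar>chi \<epsilon> z\<bar> \<le> M0" for \<epsilon>
  proof -
    have "(LBINT z. \<bar>chi \<epsilon> z\<bar>) \<le> (LBINT z. \<bar>M0\<bar> * indicat_real (cball (0::complex) R) z)"
    proof (rule integral_mono)
      show "integrable lborel (\<lambda>z. \<bar>chi \<epsilon> z\<bar>)"
        using integrable_supported[OF smooth_imp_continuous[OF smooth(1)[OF that(1)]] that(2)] by simp
      show "integrable lborel (\<lambda>z. \<bar>M0\<bar> * indicat_real (cball (0::complex) R) z)"
        using R(1) by (intro integrable_mult_right integrable_real_indicator) (simp_all add: emeasure_cball_complex)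
      show "\<bar>chi \<epsilon> z\<bar> \<le> \<bar>M0\<bar> * indicat_real (cball 0 R) z" for z
        using that(2) that(3)[of z] by (cases "cmod z \<le> R") (auto simp: supported_in_def)
    qed
    also have "\<dots> = N" using R(1) by (simp add: N_def measure_def emeasure_cball_complex)
    finally show ?thesis .
  qed
  have pos: "\<forall>\<^sub>F \<epsilon>::real in at_right 0. \<epsilon> > 0" by (rule eventually_at_right_less)
  have ev_chi: "\<forall>\<^sub>F \<epsilon> in at_right 0. supported_in R (chi \<epsilon>) \<and> (\<forall>z. \<bar>chi \<epsilon> z\<bar> \<le> M0) \<and> (LBINT z. \<bar>chi \<epsilon> z\<bar>) \<le> N"
    using ev pos
  proof eventually_elim
    case (elim \<epsilon>)
    then have s: "supported_in R (chi \<epsilon>)" using R(2) by (auto simp: supported_in_def)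
    then show ?case using elim chi_L1 by auto
  qed
  have b: "\<forall>\<^sub>F \<epsilon> in at_right 0. supported_in R (chi \<epsilon>) \<and> (\<forall>z. \<bar>chi \<epsilon> z\<bar> \<le> M) \<and> (LBINT z. \<bar>chi \<epsilon> z\<bar>) \<le> M'"
    using ev_chi
  proof eventually_elim
    case (elim \<epsilon>)
    have "M0 \<le> M" using N0 by (simp add: M_def)
    moreover have "N \<le> M'" by (simp add: M'_def)
    ultimately show ?case using elim order_trans by blast
  qed
  have a1: "\<forall>\<^sub>F \<epsilon> in at_right 0. supported_in R (chi \<epsilon>) \<and> (LBINT z. \<bar>chi \<epsilon> z\<bar>) \<le> M"
    using ev_chi by eventually_elim (auto simp: M_def)
  have a2: "\<forall>\<^sub>F \<epsilon> in at_right 0. supported_in R (\<delta> \<epsilon>) \<and> (LBINT z. \<bar>\<delta> \<epsilon> z\<bar>) \<le> M"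
    using ev by eventually_elim (use R(2) N0 in \<open>auto simp: supported_in_def M_def\<close>)
  have R\<Omega>: "cmod z \<le> R" if "z \<in> \<Omega>" for z using R1[OF that] R(3) by linarith
  note ind = indicator_open_bounded[OF \<Omega>(1) R\<Omega>]
  have "(LBINT z. \<bar>indicat_real \<Omega> z\<bar>) \<le> M'" using N0 ind(5) by (simp add: M'_def)
  note \<beta> = ind(1-4) this
  have b_lim: "((\<lambda>\<epsilon>. LBINT z. chi \<epsilon> z * \<psi> z) \<longlongrightarrow> (LBINT z. indicat_real \<Omega> z * \<psi> z)) (at_right 0)"
    if "smooth \<psi>" "compactly_supported \<psi>" for \<psi>
    using chi_lim[OF that] by (simp add: set_lebesgue_integral_def)
  have p_int: "integrable lborel (\<lambda>z. indicat_real \<Omega> z * p z)"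
    unfolding p_def by (rule integrable_log_potential_indicator[OF \<Omega>(1) R\<Omega>])
  show "((\<lambda>\<epsilon>. log_energy (\<delta> \<epsilon>) (chi \<epsilon>)) \<longlongrightarrow> p 0) (at_right 0)"
  proof (rule log_energy_tendsto[OF R(1) _ a2 b \<beta> \<delta>_lim b_lim, where A = 1])
    show "\<bar>\<psi> 0 - p 0\<bar> \<le> 1 * e" if "\<And>z. cmod z \<le> R \<Longrightarrow> \<bar>\<psi> z - log_potential (indicat_real \<Omega>) z\<bar> \<le> e" for \<psi> e
      using that[of 0] R(1) by (simp add: p_def)
  qed (use smooth in auto)
  show "((\<lambda>\<epsilon>. log_energy (chi \<epsilon>) (chi \<epsilon>)) \<longlongrightarrow> (\<integral>z\<in>\<Omega>. p z \<partial>lborel)) (at_right 0)"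
  proof (rule log_energy_tendsto[OF R(1) _ a1 b \<beta> chi_lim b_lim, where A = "area \<Omega>"])
    fix \<psi> e assume \<psi>: "smooth \<psi>" "compactly_supported \<psi>"
      and close: "\<And>z. cmod z \<le> R \<Longrightarrow> \<bar>\<psi> z - log_potential (indicat_real \<Omega>) z\<bar> \<le> e"
    have \<psi>_int: "integrable lborel (\<lambda>z. indicat_real \<Omega> z * \<psi> z)"
    proof -
      have "locally_integrable \<psi>" by (rule locally_integrable_smooth[OF \<psi>(1)])
      from locally_integrable_mult[OF this \<beta>(1,3,2)] show ?thesis by (simp add: mult.commute)
    qed
    have "(\<integral>z\<in>\<Omega>. \<psi> z \<partial>lborel) - (\<integral>z\<in>\<Omega>. p z \<partial>lborel)
        = (LBINT z. indicat_real \<Omega> z * \<psi> z - indicat_real \<Omega> z * p z)"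
      unfolding set_lebesgue_integral_def using \<psi>_int p_int by simp
    also have "\<bar>\<dots>\<bar> \<le> (LBINT z. \<bar>indicat_real \<Omega> z * \<psi> z - indicat_real \<Omega> z * p z\<bar>)" by (rule integral_abs_bound)
    also have "\<dots> \<le> (LBINT z. indicat_real \<Omega> z * e)"
    proof (rule integral_mono)
      show "\<bar>indicat_real \<Omega> z * \<psi> z - indicat_real \<Omega> z * p z\<bar> \<le> indicat_real \<Omega> z * e" for z
      proof (cases "z \<in> \<Omega>")
        case True
        then have "cmod z \<le> R" using R1 R(3) by force
        from close[OF this] show ?thesis using True by (simp add: p_def)
      qed simp
    qed (use \<psi>_int p_int \<beta>(4) in auto)
    also have "\<dots> = area \<Omega> * e" using \<Omega>(1) by (simp add: borel_open)
    finally show "\<bar>(\<integral>z\<in>\<Omega>. \<psi> z \<partial>lborel) - (\<integral>z\<in>\<Omega>. p z \<partial>lborel)\<bar> \<le> area \<Omega> * e" .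
  qed (use smooth in auto)
qed

section \<open>The tau-function of a curve\<close>

text \<open>By periodicity the curve is the image of the unit interval.\<close>

lemma smooth_jordan_curve_compact:
  assumes "smooth_jordan_curve C"
  shows "compact C"
proof -
  obtain \<gamma> :: "real \<Rightarrow> complex" where \<gamma>: "smooth \<gamma>" "\<And>t. \<gamma> (t + 1) = \<gamma> t" "C = range \<gamma>"
    using assms unfolding smooth_jordan_curve_def by blast
  have nat_shift: "\<gamma> (t + real n) = \<gamma> t" for t n
  proof (induction n)
    case (Suc n)
    have "\<gamma> (t + real (Suc n)) = \<gamma> ((t + real n) + 1)" by (simp add: add_ac)
    then show ?case using \<gamma>(2) Suc by simp
  qed simp
  have "\<gamma> t \<in> \<gamma> ` {0..1}" for t
  proof -
    have "\<gamma> t = \<gamma> (frac t)"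
    proof (cases "\<lfloor>t\<rfloor> \<ge> 0")
      case True
      then have "t = frac t + real (nat \<lfloor>t\<rfloor>)" by (simp add: frac_def)
      then show ?thesis using nat_shift by metis
    next
      case False
      then have "frac t = t + real (nat (- \<lfloor>t\<rfloor>))" by (simp add: frac_def)
      then show ?thesis using nat_shift by metis
    qed
    moreover have "frac t \<in> {0..1}" using frac_ge_0[of t] frac_lt_1[of t] by simp
    ultimately show ?thesis by blast
  qed
  then have "C = \<gamma> ` {0..1}" using \<gamma>(3) by auto
  then show ?thesis
    using compact_continuous_image[OF smooth_imp_continuous[OF \<gamma>(1)], of "{0..1}"] by simp
qed

text \<open>Every choice of metric and regularization leads to the same value; that there is a choice at all gives
  uniqueness.\<close>

lemma is_tau_iff:
  assumes \<Omega>: "open (inside C)" "bounded (inside C)" "0 \<in> inside C"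
  defines "p \<equiv> log_potential (indicat_real (inside C))"
  shows "is_tau C t \<longleftrightarrow>
    t = exp (- (1 / pi\<^sup>2) * ((\<integral>z\<in>inside C. p z \<partial>lborel) - 2 * area (inside C) * p 0))"
proof -
  let ?\<Omega> = "inside C"
  let ?T = "exp (- (1 / pi\<^sup>2) * ((\<integral>z\<in>?\<Omega>. p z \<partial>lborel) - 2 * area ?\<Omega> * p 0))"
  have reg: "(\<exists>!\<Phi>. critical_point (S_reg ?\<Omega> (chi \<epsilon>) (\<delta> \<epsilon>)) \<Phi> \<and> \<Phi> None = 0) \<and>
      partition_reg \<rho> ?\<Omega> (chi \<epsilon>) (\<delta> \<epsilon>) = partition_0 \<rho> *
        exp (- (1 / pi\<^sup>2) * (log_energy (chi \<epsilon>) (chi \<epsilon>) - 2 * area ?\<Omega> * log_energy (\<delta> \<epsilon>) (chi \<epsilon>)))"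
    if adm: "admissible_regularization ?\<Omega> chi \<delta>" and \<epsilon>: "\<epsilon> > 0" for chi \<delta> \<epsilon> \<rho>
  proof -
    have s: "smooth (chi \<epsilon>)" "smooth (\<delta> \<epsilon>)" "compactly_supported (chi \<epsilon>)" "compactly_supported (\<delta> \<epsilon>)"
      and neutral: "(LBINT z. area ?\<Omega> * \<delta> \<epsilon> z - chi \<epsilon> z) = 0"
      using adm \<epsilon> unfolding admissible_regularization_def by auto
    obtain R1 R2 where "supported_in R1 (chi \<epsilon>)" "supported_in R2 (\<delta> \<epsilon>)"
      using s(3,4) unfolding compactly_supported_iff by blast
    then have "supported_in (max R1 R2) (chi \<epsilon>)" "supported_in (max R1 R2) (\<delta> \<epsilon>)"
      by (auto simp: supported_in_def)
    from partition_reg_eq[OF s(1,2) this neutral] show ?thesis by blast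
  qed
  have lim: "((\<lambda>\<epsilon>. partition_reg \<rho> ?\<Omega> (chi \<epsilon>) (\<delta> \<epsilon>)) \<longlongrightarrow> partition_0 \<rho> * ?T) (at_right 0)"
    if adm: "admissible_regularization ?\<Omega> chi \<delta>" for chi \<delta> \<rho>
  proof (rule Lim_transform_eventually)
    show "((\<lambda>\<epsilon>. partition_0 \<rho> * exp (- (1 / pi\<^sup>2) *
        (log_energy (chi \<epsilon>) (chi \<epsilon>) - 2 * area ?\<Omega> * log_energy (\<delta> \<epsilon>) (chi \<epsilon>)))) \<longlongrightarrow> partition_0 \<rho> * ?T) (at_right 0)"
      unfolding p_def by (intro tendsto_intros log_energy_regularization_tendsto[OF \<Omega>(1,2) adm])
    show "\<forall>\<^sub>F \<epsilon> in at_right 0. partition_0 \<rho> * exp (- (1 / pi\<^sup>2) *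
        (log_energy (chi \<epsilon>) (chi \<epsilon>) - 2 * area ?\<Omega> * log_energy (\<delta> \<epsilon>) (chi \<epsilon>)))
        = partition_reg \<rho> ?\<Omega> (chi \<epsilon>) (\<delta> \<epsilon>)"
      using eventually_at_right_less[of 0] by eventually_elim (use reg[OF adm] in simp)
  qed
  show ?thesis
  proof
    assume tau: "is_tau C t"
    obtain \<rho> where \<rho>: "conformal_metric \<rho>" using conformal_metric_exists by blast
    obtain chi \<delta> where adm: "admissible_regularization ?\<Omega> chi \<delta>"
      using admissible_regularization_exists[OF \<Omega>] by blast
    obtain Z where Z: "((\<lambda>\<epsilon>. partition_reg \<rho> ?\<Omega> (chi \<epsilon>) (\<delta> \<epsilon>)) \<longlongrightarrow> Z) (at_right 0)" "t = Z / partition_0 \<rho>"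
      using tau \<rho> adm unfolding is_tau_def by blast
    have "Z = partition_0 \<rho> * ?T"
      by (rule tendsto_unique[OF trivial_limit_at_right_real Z(1) lim[OF adm]])
    then show "t = ?T" using Z(2) partition_0_pos[OF \<rho>] by simp
  next
    assume t: "t = ?T"
    show "is_tau C t"
      unfolding is_tau_def
    proof (intro allI impI conjI)
      fix \<rho> :: "complex \<Rightarrow> real" and chi \<delta> assume h: "conformal_metric \<rho> \<and> admissible_regularization ?\<Omega> chi \<delta>"
      show "\<exists>!\<Phi>. critical_point (S_reg ?\<Omega> (chi \<epsilon>) (\<delta> \<epsilon>)) \<Phi> \<and> \<Phi> None = 0" if "\<epsilon> > 0" for \<epsilon>
        using reg h that by blast
      show "\<exists>Z. ((\<lambda>\<epsilon>. partition_reg \<rho> ?\<Omega> (chi \<epsilon>) (\<delta> \<epsilon>)) \<longlongrightarrow> Z) (at_right 0) \<and> t = Z / partition_0 \<rho>"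
      proof (intro exI conjI)
        show "((\<lambda>\<epsilon>. partition_reg \<rho> ?\<Omega> (chi \<epsilon>) (\<delta> \<epsilon>)) \<longlongrightarrow> partition_0 \<rho> * ?T) (at_right 0)"
          using lim h by blast
        have "partition_0 \<rho> \<noteq> 0" using partition_0_pos h by force
        then show "t = partition_0 \<rho> * ?T / partition_0 \<rho>" by (simp add: t)
      qed
    qed
  qed
qed

lemma inverted_log_energy:
  assumes \<Omega>: "open \<Omega>" "bounded \<Omega>"
  defines "p \<equiv> log_potential (indicat_real \<Omega>)"
  shows "(\<integral>z\<in>\<Omega>. (\<integral>w\<in>\<Omega>. ln (cmod (1 / z - 1 / w)) \<partial>lborel) \<partial>lborel)
    = (\<integral>z\<in>\<Omega>. p z \<partial>lborel) - 2 * area \<Omega> * p 0"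
proof -
  obtain R where R: "\<And>z. z \<in> \<Omega> \<Longrightarrow> cmod z \<le> R" using \<Omega>(2) unfolding bounded_iff by blast
  note ind = indicator_open_bounded[OF \<Omega>(1) R]
  note [measurable] = ind(1) and ind_int = ind(4) and ind_integral = ind(5)
  have p0: "p 0 = (LBINT w. ln (cmod w) * indicat_real \<Omega> w)"
    by (simp add: p_def log_potential_def)
  have ln_int: "integrable lborel (\<lambda>w. ln (cmod w) * indicat_real \<Omega> w)"
    using log_kernel_integrable[OF ind(1-3), of 0] by simp
  have p_int: "integrable lborel (\<lambda>z. indicat_real \<Omega> z * p z)"
    unfolding p_def by (rule integrable_log_potential_indicator[OF \<Omega>(1) R])
  have inv_meas: "(\<lambda>x::complex \<times> complex. ln (cmod (1 / fst x - 1 / snd x))) \<in> borel_measurable (lborel \<Otimes>\<^sub>M lborel)"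
  proof -
    have m: "(\<lambda>x::complex \<times> complex. 1 / fst x - 1 / snd x) \<in> borel_measurable (lborel \<Otimes>\<^sub>M lborel)"
      by measurable
    show ?thesis using measurable_compose[OF m ln_cmod_measurable] .
  qed
  have inner: "(LBINT w. indicat_real \<Omega> w * ln (cmod (1 / z - 1 / w))) = p z - area \<Omega> * ln (cmod z) - p 0"
    if z: "z \<noteq> 0" for z
  proof -
    have "(LBINT w. indicat_real \<Omega> w * ln (cmod (1 / z - 1 / w)))
        = (LBINT w. ln (cmod (z - w)) * indicat_real \<Omega> w - ln (cmod z) * indicat_real \<Omega> w - ln (cmod w) * indicat_real \<Omega> w)"
    proof (rule integral_cong_AE)
      have m: "(\<lambda>w. 1 / z - 1 / w) \<in> borel_measurable lborel" by measurable
      show "(\<lambda>w. indicat_real \<Omega> w * ln (cmod (1 / z - 1 / w))) \<in> borel_measurable lborel"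
        using measurable_compose[OF m ln_cmod_measurable] ind(1) by (intro borel_measurable_times) auto
      show "AE w in lborel. indicat_real \<Omega> w * ln (cmod (1 / z - 1 / w))
          = ln (cmod (z - w)) * indicat_real \<Omega> w - ln (cmod z) * indicat_real \<Omega> w - ln (cmod w) * indicat_real \<Omega> w"
        using AE_lborel_singleton[of 0] AE_lborel_singleton[of z]
      proof eventually_elim
        case (elim w)
        have "1 / z - 1 / w = (w - z) / (z * w)" using elim z by (simp add: field_simps)
        then have "cmod (1 / z - 1 / w) = cmod (z - w) / (cmod z * cmod w)"
          by (simp add: norm_divide norm_mult norm_minus_commute)
        then have "ln (cmod (1 / z - 1 / w)) = ln (cmod (z - w)) - ln (cmod z) - ln (cmod w)"
          using elim z by (simp add: ln_div ln_mult)
        then show ?case by (simp only: left_diff_distrib mult.commute[of "indicat_real \<Omega> w"])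
      qed
      show "(\<lambda>w. ln (cmod (z - w)) * indicat_real \<Omega> w - ln (cmod z) * indicat_real \<Omega> w - ln (cmod w) * indicat_real \<Omega> w)
          \<in> borel_measurable lborel"
        using log_kernel_integrable[OF ind(1-3), of z] ln_int ind_int by (intro borel_measurable_diff) auto
    qed
    also have "\<dots> = p z - area \<Omega> * ln (cmod z) - p 0"
      unfolding p0 using log_kernel_integrable[OF ind(1-3), of z] ln_int ind_int
      by (simp add: ind_integral p_def log_potential_def mult.commute[of _ "ln (cmod z)"] del: integral_indicator)
    finally show ?thesis .
  qed
  have "(\<integral>z\<in>\<Omega>. (\<integral>w\<in>\<Omega>. ln (cmod (1 / z - 1 / w)) \<partial>lborel) \<partial>lborel)
      = (LBINT z. indicat_real \<Omega> z * (LBINT w. indicat_real \<Omega> w * ln (cmod (1 / z - 1 / w))))"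
    by (simp add: set_lebesgue_integral_def)
  also have "\<dots> = (LBINT z. indicat_real \<Omega> z * p z - area \<Omega> * (ln (cmod z) * indicat_real \<Omega> z) - p 0 * indicat_real \<Omega> z)"
  proof (rule integral_cong_AE)
    have "(\<lambda>x::complex \<times> complex. indicat_real \<Omega> (snd x)) \<in> borel_measurable (lborel \<Otimes>\<^sub>M lborel)"
      using ind(1) by (intro measurable_compose[OF measurable_snd]) simp
    then have "(\<lambda>z. LBINT w. indicat_real \<Omega> w * ln (cmod (1 / z - 1 / w))) \<in> borel_measurable lborel"
      by (intro lborel.borel_measurable_lebesgue_integral)
         (unfold case_prod_beta', intro borel_measurable_times inv_meas)
    then show "(\<lambda>z. indicat_real \<Omega> z * (LBINT w. indicat_real \<Omega> w * ln (cmod (1 / z - 1 / w)))) \<in> borel_measurable lborel"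
      using ind(1) by (intro borel_measurable_times) auto
    show "AE z in lborel. indicat_real \<Omega> z * (LBINT w. indicat_real \<Omega> w * ln (cmod (1 / z - 1 / w)))
        = indicat_real \<Omega> z * p z - area \<Omega> * (ln (cmod z) * indicat_real \<Omega> z) - p 0 * indicat_real \<Omega> z"
      using AE_lborel_singleton[of 0]
    proof eventually_elim
      case (elim z)
      show ?case unfolding inner[OF elim] by (simp add: algebra_simps)
    qed
    show "(\<lambda>z. indicat_real \<Omega> z * p z - area \<Omega> * (ln (cmod z) * indicat_real \<Omega> z) - p 0 * indicat_real \<Omega> z) \<in> borel_measurable lborel"
      using p_int ln_int ind_int by (intro borel_measurable_diff) auto
  qed
  also have "\<dots> = (LBINT z. indicat_real \<Omega> z * p z) - area \<Omega> * p 0 - p 0 * area \<Omega>"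
    using p_int ln_int ind_int by (simp add: ind_integral p0 del: integral_indicator)
  finally show ?thesis by (simp add: set_lebesgue_integral_def)
qed

theorem proposition2p1:
  fixes C \<Omega> :: "complex set"
  assumes "smooth_jordan_curve C"
    and "0 \<in> inside C"
    and "\<Omega> = inside C"
  shows "(\<exists>!t. is_tau C t) \<and> tau C > 0 \<and>
    ln (tau C) =
      - (1 / pi\<^sup>2) * (\<integral>z\<in>\<Omega>. (\<integral>w\<in>\<Omega>. ln (cmod (z - w)) \<partial>lborel) \<partial>lborel)
      + (2 / pi\<^sup>2) * area \<Omega> * (\<integral>z\<in>\<Omega>. ln (cmod z) \<partial>lborel) \<and>
    ln (tau C) =
      - (1 / pi\<^sup>2) * (\<integral>z\<in>\<Omega>. (\<integral>w\<in>\<Omega>. ln (cmod (1 / z - 1 / w)) \<partial>lborel) \<partial>lborel)"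
proof -
  have C: "compact C" by (rule smooth_jordan_curve_compact[OF assms(1)])
  have \<Omega>: "open \<Omega>" "bounded \<Omega>" "0 \<in> \<Omega>"
    using C assms(2) unfolding assms(3)
    by (auto intro: open_inside bounded_inside compact_imp_closed compact_imp_bounded)
  define p where "p = log_potential (indicat_real \<Omega>)"
  define T where "T = - (1 / pi\<^sup>2) * ((\<integral>z\<in>\<Omega>. p z \<partial>lborel) - 2 * area \<Omega> * p 0)"
  have tau_iff: "is_tau C t \<longleftrightarrow> t = exp T" for t
    using is_tau_iff[of C t] \<Omega> unfolding assms(3) T_def p_def by blast
  have tau: "tau C = exp T" unfolding tau_def tau_iff by simp
  have p_eq: "p z = (\<integral>w\<in>\<Omega>. ln (cmod (z - w)) \<partial>lborel)" for z
    by (simp add: p_def log_potential_def set_lebesgue_integral_def mult.commute)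
  have p0: "p 0 = (\<integral>w\<in>\<Omega>. ln (cmod w) \<partial>lborel)" unfolding p_eq by simp
  have T1: "T = - (1 / pi\<^sup>2) * (\<integral>z\<in>\<Omega>. (\<integral>w\<in>\<Omega>. ln (cmod (z - w)) \<partial>lborel) \<partial>lborel)
      + (2 / pi\<^sup>2) * area \<Omega> * (\<integral>z\<in>\<Omega>. ln (cmod z) \<partial>lborel)"
    unfolding T_def p0 p_eq by (simp add: algebra_simps)
  have T2: "T = - (1 / pi\<^sup>2) * (\<integral>z\<in>\<Omega>. (\<integral>w\<in>\<Omega>. ln (cmod (1 / z - 1 / w)) \<partial>lborel) \<partial>lborel)"
    unfolding T_def inverted_log_energy[OF \<Omega>(1,2)] p_def ..
  have "\<exists>!t. is_tau C t" unfolding tau_iff by simp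
  moreover have "tau C > 0" "ln (tau C) = T" by (simp_all add: tau)
  ultimately show ?thesis using T1 T2 by auto
qed

end
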